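(* Let $g:[0,\infty)\to[0,\infty)$ with $0<\rho=\int_0^\infty g(t)\,\mathrm{d}t<1$, and consider the Hawkes process cluster with excitation kernel $g$, with arrival epochs $0=A_0<A_1<\dots<A_{N-1}$ and total size $N$ (including the initial time-$0$ event). Let $G(t)=\int_0^t g(u)\,\mathrm{d}u$ and let $\Lambda_i=\sum_{j=0}^{i-1}G(A_i-A_j)$, $1\le i\le N-1$, be the compensator-transformed arrival epochs. Let $k\in\mathbb{N}$. Given that the Hawkes process cluster is comprised of $N=k+1$ events, the compensator-transformed arrival epochs $\Lambda_1,\dots,\Lambda_k$ are such that $$\Lambda_i\stackrel{\mathsf{D}}{=}\rho\cdot(\pi-U)_{(i)}\qquad\text{for all } i\in\{1,\dots,k\},$$ where $(\pi-U)_{(1)}<\dots<(\pi-U)_{(k)}$ are the increasingly sorted entries of $\pi-U=(\pi_1-U_1,\dots,\pi_k-U_k)$, with $\pi\in\mathsf{PF}_k$ a parking function of length $k$ drawn uniformly at random, and $U=(U_1,\dots,U_k)\in(0,1)^k$ a vector of $k$ i.i.d. standard uniform random variables, independent of $\pi$.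
   Context: Hawkes process cluster with excitation kernel $g$: a point process $(N_t)_{t\ge0}$ with natural filtration $(\mathcal{F}_t)$, started with one event at time $A_0=0$ (which is counted by $N_t$), with epochs $A_0<A_1<\cdots$, such that as $\delta\downarrow 0$, $\mathrm{P}(N_{t+\delta}-N_t=1\mid\mathcal{F}_t)=\lambda_t\delta+o(\delta)$, $\mathrm{P}(N_{t+\delta}-N_t=0\mid\mathcal{F}_t)=1-\lambda_t\delta+o(\delta)$, $\mathrm{P}(N_{t+\delta}-N_t>1\mid\mathcal{F}_t)=o(\delta)$, where the conditional intensity is $\lambda_t=\sum_{i=0}^{N_t-1}g(t-A_i)$ (there is no exogenous baseline intensity). Equivalently (Hawkes and Oakes), starting from the time-$0$ event, each event at time $s$ independently generates direct offspring according to an inhomogeneous Poisson process with rate $g(t-s)$, $t>s$, and the cluster consists of the initial event and all its descendants. Since $\rho<1$, the cluster size $N=\lim_{t\to\infty}N_t$ is almost surely finite. The compensator is $\Lambda(t)=\int_0^t\lambda_s\,\mathrm{d}s$, and $\Lambda_i=\Lambda(A_i)$. The symbol $\stackrel{\mathsf{D}}{=}$ denotes equality in distribution, here under the conditional law given $N=k+1$. Parking function of length $k$: a vector $\pi$ of $k$ positive integers whose increasingly sorted entries $\pi_{(1)}\le\dots\le\pi_{(k)}$ satisfy $\pi_{(i)}\le i$ for each $i\in\{1,\dots,k\}$. $\mathsf{PF}_k$ is the (finite) set of all parking functions of length $k$. *)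

theory Defs
  imports "HOL-Probability.Probability"
begin

section \<open>Simple point processes on the half-line\<close>

text \<open>
  A point process started with an event at time 0 is given by its epochs
  \<open>A 0 < A 1 < ...\<close>, with the convention that \<open>A i \<omega> = \<infinity>\<close> when there are at most \<open>i\<close>
  events. The last clause says that the process is locally finite.
\<close>

definition point_process :: "'a measure \<Rightarrow> (nat \<Rightarrow> 'a \<Rightarrow> ereal) \<Rightarrow> bool" where
  "point_process M A \<longleftrightarrow>
     (\<forall>i. A i \<in> borel_measurable M) \<and>
     (\<forall>\<omega>\<in>space M.
        A 0 \<omega> = 0 \<and>
        (\<forall>i. A i \<omega> < \<infinity> \<longrightarrow> A i \<omega> < A (Suc i) \<omega>) \<and>
        (\<forall>i. A i \<omega> = \<infinity> \<longrightarrow> A (Suc i) \<omega> = \<infinity>) \<and>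
        (\<forall>t::real. finite {i. A i \<omega> \<le> ereal t}))"

definition num_events :: "(nat \<Rightarrow> 'a \<Rightarrow> ereal) \<Rightarrow> real \<Rightarrow> 'a \<Rightarrow> nat" where
  "num_events A t \<omega> = card {i. A i \<omega> \<le> ereal t}"

text \<open>The limit of the counting process as time tends to infinity.\<close>

definition cluster_size :: "(nat \<Rightarrow> 'a \<Rightarrow> ereal) \<Rightarrow> 'a \<Rightarrow> enat" where
  "cluster_size A \<omega> = (SUP t\<in>{0..}. enat (num_events A t \<omega>))"

definition natural_filtration :: "'a measure \<Rightarrow> (real \<Rightarrow> 'a \<Rightarrow> nat) \<Rightarrow> real \<Rightarrow> 'a measure" where
  "natural_filtration M X t = sigma (space M) {X s -` B \<inter> space M | s B. 0 \<le> s \<and> s \<le> t}"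

definition martingale_wrt :: "'a measure \<Rightarrow> (real \<Rightarrow> 'a measure) \<Rightarrow> (real \<Rightarrow> 'a \<Rightarrow> real) \<Rightarrow> bool" where
  "martingale_wrt M F X \<longleftrightarrow>
     (\<forall>t\<ge>0. X t \<in> borel_measurable (F t) \<and> integrable M (X t)) \<and>
     (\<forall>s t. 0 \<le> s \<longrightarrow> s \<le> t \<longrightarrow> (AE \<omega> in M. real_cond_exp M (F s) (X t) \<omega> = X s \<omega>))"


section \<open>The Hawkes process cluster\<close>

text \<open>Only the values of the kernel \<open>g\<close> on \<open>[0, \<infinity>)\<close> enter the definitions below.\<close>

definition kernel_mass :: "(real \<Rightarrow> real) \<Rightarrow> real" where
  "kernel_mass g = (LBINT u:{0..}. g u)"

definition kernel_int :: "(real \<Rightarrow> real) \<Rightarrow> real \<Rightarrow> real" where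
  "kernel_int g t = (LBINT u:{0..t}. g u)"

definition intensity :: "(real \<Rightarrow> real) \<Rightarrow> (nat \<Rightarrow> 'a \<Rightarrow> ereal) \<Rightarrow> real \<Rightarrow> 'a \<Rightarrow> real" where
  "intensity g A t \<omega> = (\<Sum>i<num_events A t \<omega>. g (t - real_of_ereal (A i \<omega>)))"

definition compensator :: "(real \<Rightarrow> real) \<Rightarrow> (nat \<Rightarrow> 'a \<Rightarrow> ereal) \<Rightarrow> real \<Rightarrow> 'a \<Rightarrow> real" where
  "compensator g A t \<omega> = (LBINT s:{0..t}. intensity g A s \<omega>)"

text \<open>
  The point process has conditional intensity \<open>intensity g A\<close> with respect to its natural
  filtration \<open>F\<close>, i.e. \<open>compensator g A\<close> is its \<open>F\<close>-compensator: the process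
  \<open>num_events A - compensator g A\<close> is an \<open>F\<close>-local martingale, with the epochs
  \<open>A n\<close> as localising sequence (stopped at \<open>A n\<close> the process is bounded, because at most
  \<open>n + 1\<close> events have occurred by then).

  This is the integrated form of the heuristic
  \<open>P(N(t + \<delta>) - N(t) = 1 | F t) = intensity t * \<delta> + o(\<delta>)\<close>,
  \<open>P(N(t + \<delta>) - N(t) > 1 | F t) = o(\<delta>)\<close> as \<open>\<delta>\<close> decreases to 0. The latter does not
  determine the law when it is read pointwise in \<open>t\<close> (a process with an atom at a fixed time
  may satisfy it), and for a kernel that is merely integrable it can fail
  for individual \<open>t\<close> (it is sensitive to changes of \<open>g\<close> on null sets).
  That there are no multiple events is part of \<open>point_process\<close>.
\<close>

definition hawkes_cluster :: "'a measure \<Rightarrow> (real \<Rightarrow> real) \<Rightarrow> (nat \<Rightarrow> 'a \<Rightarrow> ereal) \<Rightarrow> bool" where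
  "hawkes_cluster M g A \<longleftrightarrow>
     prob_space M \<and> point_process M A \<and>
     (\<forall>n. martingale_wrt M (natural_filtration M (num_events A))
        (\<lambda>t \<omega>. let \<tau> = real_of_ereal (min (ereal t) (A n \<omega>))
                in real (num_events A \<tau> \<omega>) - compensator g A \<tau> \<omega>))"

text \<open>
  The compensator evaluated at the epoch \<open>A i\<close>; only meaningful where \<open>A i \<omega> < \<infinity>\<close>.
\<close>

definition transformed_epoch :: "(real \<Rightarrow> real) \<Rightarrow> (nat \<Rightarrow> 'a \<Rightarrow> ereal) \<Rightarrow> nat \<Rightarrow> 'a \<Rightarrow> real" where
  "transformed_epoch g A i \<omega> =
     (\<Sum>j<i. kernel_int g (real_of_ereal (A i \<omega>) - real_of_ereal (A j \<omega>)))"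

text \<open>The conditional probability measure given that the cluster has exactly \<open>n\<close> events.\<close>

definition given_cluster_size :: "'a measure \<Rightarrow> (nat \<Rightarrow> 'a \<Rightarrow> ereal) \<Rightarrow> nat \<Rightarrow> 'a measure" where
  "given_cluster_size M A n = uniform_measure M {\<omega> \<in> space M. cluster_size A \<omega> = enat n}"


section \<open>Parking functions\<close>

text \<open>List positions count from 0, so the \<open>i\<close>-th smallest entry is \<open>sort p ! (i - 1)\<close>.\<close>

definition parking_functions :: "nat \<Rightarrow> nat list set" where
  "parking_functions k =
     {p. length p = k \<and> (\<forall>x\<in>set p. 0 < x) \<and> (\<forall>i\<in>{1..k}. sort p ! (i - 1) \<le> i)}"

lemma finite_parking_functions: "finite (parking_functions k)"
proof -
  have "parking_functions k \<subseteq> {p. set p \<subseteq> {..k} \<and> length p = k}"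
  proof (clarsimp simp: parking_functions_def)
    fix p x assume *: "\<forall>i\<in>{Suc 0..length p}. sort p ! (i - Suc 0) \<le> i" "x \<in> set p"
    then obtain j where "j < length p" "sort p ! j = x"
      by (metis in_set_conv_nth length_sort set_sort)
    with *(1)[rule_format, of "Suc j"] show "x \<le> length p" by auto
  qed
  then show ?thesis
    by (rule finite_subset) (rule finite_lists_length_eq[OF finite_atMost])
qed

lemma parking_functions_nonempty: "parking_functions k \<noteq> {}"
proof -
  have "sort (replicate k 1) = replicate k (1::nat)"
    by (rule sorted_sort_id) simp
  then have "replicate k 1 \<in> parking_functions k"
    by (auto simp: parking_functions_def)
  then show ?thesis by blast
qed

text \<open>
  The joint law of a uniformly random parking function of length \<open>k\<close> and an independent
  vector, indexed by \<open>{..<k}\<close>, of independent uniform random variables on \<open>(0, 1)\<close>.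
\<close>

definition parking_uniform :: "nat \<Rightarrow> (nat list \<times> (nat \<Rightarrow> real)) measure" where
  "parking_uniform k =
     measure_pmf (pmf_of_set (parking_functions k)) \<Otimes>\<^sub>M
     (\<Pi>\<^sub>M j\<in>{..<k}. uniform_measure lborel {0<..<1})"

text \<open>The \<open>i\<close>-th smallest entry, \<open>1 \<le> i \<le> k\<close>, of the vector \<open>p - u\<close>.\<close>

definition diff_order_stat :: "nat \<Rightarrow> nat list \<times> (nat \<Rightarrow> real) \<Rightarrow> real" where
  "diff_order_stat i = (\<lambda>(p, u). sort (map (\<lambda>j. real (p ! j) - u j) [0..<length p]) ! (i - 1))"

end

theory Submission
  imports Defs
begin

text \<open>
  Measured in compensator time, a cluster is a unit-rate Poisson process that is killed at the first
  moment when the events so far have used up their total intensity: after \<open>n\<close> further events the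
  compensator cannot exceed \<open>(n + 1) \<rho>\<close>. The martingale property gives the conditional hazard rate of
  the next epoch, and substituting the compensator for time makes this rate equal to 1. Weighting by
  \<open>exp \<Lambda>\<^sub>n\<close> on the event of at least \<open>n\<close> further events therefore turns the law of \<open>(\<Lambda>\<^sub>1, \<dots>, \<Lambda>\<^sub>n)\<close>
  into Lebesgue measure on \<open>{0 < x\<^sub>1 < \<dots> < x\<^sub>n, x\<^sub>i \<le> i \<rho>}\<close>, by induction on \<open>n\<close>. Given exactly \<open>k + 1\<close>
  events the weight is the constant \<open>exp (-(k + 1) \<rho>)\<close>, so the law is uniform on this set.

  On the other side, \<open>\<rho> (\<pi> - U)\<close> is uniform on a union of cubes with side \<open>\<rho>\<close>, one for each parking
  function; a point lies in this union exactly if its sorted version lies in the set above, and sorting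
  folds the \<open>k!\<close> orderings of the coordinates onto it.
\<close>

section \<open>Sorting and parking functions\<close>

text \<open>The hazard identity has the unknown on both sides: the intensity is integrated only up
  to the next event, whose law is sought. It is solved by testing it against \<open>exp\<close>,
  which is its own antiderivative: in compensator time, \<open>exp\<close> at the start of a stretch
  between events plus its integral over the stretch is \<open>exp\<close> at the end. If the stretch
  is cut off at a level \<open>x\<close>, the paths with a next event below \<open>x\<close> produce
  the same finite term on both sides. What remains says that survival up to \<open>x\<close>, below
  the exhaustion level, costs the factor \<open>exp (te n - x)\<close>.

  The compensator is flat wherever \<open>g\<close> contributes nothing, so time is not a function
  of it. The substitution is therefore made on measures, through the cdf of the accumulated
  intensity.

  The volume of the region is never computed. Both laws are constant multiples of one restricted
  Lebesgue measure, and total mass 1 on the parking side fixes the constants; the same equation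
  shows that the conditioning event has positive probability.\<close>

lemma sort_map_permutes:
  fixes x :: "nat \<Rightarrow> 'b::linorder"
  assumes s: "s permutes {..<k}" and inc: "\<And>i j. i < j \<Longrightarrow> j < k \<Longrightarrow> x (s i) \<le> x (s j)"
  shows "sort (map x [0..<k]) = map (\<lambda>i. x (s i)) [0..<k]"
proof (rule properties_for_sort)
  have "image_mset s (mset_set {..<k}) = mset_set {..<k}"
    using s by (rule permutes_image_mset)
  then have "image_mset x (image_mset s (mset_set {..<k})) = image_mset x (mset_set {..<k})"
    by simp
  then have "image_mset (\<lambda>i. x (s i)) (mset_set {..<k}) = image_mset x (mset_set {..<k})"
    by (simp add: multiset.map_comp comp_def)
  then show "mset (map (\<lambda>i. x (s i)) [0..<k]) = mset (map x [0..<k])"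
    by (simp add: atLeast0LessThan)
  show "sorted (map (\<lambda>i. x (s i)) [0..<k])"
    using inc by (auto simp: sorted_iff_nth_mono_less)
qed

text \<open>Two sorting permutations produce the same sorted list of values, and injectivity carries
  equality of values over to equality of indices.\<close>

lemma ex1_sorting_permutation:
  fixes x :: "nat \<Rightarrow> 'b::linorder"
  assumes inj: "inj_on x {..<k}"
  shows "\<exists>!s. s permutes {..<k} \<and> (\<forall>i j. i < j \<longrightarrow> j < k \<longrightarrow> x (s i) < x (s j))"
proof -
  let ?xs = "map x [0..<k]"
  obtain s where s: "s permutes {..<length ?xs}" "permute_list s ?xs = sort ?xs"
    using mset_eq_permutation[of "sort ?xs" ?xs] by auto
  have sk: "s permutes {..<k}" using s(1) by simp
  have nth: "sort ?xs ! i = x (s i)" if "i < k" for i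
    using that permutes_in_image[OF sk, of i] by (simp add: permute_list_def flip: s(2))
  have strict: "x (s i) < x (s j)" if "i < j" "j < k" for i j
  proof -
    have "x (s i) \<le> x (s j)"
      using sorted_nth_mono[OF sorted_sort[of ?xs], of i j] that by (simp add: nth)
    moreover have "s i \<noteq> s j" using permutes_inj[OF sk] that by (auto dest: injD)
    then have "x (s i) \<noteq> x (s j)"
      using inj_on_eq_iff[OF inj, of "s i" "s j"] that
        permutes_in_image[OF sk, of i] permutes_in_image[OF sk, of j] by simp
    ultimately show ?thesis by simp
  qed
  show ?thesis
  proof (rule ex1I[of _ s])
    show "s permutes {..<k} \<and> (\<forall>i j. i < j \<longrightarrow> j < k \<longrightarrow> x (s i) < x (s j))"
      using sk strict by auto
    fix t assume t: "t permutes {..<k} \<and> (\<forall>i j. i < j \<longrightarrow> j < k \<longrightarrow> x (t i) < x (t j))"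
    then have tk: "t permutes {..<k}" by simp
    have "sort ?xs = map (\<lambda>i. x (t i)) [0..<k]"
      using t by (intro sort_map_permutes[OF tk]) (simp add: less_imp_le)
    moreover have "sort ?xs = map (\<lambda>i. x (s i)) [0..<k]"
      using strict by (intro sort_map_permutes[OF sk]) (simp add: less_imp_le)
    ultimately have "x (t i) = x (s i)" if "i < k" for i
      using that by simp
    then have "t i = s i" if "i < k" for i
      using inj_on_eq_iff[OF inj, of "t i" "s i"] that
        permutes_in_image[OF sk, of i] permutes_in_image[OF tk, of i] by simp
    then show "t = s"
      using permutes_not_in[OF tk] permutes_not_in[OF sk] by (intro ext) (metis lessThan_iff)
  qed
qed

text \<open>The entries up to \<open>a\<close> form a prefix of a sorted list, so a bound on one
  position is a statement about how many entries satisfy it.\<close>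

lemma sorted_nth_le_iff:
  fixes xs :: "'b::linorder list"
  assumes "sorted xs" "m < length xs"
  shows "xs ! m \<le> a \<longleftrightarrow> m < length (filter (\<lambda>x. x \<le> a) xs)"
  using assms
proof (induction xs arbitrary: m)
  case (Cons y ys)
  show ?case
  proof (cases "y \<le> a")
    case True
    then show ?thesis using Cons by (cases m) auto
  next
    case False
    then have "filter (\<lambda>x. x \<le> a) ys = []"
      using Cons.prems by (auto simp: filter_empty_conv)
    moreover have "y \<le> (y # ys) ! m"
      using Cons.prems by (cases m) auto
    ultimately show ?thesis using False by auto
  qed
qed simp

lemma sort_nth_le_iff:
  fixes x :: "nat \<Rightarrow> 'b::linorder"
  assumes "m < k"
  shows "sort (map x [0..<k]) ! m \<le> a \<longleftrightarrow> m < card {j\<in>{..<k}. x j \<le> a}"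
proof -
  have "length (filter (\<lambda>y. y \<le> a) (sort (map x [0..<k]))) = length (filter (\<lambda>y. y \<le> a) (map x [0..<k]))"
    by (metis filter_sort length_sort)
  also have "\<dots> = card {j\<in>{..<k}. x j \<le> a}"
    by (simp add: filter_map comp_def length_filter_conv_card lessThan_def conj_commute cong: conj_cong)
  finally show ?thesis
    using assms by (simp add: sorted_nth_le_iff)
qed

text \<open>Sublevel sets of an order statistic are counting conditions, so measurability reduces to
  that of a finite sum of indicators.\<close>

lemma borel_measurable_sort_nth:
  assumes m: "m < k" and x[measurable]: "\<And>j. j < k \<Longrightarrow> (\<lambda>\<omega>. x \<omega> j) \<in> borel_measurable M"
  shows "(\<lambda>\<omega>. sort (map (x \<omega>) [0..<k]) ! m :: real) \<in> borel_measurable M"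
  unfolding borel_measurable_iff_le
proof
  fix a :: real
  have "card {j\<in>{..<k}. x \<omega> j \<le> a} = (\<Sum>j<k. if x \<omega> j \<le> a then 1 else 0)" for \<omega>
    by (simp add: sum.If_cases Int_def)
  then have "{\<omega>\<in>space M. sort (map (x \<omega>) [0..<k]) ! m \<le> a} =
      {\<omega>\<in>space M. m < (\<Sum>j<k. if x \<omega> j \<le> a then 1 else 0)}"
    using m by (simp add: sort_nth_le_iff)
  also have "\<dots> \<in> sets M" by measurable
  finally show "{\<omega>\<in>space M. sort (map (x \<omega>) [0..<k]) ! m \<le> a} \<in> sets M" .
qed

section \<open>The chamber of sorted points and the cubes of parking functions\<close>

definition parking_chamber :: "real \<Rightarrow> nat \<Rightarrow> (nat \<Rightarrow> real) set" where
  "parking_chamber r k = {y \<in> {1..k} \<rightarrow>\<^sub>E UNIV.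
     \<forall>i\<in>{1..k}. 0 < y i \<and> y i \<le> r * i \<and> (\<forall>j\<in>{1..k}. i < j \<longrightarrow> y i < y j)}"

text \<open>The intervals are half-open so that \<open>p ! j\<close> is the rounded-up quotient of the \<open>j\<close>-th coordinate and \<open>r\<close>.\<close>

definition parking_box :: "real \<Rightarrow> nat list \<Rightarrow> (nat \<Rightarrow> real) set" where
  "parking_box r p = (\<Pi>\<^sub>E j\<in>{..<length p}. {r * (real (p ! j) - 1)<..r * real (p ! j)})"

text \<open>The half-open cubes are disjoint, and the only candidate for the one containing
  \<open>x\<close> is found by rounding up. Rounding is monotone and so is compatible with sorting:
  the parking condition on the rounded vector reads \<open>x (s j) \<le> r * Suc j\<close>, which is
  the upper bound in the chamber.\<close>

lemma sum_parking_box: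
  fixes x :: "nat \<Rightarrow> real"
  assumes r: "0 < r" and x: "x \<in> extensional {..<k}" and s: "s permutes {..<k}"
    and inc: "\<And>i j. i < j \<Longrightarrow> j < k \<Longrightarrow> x (s i) < x (s j)"
  shows "(\<Sum>p\<in>parking_functions k. indicator (parking_box r p) x :: ennreal) =
         indicator (parking_chamber r k) (\<lambda>i\<in>{1..k}. x (s (i - 1)))"
proof -
  \<comment> \<open>\<open>nat\<close> sends nonpositive ceilings to 0, which is never an entry of a
    parking function; positivity of \<open>x\<close> is therefore recorded alongside.\<close>
  define c where "c j = nat \<lceil>x j / r\<rceil>" for j
  let ?c = "map c [0..<k]"
  have box: "x \<in> parking_box r p \<longleftrightarrow> p = ?c \<and> (\<forall>j<k. 0 < x j)"
    if p: "p \<in> parking_functions k" for p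
  proof -
    have len: "length p = k" and pos: "\<And>j. j < k \<Longrightarrow> 0 < p ! j"
      using p by (auto simp: parking_functions_def)
    have "x j \<in> {r * (real (p ! j) - 1)<..r * real (p ! j)} \<longleftrightarrow> p ! j = c j \<and> 0 < x j"
      if j: "j < k" for j
    proof -
      have "x j \<in> {r * (real (p ! j) - 1)<..r * real (p ! j)} \<longleftrightarrow> \<lceil>x j / r\<rceil> = int (p ! j)"
        using r by (auto simp: ceiling_eq_iff field_simps)
      also have "\<dots> \<longleftrightarrow> p ! j = c j \<and> 0 < x j"
      proof -
        have "0 < \<lceil>x j / r\<rceil> \<longleftrightarrow> 0 < x j"
          using r by (simp add: zero_less_divide_iff)
        then show ?thesis
          using pos[OF j] unfolding c_def by linarith
      qed
      finally show ?thesis .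
    qed
    then show ?thesis
      using x len by (auto simp: parking_box_def PiE_iff list_eq_iff_nth_eq)
  qed
  have c_mono: "c i \<le> c j" if "x i \<le> x j" for i j
    unfolding c_def using r that by (intro nat_mono ceiling_mono divide_right_mono) auto
  have sort_c: "sort ?c = map (\<lambda>i. c (s i)) [0..<k]"
    by (rule sort_map_permutes[OF s]) (rule c_mono, rule less_imp_le, rule inc)
  have s_all: "(\<forall>j<k. P (s j)) \<longleftrightarrow> (\<forall>j<k. P j)" for P
  proof -
    have "(\<forall>j\<in>s ` {..<k}. P j) \<longleftrightarrow> (\<forall>j\<in>{..<k}. P j)"
      by (simp only: permutes_image[OF s])
    then show ?thesis by auto
  qed
  have cle: "c j \<le> n \<longleftrightarrow> x j \<le> r * n" for j n
    using r by (simp add: c_def nat_le_iff ceiling_le_iff field_simps)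
  have PF: "?c \<in> parking_functions k \<longleftrightarrow> (\<forall>j<k. x (s j) \<le> r * real (Suc j))"
    if pos: "\<forall>j<k. 0 < x j"
  proof -
    have "0 < c j" if "j < k" for j
      using pos r that by (simp add: c_def)
    then have "?c \<in> parking_functions k \<longleftrightarrow> (\<forall>i\<in>{1..k}. map (\<lambda>i. c (s i)) [0..<k] ! (i - 1) \<le> i)"
      by (auto simp: parking_functions_def sort_c)
    also have "\<dots> \<longleftrightarrow> (\<forall>j<k. c (s j) \<le> Suc j)"
      unfolding image_Suc_lessThan[symmetric] by auto
    finally show ?thesis by (simp only: cle)
  qed
  have ch: "(\<lambda>i\<in>{1..k}. x (s (i - 1))) \<in> parking_chamber r k \<longleftrightarrow>
      (\<forall>j<k. 0 < x (s j) \<and> x (s j) \<le> r * real (Suc j))"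
    unfolding parking_chamber_def image_Suc_lessThan[symmetric] by (auto intro!: inc)
  have "(\<Sum>p\<in>parking_functions k. indicator (parking_box r p) x :: ennreal) =
        (\<Sum>p\<in>parking_functions k. if p = ?c then (if \<forall>j<k. 0 < x j then 1 else 0) else 0)"
    by (rule sum.cong) (auto simp: box indicator_def)
  also have "\<dots> = (if ?c \<in> parking_functions k \<and> (\<forall>j<k. 0 < x j) then 1 else 0)"
    by (simp add: sum.delta finite_parking_functions)
  also have "\<dots> = indicator (parking_chamber r k) (\<lambda>i\<in>{1..k}. x (s (i - 1)))"
    unfolding indicator_def using PF ch s_all[of "\<lambda>j. 0 < x j"] by (auto split: if_splits)
  finally show ?thesis .
qed

section \<open>Product measures: relabelling, ties, uniform cubes\<close>

text \<open>The index sets may differ, so that one application both permutes the coordinates and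
  passes from list positions \<open>{..<k}\<close> to epoch numbers \<open>{1..k}\<close>.\<close>

lemma (in sigma_finite_measure) distr_PiM_bij:
  assumes fin: "finite J" and b: "bij_betw b J I"
  shows "distr (\<Pi>\<^sub>M i\<in>I. M) (\<Pi>\<^sub>M j\<in>J. M) (\<lambda>x. \<lambda>j\<in>J. x (b j)) = (\<Pi>\<^sub>M j\<in>J. M)"
proof -
  interpret P: product_sigma_finite "\<lambda>_. M"
    by (rule product_sigma_finite.intro) (rule sigma_finite_measure_axioms)
  have finI: "finite I" using b fin bij_betw_finite by blast
  have mem: "b j \<in> I" if "j \<in> J" for j using b that by (auto simp: bij_betw_def)
  let ?c = "inv_into J b"
  have c: "?c i \<in> J" "b (?c i) = i" if "i \<in> I" for i
    using b that by (auto simp: bij_betw_def inv_into_into f_inv_into_f)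
  have cb: "?c (b j) = j" if "j \<in> J" for j
    using b that by (auto simp: bij_betw_def)
  have meas[measurable]: "(\<lambda>x. \<lambda>j\<in>J. x (b j)) \<in> measurable (\<Pi>\<^sub>M i\<in>I. M) (\<Pi>\<^sub>M j\<in>J. M)"
    by (rule measurable_restrict) (auto intro!: measurable_component_singleton mem)
  show ?thesis
  proof (rule P.PiM_eqI[OF fin])
    fix A assume A: "\<And>j. j \<in> J \<Longrightarrow> A j \<in> sets M"
    have "(\<lambda>x. \<lambda>j\<in>J. x (b j)) -` Pi\<^sub>E J A \<inter> space (\<Pi>\<^sub>M i\<in>I. M) = (\<Pi>\<^sub>E i\<in>I. A (?c i))"
    proof (intro equalityI subsetI)
      fix x assume "x \<in> (\<lambda>x. \<lambda>j\<in>J. x (b j)) -` Pi\<^sub>E J A \<inter> space (\<Pi>\<^sub>M i\<in>I. M)"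
      then have x: "\<And>j. j \<in> J \<Longrightarrow> x (b j) \<in> A j" "x \<in> extensional I"
        by (auto simp: PiE_iff space_PiM)
      show "x \<in> (\<Pi>\<^sub>E i\<in>I. A (?c i))"
        using x(1)[OF c(1)] x(2) c(2) by (auto simp: PiE_iff)
    next
      fix x assume x: "x \<in> (\<Pi>\<^sub>E i\<in>I. A (?c i))"
      have "x (b j) \<in> A j" if "j \<in> J" for j
        using x mem[OF that] cb[OF that] by (auto simp: PiE_iff)
      moreover have "A (?c i) \<subseteq> space M" if "i \<in> I" for i
        using A[OF c(1)[OF that]] by (rule sets.sets_into_space)
      ultimately show "x \<in> (\<lambda>x. \<lambda>j\<in>J. x (b j)) -` Pi\<^sub>E J A \<inter> space (\<Pi>\<^sub>M i\<in>I. M)"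
        using x by (auto simp: PiE_iff space_PiM)
    qed
    then have "emeasure (distr (\<Pi>\<^sub>M i\<in>I. M) (\<Pi>\<^sub>M j\<in>J. M) (\<lambda>x. \<lambda>j\<in>J. x (b j))) (Pi\<^sub>E J A) =
        emeasure (\<Pi>\<^sub>M i\<in>I. M) (\<Pi>\<^sub>E i\<in>I. A (?c i))"
      using A fin by (subst emeasure_distr) (auto intro!: sets_PiM_I_finite)
    also have "\<dots> = (\<Prod>i\<in>I. emeasure M (A (?c i)))"
      using A c by (intro P.emeasure_PiM[OF finI]) auto
    also have "\<dots> = (\<Prod>j\<in>J. emeasure M (A (?c (b j))))"
      by (rule prod.reindex_bij_betw[OF b, symmetric])
    also have "\<dots> = (\<Prod>j\<in>J. emeasure M (A j))"
      by (rule prod.cong) (simp_all add: cb)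
    finally show "emeasure (distr (\<Pi>\<^sub>M i\<in>I. M) (\<Pi>\<^sub>M j\<in>J. M) (\<lambda>x. \<lambda>j\<in>J. x (b j))) (Pi\<^sub>E J A) =
        (\<Prod>j\<in>J. emeasure M (A j))" .
  qed simp
qed

text \<open>By Fubini: with the other coordinates fixed, a tie between \<open>i\<close> and
  \<open>j\<close> confines coordinate \<open>i\<close> to the single point
  \<open>x j\<close>.\<close>

lemma AE_PiM_lborel_inj_on:
  assumes fin: "finite I"
  shows "AE x in (\<Pi>\<^sub>M i\<in>I. (lborel :: real measure)). inj_on x I"
proof -
  interpret P: product_sigma_finite "\<lambda>_. lborel :: real measure"
    by (rule product_sigma_finite.intro) (rule lborel.sigma_finite_measure_axioms)
  have "AE x in (\<Pi>\<^sub>M i\<in>I. (lborel :: real measure)). x i \<noteq> x j"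
    if ij: "i \<in> I" "j \<in> I" "i \<noteq> j" for i j
  proof -
    have I: "insert i (I - {i}) = I" using ij by auto
    let ?f = "\<lambda>x. indicator {0} (x i - x j :: real) :: ennreal"
    have fm[measurable]: "?f \<in> borel_measurable (\<Pi>\<^sub>M i\<in>I. (lborel :: real measure))"
    proof -
      have [measurable]: "(\<lambda>x. x i) \<in> borel_measurable (\<Pi>\<^sub>M i\<in>I. borel :: real measure)"
        "(\<lambda>x. x j) \<in> borel_measurable (\<Pi>\<^sub>M i\<in>I. borel :: real measure)"
        using ij by (auto intro: measurable_component_singleton)
      show ?thesis by measurable
    qed
    have "(\<integral>\<^sup>+x. ?f x \<partial>(\<Pi>\<^sub>M i\<in>I. (lborel :: real measure))) =
        (\<integral>\<^sup>+x. (\<integral>\<^sup>+y. ?f (x(i := y)) \<partial>lborel) \<partial>(\<Pi>\<^sub>M i\<in>I - {i}. (lborel :: real measure)))"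
      using P.product_nn_integral_insert[of "I - {i}" i ?f, unfolded I, OF _ _ fm] fin by simp
    also have "\<dots> = (\<integral>\<^sup>+x. (\<integral>\<^sup>+y. indicator {x j} y \<partial>lborel) \<partial>(\<Pi>\<^sub>M i\<in>I - {i}. (lborel :: real measure)))"
      using ij by (intro nn_integral_cong) (auto simp: indicator_def)
    also have "\<dots> = 0" by simp
    finally have "AE x in (\<Pi>\<^sub>M i\<in>I. (lborel :: real measure)). ?f x = 0"
      by (simp add: nn_integral_0_iff_AE)
    then show ?thesis by eventually_elim (auto simp: indicator_def split: if_splits)
  qed
  then have "AE x in (\<Pi>\<^sub>M i\<in>I. (lborel :: real measure)). \<forall>i\<in>I. \<forall>j\<in>I. i \<noteq> j \<longrightarrow> x i \<noteq> x j"
    using fin by (auto simp: AE_finite_all)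
  then show ?thesis by eventually_elim (auto simp: inj_on_def)
qed

text \<open>The map sends the open unit interval to an open interval. The right end point in the
  density corresponds to \<open>u = 0\<close>, a null set; it is included so that the intervals
  match \<open>parking_box\<close>.\<close>

lemma distr_uniform_affine:
  fixes a r :: real
  assumes r: "0 < r"
  shows "distr (uniform_measure lborel {0<..<1}) borel (\<lambda>u. r * (a - u)) =
         density lborel (\<lambda>x. ennreal (1 / r) * indicator {r * (a - 1)<..r * a} x)"
proof (rule measure_eqI)
  fix A assume "A \<in> sets (distr (uniform_measure lborel {0<..<1}) borel (\<lambda>u. r * (a - u)))"
  then have [measurable]: "A \<in> sets borel" by simp
  have "emeasure (density lborel (\<lambda>x. ennreal (1 / r) * indicator {r * (a - 1)<..r * a} x)) A =
      ennreal (1 / r) * (\<integral>\<^sup>+x. indicator {r * (a - 1)<..r * a} x * indicator A x \<partial>lborel)"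
    by (simp add: emeasure_density nn_integral_cmult mult.assoc)
  also have "(\<integral>\<^sup>+x. indicator {r * (a - 1)<..r * a} x * indicator A x \<partial>lborel) =
      ennreal r * (\<integral>\<^sup>+u. indicator {r * (a - 1)<..r * a} (r * a + - r * u) * indicator A (r * a + - r * u) \<partial>lborel)"
    using r by (subst nn_integral_real_affine[where c="- r" and t="r * a"]) auto
  also have "(\<integral>\<^sup>+u. indicator {r * (a - 1)<..r * a} (r * a + - r * u) * indicator A (r * a + - r * u) \<partial>lborel) =
      (\<integral>\<^sup>+u. indicator ({0<..<1} \<inter> {u. r * (a - u) \<in> A}) u \<partial>lborel)"
  proof (rule nn_integral_cong_AE)
    show "AE u in lborel. indicator {r * (a - 1)<..r * a} (r * a + - r * u) * indicator A (r * a + - r * u) =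
        (indicator ({0<..<1} \<inter> {u. r * (a - u) \<in> A}) u :: ennreal)"
      using AE_lborel_singleton[of 0]
    proof eventually_elim
      case (elim u)
      have "r * a + - r * u = r * (a - u)" by (simp add: algebra_simps)
      moreover have "r * (a - u) \<in> {r * (a - 1)<..r * a} \<longleftrightarrow> u \<in> {0<..<1}"
        using r elim by auto
      ultimately show ?case by (simp add: indicator_def)
    qed
  qed
  also have "\<dots> = emeasure lborel ({0<..<1} \<inter> {u. r * (a - u) \<in> A})"
    by simp
  also have "ennreal (1 / r) * (ennreal r * \<dots>) = emeasure lborel ({0<..<1} \<inter> {u. r * (a - u) \<in> A})"
    using r by (simp add: mult.assoc[symmetric] ennreal_mult[symmetric])
  also have "\<dots> = emeasure (distr (uniform_measure lborel {0<..<1}) borel (\<lambda>u. r * (a - u))) A"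
    by (subst emeasure_distr) (simp_all add: vimage_def divide_ennreal_def)
  finally show "emeasure (distr (uniform_measure lborel {0<..<1}) borel (\<lambda>u. r * (a - u))) A =
    emeasure (density lborel (\<lambda>x. ennreal (1 / r) * indicator {r * (a - 1)<..r * a} x)) A" ..
qed simp

lemma prob_space_uniform_01: "prob_space (uniform_measure lborel {0<..<1::real})"
  by (rule prob_space_uniform_measure) simp_all

lemma parking_box_sets[measurable]:
  assumes "length p = k"
  shows "parking_box r p \<in> sets (\<Pi>\<^sub>M j\<in>{..<k}. lborel)"
  using assms unfolding parking_box_def by (auto intro!: sets_PiM_I_finite)

text \<open>Both sides are identified with the product of the one-dimensional laws from
  \<open>distr_uniform_affine\<close>, by comparing values on rectangles.\<close>

lemma distr_uniform_parking_box:
  assumes r: "0 < r" and k: "length p = k"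
  shows "distr (\<Pi>\<^sub>M j\<in>{..<k}. uniform_measure lborel {0<..<1}) (\<Pi>\<^sub>M j\<in>{..<k}. lborel)
           (\<lambda>u. \<lambda>j\<in>{..<k}. r * (real (p ! j) - u j)) =
         density (\<Pi>\<^sub>M j\<in>{..<k}. lborel) (\<lambda>x. ennreal (1 / r) ^ k * indicator (parking_box r p) x)"
proof -
  let ?I = "\<lambda>j. {r * (real (p ! j) - 1)<..r * real (p ! j)}"
  let ?D = "\<lambda>j. density lborel (\<lambda>x. ennreal (1 / r) * indicator (?I j) x)"
  let ?U = "uniform_measure lborel {0<..<1::real}"
  interpret U: prob_space ?U by (rule prob_space_uniform_01)
  interpret PU: product_sigma_finite "\<lambda>_. ?U"
    by (rule product_sigma_finite.intro) (rule U.sigma_finite_measure_axioms)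
  interpret PL: product_sigma_finite "\<lambda>_. lborel :: real measure"
    by (rule product_sigma_finite.intro) (rule lborel.sigma_finite_measure_axioms)
  have D: "?D j = distr ?U borel (\<lambda>u. r * (real (p ! j) - u))" for j
    using distr_uniform_affine[OF r] by simp
  have "prob_space (?D j)" for j
    unfolding D by (rule U.prob_space_distr) simp
  then interpret PD: product_sigma_finite ?D
    by (intro product_sigma_finite.intro) (simp add: finite_measure.axioms(1) prob_space_def)
  have sD: "sets (PiM {..<k} ?D) = sets (\<Pi>\<^sub>M j\<in>{..<k}. lborel)"
    by (intro sets_PiM_cong) simp_all
  have [measurable]: "(\<lambda>u. \<lambda>j\<in>{..<k}. r * (real (p ! j) - u j)) \<in>
      measurable (\<Pi>\<^sub>M j\<in>{..<k}. ?U) (\<Pi>\<^sub>M j\<in>{..<k}. lborel)"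
    by (rule measurable_restrict) simp
  have "distr (\<Pi>\<^sub>M j\<in>{..<k}. ?U) (\<Pi>\<^sub>M j\<in>{..<k}. lborel)
           (\<lambda>u. \<lambda>j\<in>{..<k}. r * (real (p ! j) - u j)) = PiM {..<k} ?D" (is "?L = _")
  proof (rule PD.PiM_eqI)
    fix A :: "nat \<Rightarrow> real set" assume "\<And>i. i \<in> {..<k} \<Longrightarrow> A i \<in> sets (?D i)"
    then have A: "\<And>i. i < k \<Longrightarrow> A i \<in> sets borel" by simp
    have "emeasure ?L (Pi\<^sub>E {..<k} A) =
        emeasure (\<Pi>\<^sub>M j\<in>{..<k}. ?U) (\<Pi>\<^sub>E j\<in>{..<k}. (\<lambda>u. r * (real (p ! j) - u)) -` A j)"
      using A by (subst emeasure_distr)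
        (auto intro!: sets_PiM_I_finite arg_cong[where f="emeasure _"] simp: space_PiM PiE_iff)
    also have "\<dots> = (\<Prod>j<k. emeasure ?U ((\<lambda>u. r * (real (p ! j) - u)) -` A j))"
      using A by (intro PU.emeasure_PiM) (auto intro!: measurable_sets_borel[of _ borel])
    also have "\<dots> = (\<Prod>j<k. emeasure (?D j) (A j))"
      unfolding D using A by (intro prod.cong) (auto simp: emeasure_distr)
    finally show "emeasure ?L (Pi\<^sub>E {..<k} A) = (\<Prod>i<k. emeasure (?D i) (A i))" .
  qed (simp_all add: sD)
  moreover have "density (\<Pi>\<^sub>M j\<in>{..<k}. lborel) (\<lambda>x. ennreal (1 / r) ^ k * indicator (parking_box r p) x) =
      PiM {..<k} ?D" (is "?R = _")
  proof (rule PD.PiM_eqI)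
    fix A :: "nat \<Rightarrow> real set" assume "\<And>i. i \<in> {..<k} \<Longrightarrow> A i \<in> sets (?D i)"
    then have A: "\<And>i. i < k \<Longrightarrow> A i \<in> sets borel" by simp
    then have PA: "Pi\<^sub>E {..<k} A \<in> sets (\<Pi>\<^sub>M j\<in>{..<k}. lborel)"
      by (auto intro!: sets_PiM_I_finite)
    have "emeasure ?R (Pi\<^sub>E {..<k} A) = ennreal (1 / r) ^ k *
        (\<integral>\<^sup>+x. indicator (parking_box r p) x * indicator (Pi\<^sub>E {..<k} A) x \<partial>(\<Pi>\<^sub>M j\<in>{..<k}. lborel))"
      using PA k by (simp add: emeasure_density nn_integral_cmult mult.assoc)
    also have "(\<integral>\<^sup>+x. indicator (parking_box r p) x * indicator (Pi\<^sub>E {..<k} A) x \<partial>(\<Pi>\<^sub>M j\<in>{..<k}. lborel)) =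
        emeasure (\<Pi>\<^sub>M j\<in>{..<k}. lborel) (\<Pi>\<^sub>E j\<in>{..<k}. ?I j \<inter> A j)"
    proof -
      have "parking_box r p \<inter> Pi\<^sub>E {..<k} A = (\<Pi>\<^sub>E j\<in>{..<k}. ?I j \<inter> A j)"
        using k by (auto simp: parking_box_def PiE_iff)
      moreover have "parking_box r p \<inter> Pi\<^sub>E {..<k} A \<in> sets (\<Pi>\<^sub>M j\<in>{..<k}. lborel)"
        using PA parking_box_sets[OF k] by (rule sets.Int[rotated])
      ultimately show ?thesis
        by (simp add: indicator_inter_arith[symmetric])
    qed
    also have "\<dots> = (\<Prod>j<k. emeasure lborel (?I j \<inter> A j))"
      using A by (intro PL.emeasure_PiM) auto
    also have "ennreal (1 / r) ^ k * \<dots> = (\<Prod>j<k. ennreal (1 / r) * emeasure lborel (?I j \<inter> A j))"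
      by (simp add: prod.distrib)
    also have "\<dots> = (\<Prod>j<k. emeasure (?D j) (A j))"
    proof (rule prod.cong[OF refl])
      fix j assume "j \<in> {..<k}"
      then have [measurable]: "A j \<in> sets borel" using A by simp
      show "ennreal (1 / r) * emeasure lborel (?I j \<inter> A j) = emeasure (?D j) (A j)"
        by (simp add: emeasure_density nn_integral_cmult mult.assoc indicator_inter_arith[symmetric])
    qed
    finally show "emeasure ?R (Pi\<^sub>E {..<k} A) = (\<Prod>i<k. emeasure (?D i) (A i))" .
  qed (simp_all add: sD)
  ultimately show ?thesis by simp
qed

section \<open>The law of the sorted parking vector\<close>

lemma parking_chamber_sets[measurable]:
  "parking_chamber r k \<in> sets (\<Pi>\<^sub>M i\<in>{1..k}. borel)"
proof -
  have "parking_chamber r k = {y \<in> space (\<Pi>\<^sub>M i\<in>{1..k}. borel).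
     \<forall>i\<in>{1..k}. 0 < y i \<and> y i \<le> r * i \<and> (\<forall>j\<in>{1..k}. i < j \<longrightarrow> y i < y j)}"
    by (auto simp: parking_chamber_def space_PiM)
  also have "\<dots> \<in> sets (\<Pi>\<^sub>M i\<in>{1..k}. borel)" by measurable
  finally show ?thesis .
qed

text \<open>Points of the chamber are strictly increasing, so for a vector without ties only its
  sorting permutation contributes to the right-hand sum. This trades sorting for a sum of
  relabellings, each of which preserves Lebesgue measure.\<close>

lemma sum_parking_box_sort:
  fixes x :: "nat \<Rightarrow> real" and F :: "(nat \<Rightarrow> real) \<Rightarrow> ennreal"
  assumes r: "0 < r" and x: "x \<in> extensional {..<k}" and inj: "inj_on x {..<k}"
  shows "(\<Sum>p\<in>parking_functions k. indicator (parking_box r p) x) * F (\<lambda>i\<in>{1..k}. sort (map x [0..<k]) ! (i - 1)) =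
    (\<Sum>s | s permutes {..<k}. indicator (parking_chamber r k) (\<lambda>i\<in>{1..k}. x (s (i - 1))) * F (\<lambda>i\<in>{1..k}. x (s (i - 1))))"
proof -
  let ?inc = "\<lambda>s. s permutes {..<k} \<and> (\<forall>i j. i < j \<longrightarrow> j < k \<longrightarrow> x (s i) < x (s j))"
  from ex1_sorting_permutation[OF inj] obtain s where S: "?inc s" and uniq: "\<forall>t. ?inc t \<longrightarrow> t = s"
    by (rule ex1E)
  from S have s: "s permutes {..<k}" "\<And>i j. i < j \<Longrightarrow> j < k \<Longrightarrow> x (s i) < x (s j)"
    by simp_all
  have zero: "(\<lambda>i\<in>{1..k}. x (t (i - 1))) \<notin> parking_chamber r k" if t: "t permutes {..<k}" "t \<noteq> s" for t
  proof
    assume "(\<lambda>i\<in>{1..k}. x (t (i - 1))) \<in> parking_chamber r k"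
    then have "x (t i) < x (t j)" if "i < j" "j < k" for i j
      using that unfolding parking_chamber_def image_Suc_lessThan[symmetric] by auto
    then show False using uniq t by blast
  qed
  have "(\<lambda>i\<in>{1..k}. sort (map x [0..<k]) ! (i - 1)) = (\<lambda>i\<in>{1..k}. x (s (i - 1)))"
    using sort_map_permutes[OF s(1), of x] s(2) by (auto simp: less_imp_le intro!: restrict_ext)
  then have "(\<Sum>p\<in>parking_functions k. indicator (parking_box r p) x) * F (\<lambda>i\<in>{1..k}. sort (map x [0..<k]) ! (i - 1)) =
    indicator (parking_chamber r k) (\<lambda>i\<in>{1..k}. x (s (i - 1))) * F (\<lambda>i\<in>{1..k}. x (s (i - 1)))"
    using sum_parking_box[OF r x s] by simp
  also have "\<dots> = (\<Sum>t | t permutes {..<k}. if t = s then indicator (parking_chamber r k) (\<lambda>i\<in>{1..k}. x (t (i - 1))) * F (\<lambda>i\<in>{1..k}. x (t (i - 1))) else 0)"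
    using s(1) by (simp add: sum.delta finite_permutations)
  also have "\<dots> = (\<Sum>t | t permutes {..<k}. indicator (parking_chamber r k) (\<lambda>i\<in>{1..k}. x (t (i - 1))) * F (\<lambda>i\<in>{1..k}. x (t (i - 1))))"
    using zero by (intro sum.cong) auto
  finally show ?thesis .
qed

lemma sort_map_times:
  fixes x :: "nat \<Rightarrow> real"
  assumes r: "0 < r" and m: "m < k"
  shows "r * sort (map x [0..<k]) ! m = sort (map (\<lambda>j. r * x j) [0..<k]) ! m"
proof -
  have "sort (map (\<lambda>j. r * x j) [0..<k]) = map ((*) r) (sort (map x [0..<k]))"
  proof (rule properties_for_sort)
    have "sorted (map ((*) r) ys)" if "sorted ys" for ys
      using that r by (induction ys) auto
    then show "sorted (map ((*) r) (sort (map x [0..<k])))" by simp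
  qed (simp add: multiset.map_comp comp_def)
  then show ?thesis using m by simp
qed

lemma diff_order_stat_times:
  assumes r: "0 < r" and i: "i \<in> {1..k}" and len: "length p = k"
  shows "r * diff_order_stat i (p, u) =
    sort (map (\<lambda>j\<in>{..<k}. r * (real (p ! j) - u j)) [0..<k]) ! (i - 1)"
proof -
  have "map (\<lambda>j\<in>{..<k}. r * (real (p ! j) - u j)) [0..<k] = map (\<lambda>j. r * (real (p ! j) - u j)) [0..<k]"
    by simp
  moreover have "i - 1 < k" using i by auto
  ultimately show ?thesis
    using r by (simp only: diff_order_stat_def len sort_map_times prod.case)
qed

lemma sets_parking_uniform:
  "sets (parking_uniform k) =
   sets (count_space UNIV \<Otimes>\<^sub>M (\<Pi>\<^sub>M j\<in>{..<k}. uniform_measure lborel {0<..<1::real}))"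
  unfolding parking_uniform_def by (intro sets_pair_measure_cong) simp_all

text \<open>The discrete factor ranges over lists of every length, so positions outside
  \<open>{..<k}\<close> and past the end of the list occur. There the coordinate is constantly
  \<open>undefined\<close> on the product space, and the list access does not depend on
  \<open>u\<close>.\<close>

lemma borel_measurable_diff_order_stat[measurable]:
  "diff_order_stat i \<in> borel_measurable (parking_uniform k)"
proof -
  let ?U = "\<Pi>\<^sub>M j\<in>{..<k}. uniform_measure lborel {0<..<1::real}"
  have u[measurable]: "(\<lambda>u. u j) \<in> borel_measurable ?U" for j
  proof (cases "j < k")
    case True
    then show ?thesis
      using measurable_component_singleton[of j "{..<k}" "\<lambda>_. uniform_measure lborel {0<..<1::real}"] by simp
  next
    case False
    then have "u j = undefined" if "u \<in> space ?U" for u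
      using that by (auto simp: space_PiM PiE_iff extensional_def)
    then show ?thesis by (subst measurable_cong[where g="\<lambda>_. undefined"]) simp_all
  qed
  have "(\<lambda>u. diff_order_stat i (p, u)) \<in> borel_measurable ?U" for p
  proof (cases "i - 1 < length p")
    case True
    then show ?thesis
      unfolding diff_order_stat_def prod.case by (rule borel_measurable_sort_nth) simp
  next
    case False
    then have "diff_order_stat i (p, u) = [] ! (i - 1 - length p)" for u
      using nth_append[of "sort (map (\<lambda>j. real (p ! j) - u j) [0..<length p])" "[]" "i - 1"]
      by (simp add: diff_order_stat_def)
    then show ?thesis by simp
  qed
  then have "diff_order_stat i \<in> borel_measurable (count_space UNIV \<Otimes>\<^sub>M ?U)"
    by (intro measurable_pair_measure_countable1) simp_all
  then show ?thesis
    using measurable_cong_sets[OF sets_parking_uniform refl] by blast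
qed

lemma prob_space_parking_uniform: "prob_space (parking_uniform k)"
  unfolding parking_uniform_def
  by (intro prob_space_pair prob_space_PiM prob_space_uniform_01 measure_pmf.prob_space_axioms)

text \<open>The constant collects three effects: \<open>(1 / r) ^ k\<close> is the uniform density
  on one cube, division by the number of parking functions averages over the cubes, and
  \<open>fact k\<close> counts the orderings that sorting folds together.\<close>

lemma distr_parking_uniform:
  fixes k :: nat and r :: real
  assumes r: "0 < r"
  defines "c \<equiv> ennreal (1 / r) ^ k * ennreal (fact k) / of_nat (card (parking_functions k))"
  shows "distr (parking_uniform k) (\<Pi>\<^sub>M i\<in>{1..k}. borel) (\<lambda>x. \<lambda>i\<in>{1..k}. r * diff_order_stat i x) =
         density (\<Pi>\<^sub>M i\<in>{1..k}. lborel) (\<lambda>y. c * indicator (parking_chamber r k) y)"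
proof (rule measure_eqI)
  show "sets (distr (parking_uniform k) (\<Pi>\<^sub>M i\<in>{1..k}. borel) (\<lambda>x. \<lambda>i\<in>{1..k}. r * diff_order_stat i x)) =
    sets (density (\<Pi>\<^sub>M i\<in>{1..k}. lborel) (\<lambda>y. c * indicator (parking_chamber r k) y))"
    by (simp cong: sets_PiM_cong)
  fix B assume "B \<in> sets (distr (parking_uniform k) (\<Pi>\<^sub>M i\<in>{1..k}. borel) (\<lambda>x. \<lambda>i\<in>{1..k}. r * diff_order_stat i x))"
  then have B[measurable]: "B \<in> sets (\<Pi>\<^sub>M i\<in>{1..k}. borel)" by simp
  let ?U = "\<Pi>\<^sub>M j\<in>{..<k}. uniform_measure lborel {0<..<1::real}"
  let ?L = "\<Pi>\<^sub>M j\<in>{..<k}. (lborel :: real measure)"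
  let ?B = "indicator B :: _ \<Rightarrow> ennreal"
  let ?v = "\<lambda>x. \<lambda>i\<in>{1..k}. r * diff_order_stat i x"
  let ?s = "\<lambda>x::nat \<Rightarrow> real. \<lambda>i\<in>{1..k}. sort (map x [0..<k]) ! (i - 1)"
  interpret U: prob_space ?U
    by (intro prob_space_PiM prob_space_uniform_01)
  have v[measurable]: "?v \<in> measurable (parking_uniform k) (\<Pi>\<^sub>M i\<in>{1..k}. borel)"
    by (rule measurable_restrict) simp
  have Lc: "(\<lambda>x. x j) \<in> borel_measurable ?L" if "j < k" for j
    using measurable_component_singleton[of j "{..<k}" "\<lambda>_. lborel :: real measure"] that by simp
  have s[measurable]: "?s \<in> measurable ?L (\<Pi>\<^sub>M i\<in>{1..k}. borel)"
    by (rule measurable_restrict, rule borel_measurable_sort_nth) (auto intro: Lc)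
  have sB: "(\<lambda>x. ?B (?s x)) \<in> borel_measurable ?L" by measurable
  have vU: "(\<lambda>x. ?B (?v x)) \<in> borel_measurable (measure_pmf (pmf_of_set (parking_functions k)) \<Otimes>\<^sub>M ?U)"
    using v B unfolding parking_uniform_def[symmetric] by measurable
  have perm: "(\<integral>\<^sup>+x. indicator (parking_chamber r k) (\<lambda>i\<in>{1..k}. x (t (i - 1))) * ?B (\<lambda>i\<in>{1..k}. x (t (i - 1))) \<partial>?L) =
      (\<integral>\<^sup>+y. indicator (parking_chamber r k) y * ?B y \<partial>(\<Pi>\<^sub>M i\<in>{1..k}. lborel))"
    and perm_m: "(\<lambda>x. indicator (parking_chamber r k) (\<lambda>i\<in>{1..k}. x (t (i - 1))) * ?B (\<lambda>i\<in>{1..k}. x (t (i - 1))))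
      \<in> borel_measurable ?L"
    if t: "t permutes {..<k}" for t
  proof -
    have "bij_betw (\<lambda>i. i - 1) {1..k} {..<k}"
      by (rule bij_betwI[where g=Suc]) auto
    then have bij: "bij_betw (\<lambda>i. t (i - 1)) {1..k} {..<k}"
      using bij_betw_trans[OF _ permutes_imp_bij[OF t]] by (simp add: comp_def)
    have m[measurable]: "(\<lambda>x. \<lambda>i\<in>{1..k}. x (t (i - 1))) \<in> measurable ?L (\<Pi>\<^sub>M i\<in>{1..k}. borel)"
      using bij_betw_apply[OF bij] by (intro measurable_restrict Lc) auto
    show "(\<lambda>x. indicator (parking_chamber r k) (\<lambda>i\<in>{1..k}. x (t (i - 1))) * ?B (\<lambda>i\<in>{1..k}. x (t (i - 1))))
      \<in> borel_measurable ?L" by measurable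
    have sets: "sets (\<Pi>\<^sub>M i\<in>{1..k}. (lborel :: real measure)) = sets (\<Pi>\<^sub>M i\<in>{1..k}. borel)"
      by (intro sets_PiM_cong) simp_all
    have m': "(\<lambda>x. \<lambda>i\<in>{1..k}. x (t (i - 1))) \<in> measurable ?L (\<Pi>\<^sub>M i\<in>{1..k}. lborel)"
      using m measurable_cong_sets[OF refl sets] by blast
    have PB: "(\<lambda>y. indicator (parking_chamber r k) y * ?B y) \<in> borel_measurable (\<Pi>\<^sub>M i\<in>{1..k}. lborel)"
      unfolding measurable_cong_sets[OF sets refl] by measurable
    show "(\<integral>\<^sup>+x. indicator (parking_chamber r k) (\<lambda>i\<in>{1..k}. x (t (i - 1))) * ?B (\<lambda>i\<in>{1..k}. x (t (i - 1))) \<partial>?L) =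
      (\<integral>\<^sup>+y. indicator (parking_chamber r k) y * ?B y \<partial>(\<Pi>\<^sub>M i\<in>{1..k}. lborel))"
    proof -
      have "(\<integral>\<^sup>+y. indicator (parking_chamber r k) y * ?B y \<partial>distr ?L (\<Pi>\<^sub>M i\<in>{1..k}. lborel) (\<lambda>x. \<lambda>i\<in>{1..k}. x (t (i - 1)))) =
        (\<integral>\<^sup>+x. indicator (parking_chamber r k) (\<lambda>i\<in>{1..k}. x (t (i - 1))) * ?B (\<lambda>i\<in>{1..k}. x (t (i - 1))) \<partial>?L)"
        using m' PB by (intro nn_integral_distr) simp_all
      then show ?thesis by (simp only: lborel.distr_PiM_bij[OF finite_atLeastAtMost bij])
    qed
  qed
  have box: "(\<integral>\<^sup>+u. ?B (?v (p, u)) \<partial>?U) =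
      ennreal (1 / r) ^ k * (\<integral>\<^sup>+x. indicator (parking_box r p) x * ?B (?s x) \<partial>?L)"
    if p: "p \<in> parking_functions k" for p
  proof -
    have len: "length p = k" using p by (simp add: parking_functions_def)
    have [measurable]: "parking_box r p \<in> sets ?L" by (rule parking_box_sets[OF len])
    have "?v (p, u) = ?s (\<lambda>j\<in>{..<k}. r * (real (p ! j) - u j))" for u
      by (rule restrict_ext) (rule diff_order_stat_times[OF r _ len])
    then have "(\<integral>\<^sup>+u. ?B (?v (p, u)) \<partial>?U) = (\<integral>\<^sup>+u. ?B (?s (\<lambda>j\<in>{..<k}. r * (real (p ! j) - u j))) \<partial>?U)"
      by simp
    also have "\<dots> = (\<integral>\<^sup>+x. ?B (?s x) \<partial>distr ?U ?L (\<lambda>u. \<lambda>j\<in>{..<k}. r * (real (p ! j) - u j)))"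
    proof (rule nn_integral_distr[symmetric])
      show "(\<lambda>u. \<lambda>j\<in>{..<k}. r * (real (p ! j) - u j)) \<in> measurable ?U ?L"
        by (rule measurable_restrict) simp
      show "(\<lambda>x. ?B (?s x)) \<in> borel_measurable (distr ?U ?L (\<lambda>u. \<lambda>j\<in>{..<k}. r * (real (p ! j) - u j)))"
        using sB by (simp only: measurable_distr_eq1)
    qed
    also have "\<dots> = ennreal (1 / r) ^ k * (\<integral>\<^sup>+x. indicator (parking_box r p) x * ?B (?s x) \<partial>?L)"
      unfolding distr_uniform_parking_box[OF r len] using sB
      by (simp add: nn_integral_density nn_integral_cmult mult.assoc)
    finally show ?thesis .
  qed
  have "emeasure (distr (parking_uniform k) (\<Pi>\<^sub>M i\<in>{1..k}. borel) ?v) B = (\<integral>\<^sup>+x. ?B (?v x) \<partial>parking_uniform k)"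
    by (subst nn_integral_distr[OF v, symmetric]) (use B in simp_all)
  also have "\<dots> = (\<integral>\<^sup>+p. (\<integral>\<^sup>+u. ?B (?v (p, u)) \<partial>?U) \<partial>measure_pmf (pmf_of_set (parking_functions k)))"
    unfolding parking_uniform_def by (rule U.nn_integral_fst[OF vU, symmetric])
  also have "\<dots> = (\<Sum>p\<in>parking_functions k. \<integral>\<^sup>+u. ?B (?v (p, u)) \<partial>?U) / card (parking_functions k)"
    by (rule nn_integral_pmf_of_set[OF parking_functions_nonempty finite_parking_functions])
  also have "(\<Sum>p\<in>parking_functions k. \<integral>\<^sup>+u. ?B (?v (p, u)) \<partial>?U) =
      ennreal (1 / r) ^ k * (\<Sum>p\<in>parking_functions k. \<integral>\<^sup>+x. indicator (parking_box r p) x * ?B (?s x) \<partial>?L)"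
    unfolding sum_distrib_left by (rule sum.cong[OF refl]) (rule box)
  also have "(\<Sum>p\<in>parking_functions k. \<integral>\<^sup>+x. indicator (parking_box r p) x * ?B (?s x) \<partial>?L) =
      (\<integral>\<^sup>+x. (\<Sum>p\<in>parking_functions k. indicator (parking_box r p) x * ?B (?s x)) \<partial>?L)"
  proof (rule nn_integral_sum[symmetric])
    fix p assume "p \<in> parking_functions k"
    then have "parking_box r p \<in> sets ?L"
      by (intro parking_box_sets) (simp add: parking_functions_def)
    then show "(\<lambda>x. indicator (parking_box r p) x * ?B (?s x)) \<in> borel_measurable ?L"
      using sB by (intro borel_measurable_times_ennreal borel_measurable_indicator)
  qed
  \<comment> \<open>Vectors with ties, for which no permutation sorts strictly, are removed as a
    null set.\<close>
  also have "\<dots> = (\<integral>\<^sup>+x. (\<Sum>t | t permutes {..<k}.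
      indicator (parking_chamber r k) (\<lambda>i\<in>{1..k}. x (t (i - 1))) * ?B (\<lambda>i\<in>{1..k}. x (t (i - 1)))) \<partial>?L)"
  proof (rule nn_integral_cong_AE)
    show "AE x in ?L. (\<Sum>p\<in>parking_functions k. indicator (parking_box r p) x * ?B (?s x)) =
      (\<Sum>t | t permutes {..<k}. indicator (parking_chamber r k) (\<lambda>i\<in>{1..k}. x (t (i - 1))) * ?B (\<lambda>i\<in>{1..k}. x (t (i - 1))))"
      using AE_PiM_lborel_inj_on[OF finite_lessThan] AE_space
    proof eventually_elim
      case (elim x)
      then have "x \<in> extensional {..<k}" by (auto simp: space_PiM PiE_iff)
      with sum_parking_box_sort[OF r _ elim(1), of ?B] show ?case
        by (simp only: sum_distrib_right)
    qed
  qed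
  \<comment> \<open>Every ordering contributes the same integral over the chamber, whence the factor
    \<open>fact k\<close> below.\<close>
  also have "\<dots> = (\<Sum>t | t permutes {..<k}. \<integral>\<^sup>+y. indicator (parking_chamber r k) y * ?B y \<partial>(\<Pi>\<^sub>M i\<in>{1..k}. lborel))"
  proof (subst nn_integral_sum)
    show "(\<lambda>x. indicator (parking_chamber r k) (\<lambda>i\<in>{1..k}. x (t (i - 1))) * ?B (\<lambda>i\<in>{1..k}. x (t (i - 1))))
      \<in> borel_measurable ?L" if "t \<in> {t. t permutes {..<k}}" for t
      using that by (intro perm_m) simp
  qed (intro sum.cong refl perm, simp)
  also have "\<dots> = ennreal (fact k) * (\<integral>\<^sup>+y. indicator (parking_chamber r k) y * ?B y \<partial>(\<Pi>\<^sub>M i\<in>{1..k}. lborel))"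
    by (simp add: card_permutations[of _ k] ennreal_of_nat_eq_real_of_nat)
  also have "ennreal (1 / r) ^ k * \<dots> / card (parking_functions k) =
      c * (\<integral>\<^sup>+y. indicator (parking_chamber r k) y * ?B y \<partial>(\<Pi>\<^sub>M i\<in>{1..k}. lborel))"
    by (simp add: c_def ennreal_times_divide ennreal_divide_times mult.assoc mult.commute mult.left_commute)
  also have "\<dots> = emeasure (density (\<Pi>\<^sub>M i\<in>{1..k}. lborel) (\<lambda>y. c * indicator (parking_chamber r k) y)) B"
  proof -
    have sets: "sets (\<Pi>\<^sub>M i\<in>{1..k}. (lborel :: real measure)) = sets (\<Pi>\<^sub>M i\<in>{1..k}. borel)"
      by (intro sets_PiM_cong) simp_all
    have "B \<in> sets (\<Pi>\<^sub>M i\<in>{1..k}. lborel)" "parking_chamber r k \<in> sets (\<Pi>\<^sub>M i\<in>{1..k}. lborel)"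
      unfolding sets by measurable
    then show ?thesis
      by (simp add: emeasure_density nn_integral_cmult mult.assoc)
  qed
  finally show "emeasure (distr (parking_uniform k) (\<Pi>\<^sub>M i\<in>{1..k}. borel) ?v) B =
    emeasure (density (\<Pi>\<^sub>M i\<in>{1..k}. lborel) (\<lambda>y. c * indicator (parking_chamber r k) y)) B" .
qed

section \<open>Auxiliary measure theory\<close>

text \<open>The probability integral transform for a finite measure; later it performs the change to
  compensator time. The cdf is continuous but may have flat stretches, so a sublevel set is
  described by its supremum: it is a closed half-line, and by the intermediate value theorem the cdf
  takes the value \<open>x\<close> at its end.\<close>

lemma distr_cdf_no_atoms:
  assumes "finite_borel_measure N" and atoms: "\<And>x. measure N {x} = 0"
  shows "distr N borel (cdf N) = density lborel (indicator {0<..<measure N UNIV})"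
proof -
  interpret finite_borel_measure N by fact
  let ?m = "measure N UNIV"
  have sp: "space N = UNIV" by (rule borel_UNIV)
  have cont: "isCont (cdf N) x" for x
    using atoms by (simp add: isCont_cdf)
  then have contS: "continuous_on S (cdf N)" for S
    by (simp add: continuous_at_imp_continuous_on)
  have [measurable]: "cdf N \<in> borel_measurable N"
    using borel_measurable_continuous_onI[OF contS] M_is_borel measurable_cong_sets by blast
  have m0: "0 \<le> ?m" by simp
  have fin1: "finite_borel_measure (distr N borel (cdf N))"
    by (intro finite_borel_measure.intro finite_measure_distr finite_borel_measure_axioms.intro) simp_all
  have fin2: "finite_borel_measure (density lborel (indicator {0<..<?m}))"
    by (intro finite_borel_measure.intro finite_borel_measure_axioms.intro finite_measureI)
      (simp_all add: emeasure_density)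
  have "cdf (distr N borel (cdf N)) x = cdf (density lborel (indicator {0<..<?m})) x" for x
  proof -
    let ?S = "{u. cdf N u \<le> x}"
    have L: "cdf (distr N borel (cdf N)) x = measure N ?S"
      unfolding cdf_def[of "distr N borel (cdf N)"]
      by (subst measure_distr) (auto simp: sp vimage_def)
    have R: "cdf (density lborel (indicator {0<..<?m})) x = measure lborel ({0<..<?m} \<inter> {..x})"
      unfolding cdf_def measure_def
      by (subst emeasure_density) (simp_all add: indicator_inter_arith[symmetric])
    consider "x < 0" | "?m \<le> x" | "0 \<le> x" "x < ?m" by linarith
    then show ?thesis
    proof cases
      case 1
      then have "?S = {}" "{0<..<?m} \<inter> {..x} = {}"
        using cdf_nonneg by (auto simp: not_le intro: less_le_trans)
      then show ?thesis by (simp add: L R)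
    next
      case 2
      then have "?S = UNIV" "{0<..<?m} \<inter> {..x} = {0<..<?m}"
        using cdf_bounded by (auto simp: sp intro: order_trans)
      then show ?thesis using m0 by (simp add: L R)
    next
      case 3
      have "{0<..<?m} \<inter> {..x} = {0<..x}" using 3 by auto
      then have R': "cdf (density lborel (indicator {0<..<?m})) x = x" using 3 by (simp add: R)
      have "eventually (\<lambda>u. x < cdf N u) at_top"
        using order_tendstoD(1)[OF cdf_lim_at_top] 3 by (simp add: sp)
      then obtain b where b: "\<And>u. b \<le> u \<Longrightarrow> x < cdf N u" by (auto simp: eventually_at_top_linorder)
      \<comment> \<open>The value 0 is excluded because the cdf may approach it only in the limit at
        minus infinity; then the sublevel set for \<open>x = 0\<close> is empty.\<close>
      have level: "\<exists>u. cdf N u = x" if "0 < x"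
      proof -
        have "eventually (\<lambda>u. cdf N u < x) at_bot"
          using order_tendstoD(2)[OF cdf_lim_at_bot that] .
        then obtain a where a: "\<And>u. u \<le> a \<Longrightarrow> cdf N u < x" by (auto simp: eventually_at_bot_linorder)
        have "a \<le> b" using a[of "min a b"] b[of "min a b"] by (cases "a \<le> b") auto
        then show ?thesis
          using IVT'[of "cdf N" a x b] a[of a] b[of b] contS by auto
      qed
      have "measure N ?S = x"
      proof (cases "?S = {}")
        case True
        then have "\<not> 0 < x" using level by auto
        then show ?thesis using True 3 by simp
      next
        case False
        have bdd: "bdd_above ?S"
          using b by (intro bdd_aboveI[of _ b]) (metis linorder_not_le mem_Collect_eq nle_le)
        have "closed ?S"
          using contS by (intro closed_Collect_le) auto
        then have S: "Sup ?S \<in> ?S" using False bdd by (intro closed_contains_Sup)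
        have "?S = {..Sup ?S}"
        proof (intro equalityI subsetI)
          fix u assume "u \<in> {..Sup ?S}"
          then show "u \<in> ?S" using S cdf_nondecreasing[of u "Sup ?S"] by auto
        qed (use bdd in \<open>auto intro: cSup_upper\<close>)
        then have eq: "measure N ?S = cdf N (Sup ?S)" by (simp add: cdf_def)
        have "x \<le> cdf N (Sup ?S)"
        proof (cases "0 < x")
          case True
          then obtain u where u: "cdf N u = x" using level by auto
          then have "u \<le> Sup ?S" using bdd by (intro cSup_upper) auto
          then show ?thesis using cdf_nondecreasing[of u] u by auto
        qed (use 3 cdf_nonneg[of "Sup ?S"] in auto)
        then show ?thesis using S eq by auto
      qed
      then show ?thesis by (simp add: L R')
    qed
  qed
  then have "cdf (distr N borel (cdf N)) = cdf (density lborel (indicator {0<..<?m}))" by auto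
  with cdf_unique'[OF fin1 fin2] show ?thesis .
qed

text \<open>Equality is known only on overlapping pieces; replacing them by their disjointed
  versions lets the pieces be summed.\<close>

lemma measure_eqI_countable_cover:
  fixes \<Omega> :: "nat \<Rightarrow> 'b set"
  assumes sets: "sets N = sets M"
    and \<Omega>: "\<And>m. \<Omega> m \<in> sets M"
    and eq: "\<And>m C. C \<in> sets M \<Longrightarrow> emeasure M (C \<inter> \<Omega> m) = emeasure N (C \<inter> \<Omega> m)"
    and M: "AE x in M. x \<in> (\<Union>m. \<Omega> m)" and N: "AE x in N. x \<in> (\<Union>m. \<Omega> m)"
  shows "M = N"
proof (rule measure_eqI)
  fix C assume C: "C \<in> sets M"
  let ?D = "disjointed \<Omega>"
  have D: "?D m \<in> sets M" for m
    using sets.range_disjointed_sets[of \<Omega> M] \<Omega> by auto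
  have split: "emeasure K C = (\<Sum>m. emeasure K (C \<inter> ?D m))"
    if K: "sets K = sets M" and ae: "AE x in K. x \<in> (\<Union>m. \<Omega> m)" for K
  proof -
    have "emeasure K C = emeasure K (C \<inter> (\<Union>m. ?D m))"
      using ae C D \<Omega> K by (intro emeasure_eq_AE) (auto simp: UN_disjointed_eq)
    also have "C \<inter> (\<Union>m. ?D m) = (\<Union>m. C \<inter> ?D m)" by auto
    also have "emeasure K \<dots> = (\<Sum>m. emeasure K (C \<inter> ?D m))"
    proof (rule suminf_emeasure[symmetric])
      show "disjoint_family (\<lambda>m. C \<inter> ?D m)"
        using disjoint_family_disjointed[of \<Omega>] unfolding disjoint_family_on_def by blast
    qed (use C D K in auto)
    finally show ?thesis .
  qed
  have "emeasure M (C \<inter> ?D m) = emeasure N (C \<inter> ?D m)" for m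
  proof -
    have "C \<inter> ?D m \<inter> \<Omega> m = C \<inter> ?D m" using disjointed_subset[of \<Omega> m] by blast
    then show ?thesis using eq[of "C \<inter> ?D m" m] C D by auto
  qed
  then show "emeasure M C = emeasure N C"
    unfolding split[OF refl M] split[OF sets N] by simp
qed (simp add: sets)

lemma nn_integral_exp_Ioc:
  assumes "a \<le> b"
  shows "(\<integral>\<^sup>+y. indicator {a<..b} y * ennreal (exp y) \<partial>lborel) = ennreal (exp b - exp a)"
proof -
  have "(\<integral>\<^sup>+y. indicator {a<..b} y * ennreal (exp y) \<partial>lborel) = (\<integral>\<^sup>+y. ennreal (exp y) * indicator {a..b} y \<partial>lborel)"
    using AE_lborel_singleton[of a]
    by (intro nn_integral_cong_AE) (auto elim!: eventually_mono simp: indicator_def)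
  also have "\<dots> = ennreal (exp b - exp a)"
    using assms by (intro nn_integral_FTC_Icc) (auto intro!: derivative_eq_intros)
  finally show ?thesis .
qed

lemma nn_integral_exp_cut:
  "(\<integral>\<^sup>+y. indicator {a<..b} y * (indicator {..<x} y * ennreal (exp y)) \<partial>lborel) =
    (if a \<le> b \<and> a < x then ennreal (exp (min x b) - exp a) else 0)"
proof (cases "a \<le> b \<and> a < x")
  case True
  have "(\<integral>\<^sup>+y. indicator {a<..b} y * (indicator {..<x} y * ennreal (exp y)) \<partial>lborel) =
      (\<integral>\<^sup>+y. indicator {a<..min x b} y * ennreal (exp y) \<partial>lborel)"
    using AE_lborel_singleton[of x]
    by (intro nn_integral_cong_AE) (auto elim!: eventually_mono simp: indicator_def)
  then show ?thesis using True nn_integral_exp_Ioc[of a "min x b"] by simp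
next
  case False
  then have "indicator {a<..b} y * (indicator {..<x} y * ennreal (exp y)) = 0" for y
    by (auto simp: indicator_def)
  then show ?thesis using False by (simp only: nn_integral_const) auto
qed

lemma indicator_le_1_ennreal: "indicator S v \<le> (1 :: ennreal)"
  by (simp add: indicator_def)

text \<open>In an increasing vector the last entry dominates all others, so a new coordinate has to
  be compared with \<open>v n\<close> alone. For \<open>n = 0\<close> the value 0 takes its place,
  in agreement with \<open>te 0\<close>.\<close>

lemma parking_chamber_Suc:
  assumes v: "v \<in> extensional {1..n}"
  shows "v(Suc n := x) \<in> parking_chamber r (Suc n) \<longleftrightarrow>
    v \<in> parking_chamber r n \<and> (if n = 0 then 0 else v n) < x \<and> x \<le> r * Suc n"
proof -
  let ?w = "v(Suc n := x)"
  have ext: "?w \<in> {1..Suc n} \<rightarrow>\<^sub>E UNIV" "v \<in> {1..n} \<rightarrow>\<^sub>E UNIV"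
    using v by (auto simp: PiE_iff extensional_def)
  have I: "{1..Suc n} = insert (Suc n) {1..n}" by auto
  have "?w \<in> parking_chamber r (Suc n) \<longleftrightarrow>
      v \<in> parking_chamber r n \<and> 0 < x \<and> x \<le> r * Suc n \<and> (\<forall>i\<in>{1..n}. v i < x)"
    using ext unfolding parking_chamber_def I by auto
  also have "\<dots> \<longleftrightarrow> v \<in> parking_chamber r n \<and> (if n = 0 then 0 else v n) < x \<and> x \<le> r * Suc n"
  proof (cases "n = 0")
    case False
    have n: "n \<in> {1..n}" using False by simp
    have "(0 < x \<and> (\<forall>i\<in>{1..n}. v i < x)) \<longleftrightarrow> v n < x" if P: "v \<in> parking_chamber r n"
    proof -
      have le: "v i \<le> v n" if "i \<in> {1..n}" for i
        using P n that unfolding parking_chamber_def by (cases "i = n") (auto intro: less_imp_le)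
      have "0 < v n" using P n by (simp add: parking_chamber_def)
      then show ?thesis using le n by (meson le_less_trans less_trans)
    qed
    then show ?thesis using False by auto
  qed auto
  finally show ?thesis .
qed

section \<open>The law of the transformed epochs\<close>

locale excitation_kernel =
  fixes g :: "real \<Rightarrow> real"
  assumes g_nonneg: "\<And>t. 0 \<le> t \<Longrightarrow> 0 \<le> g t"
    and g_integrable: "set_integrable lborel {0..} g"
begin

text \<open>Extension by zero: an event contributes nothing before it occurs, so the sum over past
  events can be extended to all events up to a fixed horizon.\<close>

definition g0 :: "real \<Rightarrow> real" where
  "g0 u = indicator {0..} u * g u"

abbreviation G :: "real \<Rightarrow> real" where "G \<equiv> kernel_int g"

text \<open>Its cdf is \<open>G\<close>, which makes monotonicity, bounds and increments of
  \<open>G\<close> instances of general facts about cdfs.\<close>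

definition kernel_measure :: "real measure" where
  "kernel_measure = density lborel (\<lambda>u. ennreal (g0 u))"

lemma g0_nonneg: "0 \<le> g0 u"
  using g_nonneg by (simp add: g0_def indicator_def)

lemma g0_integrable: "integrable lborel g0"
  using g_integrable by (simp add: set_integrable_def g0_def[abs_def])

lemma g0_measurable[measurable]: "g0 \<in> borel_measurable borel"
  using borel_measurable_integrable[OF g0_integrable] by simp

lemma emeasure_kernel_measure:
  assumes "B \<in> sets borel"
  shows "emeasure kernel_measure B = ennreal (\<integral>u. indicator B u * g0 u \<partial>lborel)"
proof -
  have "emeasure kernel_measure B = (\<integral>\<^sup>+u. ennreal (indicator B u * g0 u) \<partial>lborel)"
    using assms unfolding kernel_measure_def
    by (subst emeasure_density) (auto intro!: nn_integral_cong simp: indicator_def)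
  also have "\<dots> = ennreal (\<integral>u. indicator B u * g0 u \<partial>lborel)"
    using assms integrable_mult_indicator[OF _ g0_integrable, of B] g0_nonneg
    by (intro nn_integral_eq_integral) auto
  finally show ?thesis .
qed

lemma measure_kernel_measure:
  assumes "B \<in> sets borel"
  shows "measure kernel_measure B = (\<integral>u. indicator B u * g0 u \<partial>lborel)"
  using emeasure_kernel_measure[OF assms] g0_nonneg
  by (simp add: measure_def integral_nonneg_AE)

sublocale K: finite_borel_measure kernel_measure
proof (intro finite_borel_measure.intro finite_borel_measure_axioms.intro finite_measureI)
  show "emeasure kernel_measure (space kernel_measure) \<noteq> \<infinity>"
    using emeasure_kernel_measure[of UNIV] by (simp add: kernel_measure_def)
qed (simp add: kernel_measure_def)

lemma cdf_kernel_measure: "cdf kernel_measure = G"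
proof
  fix t
  have "cdf kernel_measure t = (\<integral>u. indicator {..t} u * g0 u \<partial>lborel)"
    unfolding cdf_def by (rule measure_kernel_measure) simp
  also have "\<dots> = G t"
    unfolding kernel_int_def set_lebesgue_integral_def
    by (intro Bochner_Integration.integral_cong) (auto simp: g0_def indicator_def)
  finally show "cdf kernel_measure t = G t" .
qed

lemma measure_kernel_UNIV: "measure kernel_measure UNIV = kernel_mass g"
  by (simp add: measure_kernel_measure kernel_mass_def set_lebesgue_integral_def g0_def)

lemma G_mono: "x \<le> y \<Longrightarrow> G x \<le> G y"
  using K.cdf_nondecreasing by (simp add: cdf_kernel_measure)

lemma G_measurable[measurable]: "G \<in> borel_measurable borel"
  by (rule borel_measurable_mono) (simp add: mono_def G_mono)

text \<open>The case \<open>t = 0\<close> is the important one: an event adds nothing to the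
  compensator at its own epoch, so the compensator there is the same with or without it.\<close>

lemma G_nonpos: "t \<le> 0 \<Longrightarrow> G t = 0"
proof -
  have "G t = 0" if "t < 0" for t
    using that by (simp add: kernel_int_def set_lebesgue_integral_def)
  moreover have "G 0 = 0"
  proof -
    have "G 0 = (LBINT u:{0}. g u)" by (simp add: kernel_int_def)
    also have "\<dots> = 0"
      unfolding set_lebesgue_integral_def
      using AE_lborel_singleton[of 0] by (intro integral_eq_zero_AE) (auto elim!: eventually_mono)
    finally show ?thesis .
  qed
  ultimately show "t \<le> 0 \<Longrightarrow> G t = 0" by (cases "t = 0") auto
qed

lemma G_nonneg: "0 \<le> G t"
  using K.cdf_nonneg by (simp add: cdf_kernel_measure)

lemma G_le_mass: "G t \<le> kernel_mass g"
  using K.cdf_bounded[of t] by (simp add: cdf_kernel_measure measure_kernel_UNIV K.borel_UNIV)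

lemma nn_integral_g0_Ioc:
  assumes "c \<le> b"
  shows "(\<integral>\<^sup>+u. indicator {c<..b} u * ennreal (g0 (u - a)) \<partial>lborel) = ennreal (G (b - a) - G (c - a))"
proof -
  have "(\<integral>\<^sup>+u. indicator {c<..b} u * ennreal (g0 (u - a)) \<partial>lborel) =
      (\<integral>\<^sup>+u. indicator {c - a<..b - a} u * ennreal (g0 u) \<partial>lborel)"
    by (subst nn_integral_real_affine[where c=1 and t=a]) (auto intro!: nn_integral_cong simp: indicator_def)
  also have "\<dots> = emeasure kernel_measure {c - a<..b - a}"
    unfolding kernel_measure_def by (subst emeasure_density) (auto simp: mult.commute)
  also have "\<dots> = ennreal (measure kernel_measure {c - a<..b - a})"
    by (simp add: K.emeasure_eq_measure)
  also have "measure kernel_measure {c - a<..b - a} = G (b - a) - G (c - a)"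
    using K.cdf_diff_eq[of "c - a" "b - a"] assms
    by (cases "c = b") (simp_all add: cdf_kernel_measure)
  finally show ?thesis .
qed

lemma nn_integral_g0_Ioi:
  "(\<integral>\<^sup>+u. indicator {c<..} u * ennreal (g0 (u - a)) \<partial>lborel) = ennreal (kernel_mass g - G (c - a))"
proof -
  have "(\<integral>\<^sup>+u. indicator {c<..} u * ennreal (g0 (u - a)) \<partial>lborel) =
      (\<integral>\<^sup>+u. indicator {c - a<..} u * ennreal (g0 u) \<partial>lborel)"
    by (subst nn_integral_real_affine[where c=1 and t=a]) (auto intro!: nn_integral_cong simp: indicator_def)
  also have "\<dots> = emeasure kernel_measure {c - a<..}"
    unfolding kernel_measure_def by (subst emeasure_density) (auto simp: mult.commute)
  also have "\<dots> = ennreal (measure kernel_measure (UNIV - {..c - a}))"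
    by (simp add: K.emeasure_eq_measure Compl_eq_Diff_UNIV[symmetric] Compl_atMost)
  also have "measure kernel_measure (UNIV - {..c - a}) = kernel_mass g - G (c - a)"
    using K.finite_measure_compl[of "{..c - a}"]
    by (simp add: K.borel_UNIV measure_kernel_UNIV cdf_kernel_measure[symmetric] cdf_def K.M_is_borel)
  finally show ?thesis .
qed

end

section \<open>Epochs, counts and the natural filtration\<close>

locale hawkes_process = excitation_kernel g + prob_space M
  for g :: "real \<Rightarrow> real" and M :: "'a measure" +
  fixes A :: "nat \<Rightarrow> 'a \<Rightarrow> ereal"
  assumes hawkes: "hawkes_cluster M g A"
begin

text \<open>This is \<open>0\<close> where \<open>A i \<omega> = \<infinity>\<close>.\<close>

definition ep :: "nat \<Rightarrow> 'a \<Rightarrow> real" where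
  "ep i \<omega> = real_of_ereal (A i \<omega>)"

lemma point_process_A: "point_process M A"
  using hawkes by (simp add: hawkes_cluster_def)

lemma A_measurable[measurable]: "A i \<in> borel_measurable M"
  using point_process_A by (simp add: point_process_def)

lemma ep_measurable[measurable]: "ep i \<in> borel_measurable M"
  unfolding ep_def[abs_def] by measurable

lemma A_0: "\<omega> \<in> space M \<Longrightarrow> A 0 \<omega> = 0"
  using point_process_A by (simp add: point_process_def)

lemma A_Suc_less: "\<omega> \<in> space M \<Longrightarrow> A i \<omega> < \<infinity> \<Longrightarrow> A i \<omega> < A (Suc i) \<omega>"
  using point_process_A by (simp add: point_process_def)

lemma A_mono:
  assumes "\<omega> \<in> space M" "i \<le> j"
  shows "A i \<omega> \<le> A j \<omega>"
proof (rule lift_Suc_mono_le[of "\<lambda>i. A i \<omega>"])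
  show "A n \<omega> \<le> A (Suc n) \<omega>" for n
  proof (cases "A n \<omega> = \<infinity>")
    case True
    then show ?thesis using point_process_A assms(1) by (simp add: point_process_def)
  next
    case False
    then show ?thesis using A_Suc_less[OF assms(1), of n] by simp
  qed
qed fact

lemma A_nonneg: "\<omega> \<in> space M \<Longrightarrow> 0 \<le> A i \<omega>"
  using A_mono[of \<omega> 0 i] by (simp add: A_0)

lemma ereal_ep: "\<omega> \<in> space M \<Longrightarrow> A i \<omega> < \<infinity> \<Longrightarrow> ereal (ep i \<omega>) = A i \<omega>"
  using A_nonneg[of \<omega> i] unfolding ep_def by (cases "A i \<omega>") auto

lemma ep_nonneg: "\<omega> \<in> space M \<Longrightarrow> 0 \<le> ep i \<omega>"
  unfolding ep_def by (simp add: A_nonneg real_of_ereal_pos)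

lemma A_le_iff: "\<omega> \<in> space M \<Longrightarrow> A i \<omega> \<le> ereal t \<longleftrightarrow> A i \<omega> < \<infinity> \<and> ep i \<omega> \<le> t"
  using A_nonneg[of \<omega> i] unfolding ep_def by (cases "A i \<omega>") auto

lemma ep_less:
  assumes "\<omega> \<in> space M" "A j \<omega> < \<infinity>" "i < j"
  shows "ep i \<omega> < ep j \<omega>"
proof -
  have fin: "A i \<omega> < \<infinity>" using A_mono[of \<omega> i j] assms by auto
  have "A i \<omega> < A j \<omega>"
    using A_Suc_less[of \<omega> i] A_mono[of \<omega> "Suc i" j] fin assms by (auto intro: less_le_trans)
  then have "ereal (ep i \<omega>) < ereal (ep j \<omega>)"
    using assms fin by (simp add: ereal_ep)
  then show ?thesis by simp
qed

text \<open>The epochs are ordered, so the indices of those up to \<open>t\<close> form an initial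
  segment, which is determined by its cardinality.\<close>

lemma less_num_events_iff:
  assumes \<omega>: "\<omega> \<in> space M"
  shows "i < num_events A t \<omega> \<longleftrightarrow> A i \<omega> \<le> ereal t"
proof -
  let ?S = "{i. A i \<omega> \<le> ereal t}"
  have fin: "finite ?S" using point_process_A \<omega> by (simp add: point_process_def)
  have down: "j \<in> ?S" if "i \<in> ?S" "j \<le> i" for i j
    using that A_mono[OF \<omega>, of j i] by (auto intro: order_trans)
  have "?S = {..<card ?S}"
  proof (cases "?S = {}")
    case True then show ?thesis by simp
  next
    case False
    then have "?S = {..Max ?S}"
      using down[OF Max_in[OF fin False]] Max_ge[OF fin] by blast
    then show ?thesis by (metis card_atMost lessThan_Suc_atMost)
  qed
  then show ?thesis unfolding num_events_def by blast
qed

lemma num_events_eq: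
  assumes \<omega>: "\<omega> \<in> space M" and "A m \<omega> \<le> ereal t" "ereal t < A (Suc m) \<omega>"
  shows "num_events A t \<omega> = Suc m"
proof -
  have "m < num_events A t \<omega>" "\<not> Suc m < num_events A t \<omega>"
    using assms by (simp_all add: less_num_events_iff[OF \<omega>] not_le)
  then show ?thesis by linarith
qed

text \<open>The number of summands in the intensity varies with \<open>s\<close>. With
  \<open>g0\<close> it can be replaced by the number at the final time \<open>t\<close>, since later
  events give zero; then sum and integral are interchanged.\<close>

lemma compensator_eq:
  assumes \<omega>: "\<omega> \<in> space M" and "0 \<le> t"
  shows "compensator g A t \<omega> = (\<Sum>i<num_events A t \<omega>. G (t - ep i \<omega>))"
proof -
  let ?n = "num_events A t \<omega>"
  have int: "intensity g A s \<omega> = (\<Sum>i<?n. g0 (s - ep i \<omega>))" if s: "s \<in> {0..t}" for s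
  proof -
    have le: "num_events A s \<omega> \<le> ?n"
    proof (rule leI, rule notI)
      assume "?n < num_events A s \<omega>"
      then have "A ?n \<omega> \<le> ereal s" by (simp add: less_num_events_iff[OF \<omega>])
      also have "\<dots> \<le> ereal t" using s by simp
      finally have "?n < ?n" by (simp only: less_num_events_iff[OF \<omega>])
      then show False by simp
    qed
    have iff: "i < num_events A s \<omega> \<longleftrightarrow> ep i \<omega> \<le> s" if "i < ?n" for i
      using that by (simp add: less_num_events_iff[OF \<omega>] A_le_iff[OF \<omega>])
    have "intensity g A s \<omega> = (\<Sum>i<num_events A s \<omega>. g0 (s - ep i \<omega>))"
      unfolding intensity_def
    proof (rule sum.cong[OF refl])
      fix i assume "i \<in> {..<num_events A s \<omega>}"
      then have "ep i \<omega> \<le> s" using le iff[of i] by simp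
      then show "g (s - real_of_ereal (A i \<omega>)) = g0 (s - ep i \<omega>)" by (simp add: g0_def ep_def)
    qed
    also have "\<dots> = (\<Sum>i<?n. g0 (s - ep i \<omega>))"
    proof (rule sum.mono_neutral_left)
      show "\<forall>i\<in>{..<?n} - {..<num_events A s \<omega>}. g0 (s - ep i \<omega>) = 0"
      proof
        fix i assume "i \<in> {..<?n} - {..<num_events A s \<omega>}"
        then have "\<not> ep i \<omega> \<le> s" using iff[of i] by simp
        then show "g0 (s - ep i \<omega>) = 0" by (simp add: g0_def)
      qed
    qed (use le in auto)
    finally show ?thesis .
  qed
  have shift: "(\<integral>s. indicator {0..t} s * g0 (s - a) \<partial>lborel) = G (t - a)" (is "?l = _")
    and shift_int: "integrable lborel (\<lambda>s. indicator {0..t} s * g0 (s - a))"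
    if "0 \<le> a" for a
  proof -
    show "integrable lborel (\<lambda>s. indicator {0..t} s * g0 (s - a))"
      using integrable_mult_indicator[of "{0..t}" lborel "\<lambda>s. g0 (s - a)"]
        lborel_integrable_real_affine[OF g0_integrable, of 1 "- a"] by simp
    have "?l = (\<integral>v. indicator {0..t} (a + v) * g0 v \<partial>lborel)"
      using lborel_integral_real_affine[where c=1 and t=a and f="\<lambda>s. indicator {0..t} s * g0 (s - a)"] by simp
    also have "\<dots> = G (t - a)"
      unfolding kernel_int_def set_lebesgue_integral_def using that
      by (intro Bochner_Integration.integral_cong) (auto simp: g0_def indicator_def)
    finally show "?l = G (t - a)" .
  qed
  have "compensator g A t \<omega> = (\<integral>s. (\<Sum>i<?n. indicator {0..t} s * g0 (s - ep i \<omega>)) \<partial>lborel)"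
    unfolding compensator_def set_lebesgue_integral_def
    by (intro Bochner_Integration.integral_cong) (auto simp: indicator_def int)
  also have "\<dots> = (\<Sum>i<?n. G (t - ep i \<omega>))"
    using \<omega> by (subst Bochner_Integration.integral_sum) (auto simp: shift shift_int ep_nonneg)
  finally show ?thesis .
qed

lemma cluster_size_eq_iff:
  assumes \<omega>: "\<omega> \<in> space M"
  shows "cluster_size A \<omega> = enat (Suc n) \<longleftrightarrow> A n \<omega> < \<infinity> \<and> A (Suc n) \<omega> = \<infinity>"
proof
  assume *: "A n \<omega> < \<infinity> \<and> A (Suc n) \<omega> = \<infinity>"
  have "num_events A t \<omega> \<le> Suc n" for t
    using less_num_events_iff[OF \<omega>, of "Suc n" t] * by (simp add: not_le[symmetric])
  moreover have "num_events A (ep n \<omega>) \<omega> = Suc n"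
    using * by (intro num_events_eq[OF \<omega>]) (auto simp: ereal_ep[OF \<omega>])
  ultimately show "cluster_size A \<omega> = enat (Suc n)"
    unfolding cluster_size_def using ep_nonneg[OF \<omega>, of n]
    by (intro antisym SUP_least SUP_upper2[of "ep n \<omega>"]) auto
next
  assume *: "cluster_size A \<omega> = enat (Suc n)"
  have le: "num_events A t \<omega> \<le> Suc n" if "0 \<le> t" for t
  proof -
    have "enat (num_events A t \<omega>) \<le> cluster_size A \<omega>"
      unfolding cluster_size_def using that by (intro SUP_upper) auto
    then show ?thesis by (simp add: *)
  qed
  have "A (Suc n) \<omega> = \<infinity>"
  proof (rule ccontr)
    assume "A (Suc n) \<omega> \<noteq> \<infinity>"
    then have "Suc n < num_events A (ep (Suc n) \<omega>) \<omega>"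
      by (subst less_num_events_iff[OF \<omega>]) (simp add: ereal_ep[OF \<omega>])
    then show False using le[OF ep_nonneg[OF \<omega>, of "Suc n"]] by simp
  qed
  moreover have "A n \<omega> < \<infinity>"
  proof (rule ccontr)
    assume "\<not> A n \<omega> < \<infinity>"
    then have "\<not> n < num_events A t \<omega>" for t
      by (subst less_num_events_iff[OF \<omega>]) auto
    then have "cluster_size A \<omega> \<le> enat n"
      unfolding cluster_size_def by (intro SUP_least) (simp add: not_less)
    then show False by (simp add: *)
  qed
  ultimately show "A n \<omega> < \<infinity> \<and> A (Suc n) \<omega> = \<infinity>" by simp
qed

abbreviation F :: "real \<Rightarrow> 'a measure" where
  "F \<equiv> natural_filtration M (num_events A)"

lemma space_F: "space (F q) = space M"
  unfolding natural_filtration_def by (intro space_measure_of) auto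

lemma sets_F: "sets (F q) = sigma_sets (space M) {num_events A s -` B \<inter> space M | s B. 0 \<le> s \<and> s \<le> q}"
  unfolding natural_filtration_def by (intro sets_measure_of) auto

lemma F_A_le:
  assumes "0 \<le> x" "x \<le> q"
  shows "{\<omega>\<in>space M. A i \<omega> \<le> ereal x} \<in> sets (F q)"
proof -
  have "{\<omega>\<in>space M. A i \<omega> \<le> ereal x} = num_events A x -` {i<..} \<inter> space M"
    by (auto simp: less_num_events_iff)
  then show ?thesis unfolding sets_F using assms by blast
qed

lemma subalgebra_F: "subalgebra M (F q)"
  unfolding subalgebra_def
proof
  show "sets (F q) \<subseteq> sets M"
    unfolding sets_F
  proof (rule sets.sigma_sets_subset, safe)
    fix s B
    \<comment> \<open>Counts have countably many values, so preimages of single values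
      suffice.\<close>
    have "num_events A s -` {m} \<inter> space M \<in> sets M" for m
    proof -
      have "num_events A s \<omega> = m \<longleftrightarrow> (\<forall>i<m. A i \<omega> \<le> ereal s) \<and> \<not> A m \<omega> \<le> ereal s" if "\<omega> \<in> space M" for \<omega>
      proof -
        have "(\<forall>i<m. i < num_events A s \<omega>) \<longleftrightarrow> m \<le> num_events A s \<omega>"
          by (metis leI less_le_trans order_less_irrefl)
        then show ?thesis
          unfolding less_num_events_iff[OF that, symmetric] by auto
      qed
      then have "num_events A s -` {m} \<inter> space M =
          {\<omega>\<in>space M. (\<forall>i<m. A i \<omega> \<le> ereal s) \<and> \<not> A m \<omega> \<le> ereal s}" by auto
      also have "\<dots> \<in> sets M" by measurable
      finally show ?thesis .
    qed
    moreover have "num_events A s -` B \<inter> space M = (\<Union>m\<in>B. num_events A s -` {m} \<inter> space M)" by auto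
    moreover have "(\<Union>m\<in>B. num_events A s -` {m} \<inter> space M) \<in> sets M"
      using calculation(1) by (intro sets.countable_UN') auto
    ultimately show "num_events A s -` B \<inter> space M \<in> sets M" by (simp only:)
  qed
qed (rule space_F)

lemma F_ep:
  assumes q: "0 \<le> q" and B: "B \<in> sets borel"
  shows "{\<omega>\<in>space M. A i \<omega> \<le> ereal q \<and> ep i \<omega> \<in> B} \<in> sets (F q)"
proof -
  \<comment> \<open>The value \<open>q + 1\<close> marks an epoch that has not occurred by time
    \<open>q\<close>. Below the mark, a sublevel set only asks whether the epoch is at most
    \<open>min a q\<close>, which is observable at time \<open>q\<close>.\<close>
  let ?Y = "\<lambda>\<omega>. if A i \<omega> \<le> ereal q then ep i \<omega> else q + 1"
  have "?Y \<in> borel_measurable (F q)"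
    unfolding borel_measurable_iff_le
  proof
    fix a :: real
    consider "q + 1 \<le> a" | "0 \<le> a" "a < q + 1" | "a < 0" by linarith
    then show "{\<omega> \<in> space (F q). ?Y \<omega> \<le> a} \<in> sets (F q)"
    proof cases
      case 1
      then have "{\<omega> \<in> space (F q). ?Y \<omega> \<le> a} = space (F q)"
        by (auto simp: space_F A_le_iff)
      then show ?thesis by simp
    next
      case 2
      then have "{\<omega> \<in> space (F q). ?Y \<omega> \<le> a} = {\<omega>\<in>space M. A i \<omega> \<le> ereal (min a q)}"
        by (auto simp: space_F A_le_iff)
      then show ?thesis using F_A_le[of "min a q" q i] 2 q by simp
    next
      case 3
      then have "{\<omega> \<in> space (F q). ?Y \<omega> \<le> a} = {}"
        using q by (auto simp: space_F not_le intro: less_le_trans ep_nonneg)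
      then show ?thesis by (simp only: sets.empty_sets)
    qed
  qed
  then have "?Y -` B \<inter> space (F q) \<in> sets (F q)" using B by (rule measurable_sets)
  moreover have "{\<omega>\<in>space M. A i \<omega> \<le> ereal q \<and> ep i \<omega> \<in> B} =
      {\<omega>\<in>space M. A i \<omega> \<le> ereal q} \<inter> (?Y -` B \<inter> space (F q))"
    by (auto simp: space_F)
  ultimately show ?thesis using F_A_le[OF q order_refl] by auto
qed

text \<open>
  What the compensator and the intensity at time \<open>u\<close> would be if the events \<open>A 0, \<dots>, A n\<close> were the
  only ones; they are the actual values as long as \<open>A n \<omega> \<le> u < A (Suc n) \<omega>\<close>.
\<close>

definition comp_after :: "nat \<Rightarrow> 'a \<Rightarrow> real \<Rightarrow> real" where
  "comp_after n \<omega> u = (\<Sum>j<Suc n. G (u - ep j \<omega>))"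

definition intens_after :: "nat \<Rightarrow> 'a \<Rightarrow> real \<Rightarrow> real" where
  "intens_after n \<omega> u = (\<Sum>j<Suc n. g0 (u - ep j \<omega>))"

lemma comp_after_mono: "u \<le> v \<Longrightarrow> comp_after n \<omega> u \<le> comp_after n \<omega> v"
  unfolding comp_after_def by (intro sum_mono G_mono) simp

lemma comp_after_le: "comp_after n \<omega> u \<le> Suc n * kernel_mass g"
  unfolding comp_after_def using sum_bounded_above[of "{..<Suc n}" "\<lambda>j. G (u - ep j \<omega>)"] G_le_mass by simp

lemma comp_after_nonneg: "0 \<le> comp_after n \<omega> u"
  unfolding comp_after_def by (intro sum_nonneg G_nonneg)

lemma intens_after_measurable[measurable]:
  "(\<lambda>(\<omega>, u). intens_after n \<omega> u) \<in> borel_measurable (M \<Otimes>\<^sub>M borel)"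
  unfolding intens_after_def by measurable

lemma nn_integral_intens_after_Ioc:
  assumes "c \<le> b"
  shows "(\<integral>\<^sup>+u. indicator {c<..b} u * ennreal (intens_after n \<omega> u) \<partial>lborel) =
    ennreal (comp_after n \<omega> b - comp_after n \<omega> c)"
proof -
  have "(\<integral>\<^sup>+u. indicator {c<..b} u * ennreal (intens_after n \<omega> u) \<partial>lborel) =
      (\<integral>\<^sup>+u. (\<Sum>j<Suc n. indicator {c<..b} u * ennreal (g0 (u - ep j \<omega>))) \<partial>lborel)"
    unfolding intens_after_def sum_distrib_left[symmetric] by (simp only: sum_ennreal g0_nonneg)
  also have "\<dots> = (\<Sum>j<Suc n. ennreal (G (b - ep j \<omega>) - G (c - ep j \<omega>)))"
    by (subst nn_integral_sum) (simp_all only: nn_integral_g0_Ioc[OF assms], measurable)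
  also have "\<dots> = ennreal (comp_after n \<omega> b - comp_after n \<omega> c)"
    unfolding comp_after_def sum_subtractf[symmetric] using assms by (intro sum_ennreal) (simp add: G_mono)
  finally show ?thesis .
qed

lemma nn_integral_intens_after_Ioi:
  "(\<integral>\<^sup>+u. indicator {c<..} u * ennreal (intens_after n \<omega> u) \<partial>lborel) =
    ennreal (Suc n * kernel_mass g - comp_after n \<omega> c)"
proof -
  have "(\<integral>\<^sup>+u. indicator {c<..} u * ennreal (intens_after n \<omega> u) \<partial>lborel) =
      (\<integral>\<^sup>+u. (\<Sum>j<Suc n. indicator {c<..} u * ennreal (g0 (u - ep j \<omega>))) \<partial>lborel)"
    unfolding intens_after_def sum_distrib_left[symmetric] by (simp only: sum_ennreal g0_nonneg)
  also have "\<dots> = (\<Sum>j<Suc n. ennreal (kernel_mass g - G (c - ep j \<omega>)))"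
    by (subst nn_integral_sum) (simp_all only: nn_integral_g0_Ioi, measurable)
  also have "\<dots> = ennreal (\<Sum>j<Suc n. kernel_mass g - G (c - ep j \<omega>))"
    by (intro sum_ennreal) (simp add: G_le_mass)
  also have "(\<Sum>j<Suc n. kernel_mass g - G (c - ep j \<omega>)) = Suc n * kernel_mass g - comp_after n \<omega> c"
    unfolding comp_after_def sum_subtractf by simp
  finally show ?thesis .
qed

section \<open>From the martingale to the hazard of the next event\<close>

text \<open>Moves the stopping of the compensator into an indicator under the integral. In this form
  the increment over \<open>{q<..t}\<close> becomes a measure of that interval and can be extended
  to Borel sets.\<close>

lemma nn_integral_stopped_intens_after:
  assumes \<omega>: "\<omega> \<in> space M" and qt: "q \<le> t"
  shows "(\<integral>\<^sup>+u. indicator {q<..t} u * indicator {u. ereal u \<le> A (Suc n) \<omega>} u * ennreal (intens_after n \<omega> u) \<partial>lborel) =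
    ennreal (if ereal q < A (Suc n) \<omega>
      then comp_after n \<omega> (real_of_ereal (min (ereal t) (A (Suc n) \<omega>))) - comp_after n \<omega> q else 0)"
proof -
  let ?T = "A (Suc n) \<omega>"
  consider "?T \<le> ereal q" | "ereal q < ?T" "?T \<le> ereal t" | "ereal q < ?T" "ereal t < ?T" by force
  then show ?thesis
  proof cases
    case 1
    have eq: "(\<lambda>u. indicator {q<..t} u * indicator {u. ereal u \<le> ?T} u * ennreal (intens_after n \<omega> u)) = (\<lambda>_. 0)"
    proof
      fix u
      have "\<not> (ereal q < ereal u \<and> ereal u \<le> ?T)"
        using 1 by (meson leD le_less_trans less_le_trans)
      then show "indicator {q<..t} u * indicator {u. ereal u \<le> ?T} u * ennreal (intens_after n \<omega> u) = 0"
        by (auto simp: indicator_def)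
    qed
    show ?thesis unfolding eq using leD[OF 1] by simp
  next
    case 2
    then have e: "ereal (ep (Suc n) \<omega>) = ?T" by (intro ereal_ep[OF \<omega>]) auto
    then have "q \<le> ep (Suc n) \<omega>" "ep (Suc n) \<omega> \<le> t" using 2 by (metis ereal_less(2) ereal_less_eq(3) less_ereal.simps(1) less_imp_le, metis ereal_less_eq(3))
    moreover have "(\<lambda>u. indicator {q<..t} u * indicator {u. ereal u \<le> ?T} u * ennreal (intens_after n \<omega> u)) =
       (\<lambda>u. indicator {q<..ep (Suc n) \<omega>} u * ennreal (intens_after n \<omega> u))"
      using calculation by (auto simp: indicator_def e[symmetric])
    moreover have "real_of_ereal (min (ereal t) ?T) = ep (Suc n) \<omega>"
      using 2 by (simp add: min_absorb2 ep_def)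
    ultimately show ?thesis using 2 by (simp add: nn_integral_intens_after_Ioc)
  next
    case 3
    have "ereal u \<le> ?T" if "u \<le> t" for u
      using that 3 by (metis ereal_less_eq(3) less_imp_le order_trans)
    then have "(\<lambda>u. indicator {q<..t} u * indicator {u. ereal u \<le> ?T} u * ennreal (intens_after n \<omega> u)) =
       (\<lambda>u. indicator {q<..t} u * ennreal (intens_after n \<omega> u))"
      by (auto simp: indicator_def)
    moreover have "real_of_ereal (min (ereal t) ?T) = t"
      using 3 by (simp add: min_absorb1 less_imp_le)
    ultimately show ?thesis using 3 qt by (simp add: nn_integral_intens_after_Ioc)
  qed
qed

text \<open>If the \<open>n\<close>-th epoch is past at time \<open>q\<close>, the only event that
  can still move the process stopped at \<open>A (Suc n)\<close> is \<open>A (Suc n)\<close> itself.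
  So its increment is one indicator minus a compensator increment that involves the events up to
  \<open>A n\<close> only.\<close>

lemma stopped_increment:
  assumes \<omega>: "\<omega> \<in> space M" and q: "0 \<le> q" "q \<le> t" and An: "A n \<omega> \<le> ereal q"
  defines "X \<equiv> \<lambda>s. let \<tau> = real_of_ereal (min (ereal s) (A (Suc n) \<omega>))
    in real (num_events A \<tau> \<omega>) - compensator g A \<tau> \<omega>"
  shows "X t - X q = indicator {\<omega>. ereal q < A (Suc n) \<omega> \<and> A (Suc n) \<omega> \<le> ereal t} \<omega> -
    (if ereal q < A (Suc n) \<omega>
      then comp_after n \<omega> (real_of_ereal (min (ereal t) (A (Suc n) \<omega>))) - comp_after n \<omega> q else 0)"
proof -
  let ?T = "A (Suc n) \<omega>"
  have before: "X s = Suc n - comp_after n \<omega> s" if "q \<le> s" "ereal s < ?T" for s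
  proof -
    have "real_of_ereal (min (ereal s) ?T) = s" using that by (simp add: min_absorb1 less_imp_le)
    moreover have "A n \<omega> \<le> ereal s" using An that(1) by (meson ereal_less_eq(3) order_trans)
    then have "num_events A s \<omega> = Suc n" using that by (intro num_events_eq[OF \<omega>])
    ultimately show ?thesis
      using q that compensator_eq[OF \<omega>, of s] by (simp only: X_def Let_def comp_after_def)
  qed
  consider "?T \<le> ereal q" | "ereal q < ?T" "?T \<le> ereal t" | "ereal q < ?T" "ereal t < ?T" by force
  then show ?thesis
  proof cases
    case 1
    then have "?T \<le> ereal t" using q(2) by (meson ereal_less_eq(3) order_trans)
    then have "X t = X q" using 1 by (simp add: X_def min_absorb2)
    then show ?thesis using leD[OF 1] by simp
  next
    case 2
    then have fin: "?T < \<infinity>" by auto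
    let ?e = "ep (Suc n) \<omega>"
    have e: "ereal ?e = ?T" using fin by (rule ereal_ep[OF \<omega>])
    have m: "real_of_ereal (min (ereal t) ?T) = ?e" using 2 by (simp add: min_absorb2 ep_def)
    have "num_events A ?e \<omega> = Suc (Suc n)"
      using A_Suc_less[OF \<omega> fin] by (intro num_events_eq[OF \<omega>]) (simp_all add: e)
    then have "compensator g A ?e \<omega> = (\<Sum>i<Suc (Suc n). G (?e - ep i \<omega>))"
      using compensator_eq[OF \<omega> ep_nonneg[OF \<omega>]] by (simp only:)
    \<comment> \<open>The event at \<open>?e\<close> is already counted here but adds only
      \<open>G 0 = 0\<close>.\<close>
    also have "\<dots> = comp_after n \<omega> ?e" by (simp add: comp_after_def G_nonpos)
    finally have "X t = Suc (Suc n) - comp_after n \<omega> ?e"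
      using \<open>num_events A ?e \<omega> = Suc (Suc n)\<close> by (simp only: X_def m Let_def)
    then show ?thesis using 2 before[of q] by (simp add: ep_def)
  next
    case 3
    have "real_of_ereal (min (ereal t) ?T) = t" using 3 by (simp add: min_absorb1 less_imp_le)
    then show ?thesis using 3 before[of q] before[of t] q by (simp add: not_le)
  qed
qed

text \<open>The stopped martingale has the same integral over \<open>E\<close> at times
  \<open>q\<close> and \<open>t\<close>. By \<open>stopped_increment\<close> the expected jump on
  \<open>E\<close> thus equals the expected compensator increment.\<close>

lemma prob_next_event_Ioc:
  assumes q: "0 \<le> q" "q \<le> t" and E: "E \<in> sets (F q)" and EA: "\<And>\<omega>. \<omega> \<in> E \<Longrightarrow> A n \<omega> \<le> ereal q"
  shows "emeasure M {\<omega>\<in>E. ereal q < A (Suc n) \<omega> \<and> A (Suc n) \<omega> \<le> ereal t} =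
    (\<integral>\<^sup>+\<omega>. indicator E \<omega> * (\<integral>\<^sup>+u. indicator {q<..t} u * indicator {u. ereal u \<le> A (Suc n) \<omega>} u *
       ennreal (intens_after n \<omega> u) \<partial>lborel) \<partial>M)"
proof -
  define X where "X s \<omega> = (let \<tau> = real_of_ereal (min (ereal s) (A (Suc n) \<omega>))
    in real (num_events A \<tau> \<omega>) - compensator g A \<tau> \<omega>)" for s \<omega>
  define K where "K \<omega> = (if ereal q < A (Suc n) \<omega>
      then comp_after n \<omega> (real_of_ereal (min (ereal t) (A (Suc n) \<omega>))) - comp_after n \<omega> q else 0)" for \<omega>
  let ?S = "{\<omega>\<in>E. ereal q < A (Suc n) \<omega> \<and> A (Suc n) \<omega> \<le> ereal t}"
  have "martingale_wrt M F (\<lambda>s \<omega>. X s \<omega>)"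
    unfolding X_def using hawkes by (simp add: hawkes_cluster_def)
  then have Xt: "integrable M (X t)" "integrable M (X q)"
    and X_mart: "AE \<omega> in M. real_cond_exp M (F q) (X t) \<omega> = X q \<omega>"
    using q by (auto simp: martingale_wrt_def)
  interpret sub: finite_measure_subalgebra M "F q"
    by unfold_locales (rule subalgebra_F)
  have EM[measurable]: "E \<in> sets M" using E subalgebra_F by (auto simp: subalgebra_def)
  have Esp: "\<omega> \<in> space M" if "\<omega> \<in> E" for \<omega> using sets.sets_into_space[OF EM] that by auto
  have S[measurable]: "?S \<in> sets M"
  proof -
    have "?S = E \<inter> {\<omega>\<in>space M. ereal q < A (Suc n) \<omega> \<and> A (Suc n) \<omega> \<le> ereal t}" using Esp by auto
    also have "\<dots> \<in> sets M" by measurable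
    finally show ?thesis .
  qed
  from Xt have [measurable]: "X t \<in> borel_measurable M" "X q \<in> borel_measurable M" by auto
  have int_eq: "(\<integral>\<omega>. indicator E \<omega> * X t \<omega> \<partial>M) = (\<integral>\<omega>. indicator E \<omega> * X q \<omega> \<partial>M)"
  proof -
    have "(\<integral>\<omega>. indicator E \<omega> * X t \<omega> \<partial>M) = (\<integral>\<omega>. indicator E \<omega> * real_cond_exp M (F q) (X t) \<omega> \<partial>M)"
      using sub.real_cond_exp_intA[OF Xt(1) E] by (simp add: set_lebesgue_integral_def)
    also have "\<dots> = (\<integral>\<omega>. indicator E \<omega> * X q \<omega> \<partial>M)"
      using X_mart by (intro integral_cong_AE) (auto elim!: eventually_mono)
    finally show ?thesis .
  qed
  have diff: "indicator E \<omega> * K \<omega> = indicator ?S \<omega> - (indicator E \<omega> * X t \<omega> - indicator E \<omega> * X q \<omega>)" for \<omega>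
  proof (cases "\<omega> \<in> E")
    case True
    then show ?thesis
      using stopped_increment[OF Esp[OF True] q EA[OF True]]
      unfolding X_def K_def by (simp add: indicator_def)
  qed simp
  have I: "integrable M (\<lambda>\<omega>. indicator E \<omega> * X t \<omega>)" "integrable M (\<lambda>\<omega>. indicator E \<omega> * X q \<omega>)"
    using integrable_mult_indicator[OF EM Xt(1)] integrable_mult_indicator[OF EM Xt(2)] by simp_all
  have IS: "integrable M (indicat_real ?S)"
    by (rule integrable_real_indicator) (use S in \<open>auto simp: emeasure_eq_measure\<close>)
  have KI: "integrable M (\<lambda>\<omega>. indicator E \<omega> * K \<omega>)"
    unfolding diff by (intro Bochner_Integration.integrable_diff IS I)
  have "(\<integral>\<omega>. indicator E \<omega> * K \<omega> \<partial>M) = measure M ?S"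
    unfolding diff using int_eq S
    by (simp add: Bochner_Integration.integral_diff IS I sets.Int_space_eq2 del: Bochner_Integration.integral_mult_right_zero)
  then have "emeasure M ?S = ennreal (\<integral>\<omega>. indicator E \<omega> * K \<omega> \<partial>M)"
    by (simp add: emeasure_eq_measure)
  also have "\<dots> = (\<integral>\<^sup>+\<omega>. ennreal (indicator E \<omega> * K \<omega>) \<partial>M)"
  proof (rule nn_integral_eq_integral[OF KI, symmetric], rule AE_I2)
    fix \<omega> assume \<omega>: "\<omega> \<in> space M"
    have "0 \<le> K \<omega>"
    proof (cases "ereal q < A (Suc n) \<omega>")
      case True
      then have "q \<le> real_of_ereal (min (ereal t) (A (Suc n) \<omega>))"
        using q by (cases "A (Suc n) \<omega>") (auto simp: min_def)
      then show ?thesis using True by (simp add: K_def comp_after_mono)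
    qed (simp add: K_def)
    then show "0 \<le> indicator E \<omega> * K \<omega>" by simp
  qed
  also have "\<dots> = (\<integral>\<^sup>+\<omega>. indicator E \<omega> * (\<integral>\<^sup>+u. indicator {q<..t} u * indicator {u. ereal u \<le> A (Suc n) \<omega>} u *
       ennreal (intens_after n \<omega> u) \<partial>lborel) \<partial>M)"
  proof (rule nn_integral_cong)
    fix \<omega> assume \<omega>: "\<omega> \<in> space M"
    show "ennreal (indicator E \<omega> * K \<omega>) = indicator E \<omega> * (\<integral>\<^sup>+u. indicator {q<..t} u * indicator {u. ereal u \<le> A (Suc n) \<omega>} u *
       ennreal (intens_after n \<omega> u) \<partial>lborel)"
      unfolding nn_integral_stopped_intens_after[OF \<omega> q(2)] K_def[symmetric]
      by (auto simp: indicator_def)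
  qed
  finally show ?thesis .
qed

text \<open>The hazard of the epoch \<open>A (Suc n)\<close> along the path: the intensity in force,
  switched off after that epoch. It thereby depends on the epoch whose law is sought.\<close>

definition rate :: "nat \<Rightarrow> 'a \<Rightarrow> real \<Rightarrow> ennreal" where
  "rate n \<omega> u = (if A n \<omega> < ereal u \<and> ereal u \<le> A (Suc n) \<omega> then ennreal (intens_after n \<omega> u) else 0)"

lemma rate_measurable[measurable]: "(\<lambda>(\<omega>, u). rate n \<omega> u) \<in> borel_measurable (M \<Otimes>\<^sub>M borel)"
  unfolding rate_def by measurable

lemma rate_measurable'[measurable]: "(\<lambda>(\<omega>, u). rate n \<omega> u) \<in> borel_measurable (M \<Otimes>\<^sub>M lborel)"
  using rate_measurable measurable_cong_sets[OF sets_pair_measure_cong[OF refl sets_lborel] refl] by blast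

text \<open>As functions of \<open>B\<close> both sides are finite measures, \<open>N1\<close> and
  \<open>N2\<close>. They agree on half-lines by \<open>prob_next_event_Ioc\<close>, so their cdfs
  coincide.\<close>

lemma prob_next_event:
  assumes q: "0 \<le> q" and E: "E \<in> sets (F q)" and EA: "\<And>\<omega>. \<omega> \<in> E \<Longrightarrow> A n \<omega> \<le> ereal q"
    and B: "B \<in> sets borel"
  shows "emeasure M {\<omega>\<in>E. ereal q < A (Suc n) \<omega> \<and> A (Suc n) \<omega> < \<infinity> \<and> ep (Suc n) \<omega> \<in> B} =
    (\<integral>\<^sup>+\<omega>. indicator E \<omega> * (\<integral>\<^sup>+u. indicator (B \<inter> {q<..}) u * rate n \<omega> u \<partial>lborel) \<partial>M)"
proof -
  let ?S = "{\<omega>\<in>E. ereal q < A (Suc n) \<omega> \<and> A (Suc n) \<omega> < \<infinity>}"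
  let ?w = "\<lambda>(\<omega>, u). indicator E \<omega> * (indicator {q<..} u * rate n \<omega> u)"
  have EM[measurable]: "E \<in> sets M" using E subalgebra_F by (auto simp: subalgebra_def)
  have Esp: "\<omega> \<in> space M" if "\<omega> \<in> E" for \<omega> using sets.sets_into_space[OF EM] that by auto
  have S[measurable]: "?S \<in> sets M"
  proof -
    have "?S = E \<inter> {\<omega>\<in>space M. ereal q < A (Suc n) \<omega> \<and> A (Suc n) \<omega> < \<infinity>}" using Esp by auto
    also have "\<dots> \<in> sets M" by measurable
    finally show ?thesis .
  qed
  have w[measurable]: "?w \<in> borel_measurable (M \<Otimes>\<^sub>M lborel)" by measurable
  define N1 where "N1 = distr (density M (indicator ?S)) borel (ep (Suc n))"
  define N2 where "N2 = distr (density (M \<Otimes>\<^sub>M lborel) ?w) borel snd"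
  have N1: "emeasure N1 C = emeasure M {\<omega>\<in>E. ereal q < A (Suc n) \<omega> \<and> A (Suc n) \<omega> < \<infinity> \<and> ep (Suc n) \<omega> \<in> C}"
    if C[measurable]: "C \<in> sets borel" for C
  proof -
    have "emeasure N1 C = emeasure M (?S \<inter> (ep (Suc n) -` C \<inter> space M))"
      unfolding N1_def by (subst emeasure_distr) (simp_all add: emeasure_restricted)
    also have "?S \<inter> (ep (Suc n) -` C \<inter> space M) =
        {\<omega>\<in>E. ereal q < A (Suc n) \<omega> \<and> A (Suc n) \<omega> < \<infinity> \<and> ep (Suc n) \<omega> \<in> C}"
      using Esp by auto
    finally show ?thesis .
  qed
  have N2: "emeasure N2 C = (\<integral>\<^sup>+\<omega>. indicator E \<omega> * (\<integral>\<^sup>+u. indicator (C \<inter> {q<..}) u * rate n \<omega> u \<partial>lborel) \<partial>M)"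
    if C[measurable]: "C \<in> sets borel" for C
  proof -
    have "emeasure N2 C = (\<integral>\<^sup>+y. indicator C y \<partial>N2)"
      by (simp add: N2_def)
    also have "\<dots> = (\<integral>\<^sup>+x. indicator C (snd x) \<partial>density (M \<Otimes>\<^sub>M lborel) ?w)"
      unfolding N2_def by (intro nn_integral_distr; measurable)
    also have "\<dots> = (\<integral>\<^sup>+x. ?w x * indicator C (snd x) \<partial>(M \<Otimes>\<^sub>M lborel))"
      by (intro nn_integral_density; measurable)
    also have "\<dots> = (\<integral>\<^sup>+\<omega>. \<integral>\<^sup>+u. ?w (\<omega>, u) * indicator C u \<partial>lborel \<partial>M)"
      by (subst lborel.nn_integral_fst[symmetric]) simp_all
    also have "\<dots> = (\<integral>\<^sup>+\<omega>. indicator E \<omega> * (\<integral>\<^sup>+u. indicator (C \<inter> {q<..}) u * rate n \<omega> u \<partial>lborel) \<partial>M)"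
    proof (intro nn_integral_cong)
      fix \<omega> assume [measurable]: "\<omega> \<in> space M"
      have "(\<integral>\<^sup>+u. ?w (\<omega>, u) * indicator C u \<partial>lborel) =
          (\<integral>\<^sup>+u. indicator E \<omega> * (indicator (C \<inter> {q<..}) u * rate n \<omega> u) \<partial>lborel)"
        by (intro nn_integral_cong) (auto simp: indicator_def)
      also have "\<dots> = indicator E \<omega> * (\<integral>\<^sup>+u. indicator (C \<inter> {q<..}) u * rate n \<omega> u \<partial>lborel)"
        by (intro nn_integral_cmult) measurable
      finally show "(\<integral>\<^sup>+u. ?w (\<omega>, u) * indicator C u \<partial>lborel) =
        indicator E \<omega> * (\<integral>\<^sup>+u. indicator (C \<inter> {q<..}) u * rate n \<omega> u \<partial>lborel)" .
    qed
    finally show ?thesis .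
  qed
  have eq: "emeasure N1 {..x} = emeasure N2 {..x}" for x
  proof (cases "q \<le> x")
    case True
    have "{\<omega>\<in>E. ereal q < A (Suc n) \<omega> \<and> A (Suc n) \<omega> < \<infinity> \<and> ep (Suc n) \<omega> \<in> {..x}} =
        {\<omega>\<in>E. ereal q < A (Suc n) \<omega> \<and> A (Suc n) \<omega> \<le> ereal x}"
      using Esp A_le_iff by auto
    then have "emeasure N1 {..x} = (\<integral>\<^sup>+\<omega>. indicator E \<omega> * (\<integral>\<^sup>+u. indicator {q<..x} u *
        indicator {u. ereal u \<le> A (Suc n) \<omega>} u * ennreal (intens_after n \<omega> u) \<partial>lborel) \<partial>M)"
      using prob_next_event_Ioc[OF q True E EA] by (simp add: N1)
    also have "\<dots> = emeasure N2 {..x}"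
      unfolding N2[OF atMost_borel]
    proof (rule nn_integral_cong)
      fix \<omega>
      have "A n \<omega> < ereal u" if "\<omega> \<in> E" "q < u" for u
        using EA[OF that(1)] that(2) by (meson ereal_less(2) le_less_trans less_ereal.simps(1))
      then show "indicator E \<omega> * (\<integral>\<^sup>+u. indicator {q<..x} u *
          indicator {u. ereal u \<le> A (Suc n) \<omega>} u * ennreal (intens_after n \<omega> u) \<partial>lborel) =
        indicator E \<omega> * (\<integral>\<^sup>+u. indicator ({..x} \<inter> {q<..}) u * rate n \<omega> u \<partial>lborel)"
        by (cases "\<omega> \<in> E") (auto intro!: nn_integral_cong simp: indicator_def rate_def)
    qed
    finally show ?thesis .
  next
    case False
    have "A (Suc n) \<omega> < \<infinity> \<and> ep (Suc n) \<omega> \<in> {..x} \<longleftrightarrow> A (Suc n) \<omega> \<le> ereal x" if "\<omega> \<in> E" for \<omega>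
      using Esp[OF that] A_le_iff by auto
    moreover have "\<not> (ereal q < A (Suc n) \<omega> \<and> A (Suc n) \<omega> \<le> ereal x)" for \<omega>
      using False by (meson less_ereal.simps(1) less_imp_le less_le_trans order_less_le_trans)
    ultimately have "{\<omega>\<in>E. ereal q < A (Suc n) \<omega> \<and> A (Suc n) \<omega> < \<infinity> \<and> ep (Suc n) \<omega> \<in> {..x}} = {}"
      by blast
    moreover have "{..x} \<inter> {q<..} = {}" using False by auto
    ultimately show ?thesis
      by (simp only: N1[OF atMost_borel] N2[OF atMost_borel]) simp
  qed
  have fin1: "finite_borel_measure N1"
  proof (intro finite_borel_measure.intro finite_borel_measure_axioms.intro finite_measureI)
    have "emeasure N1 UNIV < \<infinity>"
      by (simp add: N1 emeasure_eq_measure)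
    then show "emeasure N1 (space N1) \<noteq> \<infinity>"
      by (simp add: N1_def)
  qed (simp add: N1_def)
  have fin2: "finite_borel_measure N2"
  proof (intro finite_borel_measure.intro finite_borel_measure_axioms.intro finite_measureI)
    \<comment> \<open>Finiteness: \<open>Suc n\<close> events are active and each spends at most
      \<open>kernel_mass g\<close>.\<close>
    have "emeasure N2 UNIV \<le> (\<integral>\<^sup>+\<omega>. ennreal (Suc n * kernel_mass g) \<partial>M)"
    proof (subst N2, simp, rule nn_integral_mono)
      fix \<omega>
      have "(\<integral>\<^sup>+u. indicator (UNIV \<inter> {q<..}) u * rate n \<omega> u \<partial>lborel) \<le>
          (\<integral>\<^sup>+u. indicator {q<..} u * ennreal (intens_after n \<omega> u) \<partial>lborel)"
        by (intro nn_integral_mono) (auto simp: rate_def indicator_def)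
      also have "\<dots> \<le> ennreal (Suc n * kernel_mass g)"
        unfolding nn_integral_intens_after_Ioi using comp_after_nonneg by (intro ennreal_leI) simp
      finally show "indicator E \<omega> * (\<integral>\<^sup>+u. indicator (UNIV \<inter> {q<..}) u * rate n \<omega> u \<partial>lborel) \<le>
        ennreal (Suc n * kernel_mass g)"
        by (auto simp: indicator_def)
    qed
    also have "\<dots> < \<infinity>" by (simp add: emeasure_space_1)
    finally show "emeasure N2 (space N2) \<noteq> \<infinity>"
      by (simp add: N2_def)
  qed (simp add: N2_def)
  have "cdf N1 = cdf N2"
    unfolding cdf_def measure_def by (rule ext) (simp only: eq)
  then have "N1 = N2" by (rule cdf_unique'[OF fin1 fin2])
  then show ?thesis using N1[OF B] N2[OF B] by simp
qed

section \<open>The joint law of the epochs\<close>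

abbreviation epochs :: "nat \<Rightarrow> 'a \<Rightarrow> nat \<Rightarrow> real" where
  "epochs n \<omega> \<equiv> \<lambda>i\<in>{..n}. ep i \<omega>"

abbreviation extend_epochs :: "nat \<Rightarrow> 'a \<times> real \<Rightarrow> nat \<Rightarrow> real" where
  "extend_epochs n x \<equiv> \<lambda>i\<in>{..Suc n}. if i \<le> n then ep i (fst x) else snd x"

lemma epochs_measurable[measurable]: "epochs n \<in> measurable M (\<Pi>\<^sub>M i\<in>{..n}. borel)"
  by (rule measurable_restrict) simp

lemma extend_epochs_measurable[measurable]:
  "extend_epochs n \<in> measurable (M \<Otimes>\<^sub>M lborel) (\<Pi>\<^sub>M i\<in>{..Suc n}. borel)"
  by (rule measurable_restrict) simp

text \<open>
  The event that the \<open>n\<close>-th epoch is at most \<open>q\<close> is observable at time \<open>q\<close>, so the martingale property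
  yields this identity on \<open>{v n \<le> q < v (Suc n)}\<close>; these sets with rational \<open>q\<close> cover the support.
\<close>

lemma distr_epochs_Suc:
  "distr (density M (indicator {\<omega>\<in>space M. A (Suc n) \<omega> < \<infinity>})) (\<Pi>\<^sub>M i\<in>{..Suc n}. borel) (epochs (Suc n)) =
   distr (density (M \<Otimes>\<^sub>M lborel) (\<lambda>(\<omega>, u). rate n \<omega> u)) (\<Pi>\<^sub>M i\<in>{..Suc n}. borel) (extend_epochs n)"
  (is "?N1 = ?N2")
proof -
  let ?V = "\<Pi>\<^sub>M i\<in>{..Suc n}. (borel :: real measure)"
  let ?S = "{\<omega>\<in>space M. A (Suc n) \<omega> < \<infinity>}"
  let ?Q = "{q\<in>\<rat>. 0 \<le> q} :: real set"
  define Q where "Q = from_nat_into ?Q"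
  have "range Q = ?Q" unfolding Q_def
    by (rule range_from_nat_into) (auto intro: countable_subset[OF _ countable_rat] exI[of _ 0])
  then have Q0: "0 \<le> Q m" for m by (metis (mono_tags, lifting) mem_Collect_eq rangeI)
  define D where "D q = {v\<in>space ?V. v n \<le> q \<and> q < v (Suc n)}" for q
  have D_sets: "D q \<in> sets ?V" for q
    unfolding D_def by measurable
  have cover: "v \<in> (\<Union>m. D (Q m))" if v: "v \<in> space ?V" "0 \<le> v n" "v n < v (Suc n)" for v
  proof -
    obtain q where "q \<in> \<rat>" "v n < q" "q < v (Suc n)"
      using Rats_dense_in_real[OF v(3)] by blast
    moreover from this obtain m where "q = Q m"
      using \<open>range Q = ?Q\<close> v(2) by (metis (mono_tags, lifting) imageE less_imp_le mem_Collect_eq order_trans)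
    ultimately show ?thesis using v(1) by (auto simp: D_def intro!: exI[of _ m])
  qed
  have sp: "epochs (Suc n) \<omega> \<in> space ?V" for \<omega> by (auto simp: space_PiM)
  have sp': "extend_epochs n x \<in> space ?V" for x by (auto simp: space_PiM)
  have N2: "emeasure ?N2 X = (\<integral>\<^sup>+x. (case x of (\<omega>, u) \<Rightarrow> rate n \<omega> u) * indicator X (extend_epochs n x) \<partial>(M \<Otimes>\<^sub>M lborel))"
    if [measurable]: "X \<in> sets ?V" for X
  proof -
    have "emeasure ?N2 X = (\<integral>\<^sup>+y. indicator X y \<partial>?N2)"
      by simp
    also have "\<dots> = (\<integral>\<^sup>+x. indicator X (extend_epochs n x) \<partial>density (M \<Otimes>\<^sub>M lborel) (\<lambda>(\<omega>, u). rate n \<omega> u))"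
      by (intro nn_integral_distr; measurable)
    also have "\<dots> = (\<integral>\<^sup>+x. (case x of (\<omega>, u) \<Rightarrow> rate n \<omega> u) * indicator X (extend_epochs n x) \<partial>(M \<Otimes>\<^sub>M lborel))"
      by (intro nn_integral_density; measurable)
    finally show ?thesis .
  qed
  show ?thesis
  proof (rule measure_eqI_countable_cover[where \<Omega>="\<lambda>m. D (Q m)"])
    show "sets ?N2 = sets ?N1" by simp
    show "D (Q m) \<in> sets ?N1" for m using D_sets by simp
    have "\<omega> \<in> ?S \<Longrightarrow> epochs (Suc n) \<omega> \<in> (\<Union>m. D (Q m))" for \<omega>
      by (intro cover sp) (auto simp: ep_nonneg ep_less)
    then show "AE x in ?N1. x \<in> (\<Union>m. D (Q m))"
      using D_sets by (subst AE_distr_iff) (auto simp: AE_density indicator_def)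
    have "extend_epochs n (\<omega>, u) \<in> (\<Union>m. D (Q m))" if "\<omega> \<in> space M" "rate n \<omega> u \<noteq> 0" for \<omega> u
    proof (intro cover sp')
      have less: "A n \<omega> < ereal u" using that by (auto simp: rate_def split: if_splits)
      then have "ereal (ep n \<omega>) = A n \<omega>" by (intro ereal_ep that) auto
      then have "ep n \<omega> < u" using less by (metis less_ereal.simps(1))
      then show "extend_epochs n (\<omega>, u) n < extend_epochs n (\<omega>, u) (Suc n)" by simp
    qed (use that in \<open>auto simp: ep_nonneg\<close>)
    then show "AE x in ?N2. x \<in> (\<Union>m. D (Q m))"
      using D_sets by (subst AE_distr_iff) (auto simp: AE_density space_pair_measure intro!: AE_I2)
    fix m C assume "C \<in> sets ?N1"
    then have C: "C \<in> sets ?V" by simp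
    \<comment> \<open>On one piece the two finite-dimensional measures are compared on rectangles;
      the condition on the first epochs becomes an event of \<open>F (Q m)\<close>.\<close>
    have "density ?N1 (indicator (D (Q m))) = density ?N2 (indicator (D (Q m)))"
    proof (rule measure_eqI_PiM_finite)
      show "finite {..Suc n}" by simp
      show "sets (density ?N1 (indicator (D (Q m)))) = sets ?V" "sets (density ?N2 (indicator (D (Q m)))) = sets ?V"
        by simp_all
      show "range (\<lambda>_::nat. \<Pi>\<^sub>E i\<in>{..Suc n}. UNIV) \<subseteq> prod_algebra {..Suc n} (\<lambda>_. borel)"
        by (auto intro!: prod_algebraI_finite)
      show "(\<Union>_::nat. \<Pi>\<^sub>E i\<in>{..Suc n}. UNIV) = space ?V" by (simp add: space_PiM)
      show "emeasure (density ?N1 (indicator (D (Q m)))) (\<Pi>\<^sub>E i\<in>{..Suc n}. UNIV) \<noteq> \<infinity>"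
      proof -
        have U: "(\<Pi>\<^sub>E i\<in>{..Suc n}. UNIV) \<in> sets ?V" using sets.top[of ?V] by (simp add: space_PiM)
        then have "emeasure (density ?N1 (indicator (D (Q m)))) (\<Pi>\<^sub>E i\<in>{..Suc n}. UNIV) =
          emeasure M (?S \<inter> (epochs (Suc n) -` (D (Q m) \<inter> (\<Pi>\<^sub>E i\<in>{..Suc n}. UNIV)) \<inter> space M))"
          using D_sets by (subst emeasure_restricted; simp) (subst emeasure_distr; simp add: emeasure_restricted)
        then show ?thesis by (simp add: emeasure_eq_measure)
      qed
      fix B :: "nat \<Rightarrow> real set" assume "\<And>i. i \<in> {..Suc n} \<Longrightarrow> B i \<in> sets borel"
      then have B: "\<And>i. i \<le> Suc n \<Longrightarrow> B i \<in> sets borel" by simp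
      let ?B = "Pi\<^sub>E {..Suc n} B"
      have PB: "?B \<in> sets ?V" using B by (auto intro!: sets_PiM_I_finite)
      \<comment> \<open>On \<open>D (Q m)\<close> the bound on \<open>A n\<close> entails the bounds
        on all earlier epochs. Imposing them explicitly makes each condition separately observable
        at time \<open>Q m\<close>.\<close>
      let ?E = "{\<omega>\<in>space M. \<forall>i\<in>{..n}. A i \<omega> \<le> ereal (Q m) \<and> ep i \<omega> \<in> B i}"
      have E: "?E \<in> sets (F (Q m))"
      proof -
        have "?E = (\<Inter>i\<in>{..n}. {\<omega>\<in>space M. A i \<omega> \<le> ereal (Q m) \<and> ep i \<omega> \<in> B i})" by auto
        also have "\<dots> \<in> sets (F (Q m))"
          using F_ep[OF Q0 B] by (intro sets.finite_INT) auto
        finally show ?thesis .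
      qed
      have EM[measurable]: "?E \<in> sets M" using E subalgebra_F by (auto simp: subalgebra_def)
      have "emeasure (density ?N1 (indicator (D (Q m)))) ?B =
          emeasure M (?S \<inter> (epochs (Suc n) -` (D (Q m) \<inter> ?B) \<inter> space M))"
        using D_sets PB by (subst emeasure_restricted; simp) (subst emeasure_distr; simp add: emeasure_restricted)
      also have "?S \<inter> (epochs (Suc n) -` (D (Q m) \<inter> ?B) \<inter> space M) =
          {\<omega>\<in>?E. ereal (Q m) < A (Suc n) \<omega> \<and> A (Suc n) \<omega> < \<infinity> \<and> ep (Suc n) \<omega> \<in> B (Suc n)}"
        (is "?X = ?Y")
      proof (intro set_eqI iffI)
        fix \<omega> assume x: "\<omega> \<in> ?X"
        then have \<omega>: "\<omega> \<in> space M" and fin: "A (Suc n) \<omega> < \<infinity>" by auto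
        have "A i \<omega> \<le> ereal (Q m)" if "i \<le> n" for i
        proof -
          have "A n \<omega> < \<infinity>" using A_mono[OF \<omega>, of n "Suc n"] fin by auto
          then have "A n \<omega> \<le> ereal (Q m)" using x by (simp add: A_le_iff[OF \<omega>] D_def)
          then show ?thesis using A_mono[OF \<omega> that] by (rule order_trans[rotated])
        qed
        moreover have "ereal (Q m) < A (Suc n) \<omega>"
          using x by (simp add: D_def flip: ereal_ep[OF \<omega> fin])
        ultimately show "\<omega> \<in> ?Y" using x \<omega> fin by (auto simp: PiE_iff)
      next
        fix \<omega> assume y: "\<omega> \<in> ?Y"
        then have \<omega>: "\<omega> \<in> space M" and fin: "A (Suc n) \<omega> < \<infinity>" by auto
        have "ep n \<omega> \<le> Q m" using y by (auto simp: A_le_iff[OF \<omega>])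
        moreover have "Q m < ep (Suc n) \<omega>"
          using y by (simp flip: ereal_ep[OF \<omega> fin])
        moreover have "ep i \<omega> \<in> B i" if "i \<le> Suc n" for i
          using y that by (cases "i = Suc n") auto
        ultimately show "\<omega> \<in> ?X" using \<omega> fin sp[of \<omega>] by (auto simp: D_def PiE_iff)
      qed
      also have "emeasure M ?Y =
          (\<integral>\<^sup>+\<omega>. indicator ?E \<omega> * (\<integral>\<^sup>+u. indicator (B (Suc n) \<inter> {Q m<..}) u * rate n \<omega> u \<partial>lborel) \<partial>M)"
        using B by (intro prob_next_event[OF Q0 E]) auto
      also have "\<dots> = (\<integral>\<^sup>+\<omega>. (\<integral>\<^sup>+u. rate n \<omega> u * indicator (D (Q m) \<inter> ?B) (extend_epochs n (\<omega>, u)) \<partial>lborel) \<partial>M)"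
      proof (rule nn_integral_cong)
        fix \<omega> assume \<omega>[measurable]: "\<omega> \<in> space M"
        have [measurable]: "B (Suc n) \<in> sets borel" using B by simp
        have "indicator ?E \<omega> * (\<integral>\<^sup>+u. indicator (B (Suc n) \<inter> {Q m<..}) u * rate n \<omega> u \<partial>lborel) =
            (\<integral>\<^sup>+u. indicator ?E \<omega> * (indicator (B (Suc n) \<inter> {Q m<..}) u * rate n \<omega> u) \<partial>lborel)"
          by (rule nn_integral_cmult[symmetric]) measurable
        also have "\<dots> = (\<integral>\<^sup>+u. rate n \<omega> u * indicator (D (Q m) \<inter> ?B) (extend_epochs n (\<omega>, u)) \<partial>lborel)"
        proof (rule nn_integral_cong)
          fix u
          show "indicator ?E \<omega> * (indicator (B (Suc n) \<inter> {Q m<..}) u * rate n \<omega> u) =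
            rate n \<omega> u * indicator (D (Q m) \<inter> ?B) (extend_epochs n (\<omega>, u))"
          \<comment> \<open>A nonzero rate forces \<open>A n \<omega> < u\<close>, so all epochs up
            to \<open>n\<close> are finite and \<open>ep\<close> gives their true values, not the
            default 0.\<close>
          proof (cases "rate n \<omega> u = 0")
            case False
            then have "A n \<omega> < ereal u" by (auto simp: rate_def split: if_splits)
            then have fin: "A i \<omega> < \<infinity>" if "i \<le> n" for i
              using A_mono[OF \<omega> that] by auto
            have "ep i \<omega> \<le> ep n \<omega>" if "i \<le> n" for i
              using ep_less[OF \<omega> fin[OF order_refl], of i] that by (cases "i = n") auto
            then have "\<omega> \<in> ?E \<longleftrightarrow> ep n \<omega> \<le> Q m \<and> (\<forall>i\<in>{..n}. ep i \<omega> \<in> B i)"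
              using fin \<omega> by (auto simp: A_le_iff[OF \<omega>] intro: order_trans)
            then have E': "indicator ?E \<omega> = (of_bool (ep n \<omega> \<le> Q m \<and> (\<forall>i\<in>{..n}. ep i \<omega> \<in> B i)) :: ennreal)"
              by (simp only: indicator_def)
            have "extend_epochs n (\<omega>, u) \<in> ?B \<longleftrightarrow> (\<forall>i\<in>insert (Suc n) {..n}. (if i \<le> n then ep i \<omega> else u) \<in> B i)"
              by (simp add: PiE_iff atMost_Suc)
            also have "\<dots> \<longleftrightarrow> u \<in> B (Suc n) \<and> (\<forall>i\<in>{..n}. ep i \<omega> \<in> B i)"
              by simp
            finally have "extend_epochs n (\<omega>, u) \<in> D (Q m) \<inter> ?B \<longleftrightarrow>
                ep n \<omega> \<le> Q m \<and> Q m < u \<and> (\<forall>i\<in>{..n}. ep i \<omega> \<in> B i) \<and> u \<in> B (Suc n)"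
              using sp'[of "(\<omega>, u)"] unfolding D_def by auto
            then have D': "indicator (D (Q m) \<inter> ?B) (extend_epochs n (\<omega>, u)) =
                (of_bool (ep n \<omega> \<le> Q m \<and> Q m < u \<and> (\<forall>i\<in>{..n}. ep i \<omega> \<in> B i) \<and> u \<in> B (Suc n)) :: ennreal)"
              by (simp only: indicator_def)
            show ?thesis unfolding E' D' by (auto simp: indicator_def)
          qed simp
        qed
        finally show "indicator ?E \<omega> * (\<integral>\<^sup>+u. indicator (B (Suc n) \<inter> {Q m<..}) u * rate n \<omega> u \<partial>lborel) =
          (\<integral>\<^sup>+u. rate n \<omega> u * indicator (D (Q m) \<inter> ?B) (extend_epochs n (\<omega>, u)) \<partial>lborel)" .
      qed
      also have "\<dots> = (\<integral>\<^sup>+x. (case x of (\<omega>, u) \<Rightarrow> rate n \<omega> u) * indicator (D (Q m) \<inter> ?B) (extend_epochs n x) \<partial>(M \<Otimes>\<^sub>M lborel))"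
        using D_sets PB by (subst lborel.nn_integral_fst[symmetric]) simp_all
      also have "\<dots> = emeasure ?N2 (D (Q m) \<inter> ?B)"
        using D_sets PB by (intro N2[symmetric]) auto
      also have "\<dots> = emeasure (density ?N2 (indicator (D (Q m)))) ?B"
        using D_sets PB by (simp add: emeasure_restricted)
      finally show "emeasure (density ?N1 (indicator (D (Q m)))) ?B = emeasure (density ?N2 (indicator (D (Q m)))) ?B" .
    qed
    then have "emeasure (density ?N1 (indicator (D (Q m)))) C = emeasure (density ?N2 (indicator (D (Q m)))) C"
      by simp
    then show "emeasure ?N1 (C \<inter> D (Q m)) = emeasure ?N2 (C \<inter> D (Q m))"
      using C D_sets by (simp add: emeasure_restricted Int_commute)
  qed
qed

text \<open>The integral form of \<open>distr_epochs_Suc\<close>. The right-hand side still contains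
  \<open>A (Suc n)\<close> through the cut-off in \<open>rate\<close>, so this is a hazard identity
  and not yet a formula for the law.\<close>

lemma nn_integral_next_event:
  assumes y[measurable]: "y \<in> borel_measurable (\<Pi>\<^sub>M i\<in>{..Suc n}. borel)"
  shows "(\<integral>\<^sup>+\<omega>. indicator {\<omega>. A (Suc n) \<omega> < \<infinity>} \<omega> * y (epochs (Suc n) \<omega>) \<partial>M) =
    (\<integral>\<^sup>+\<omega>. \<integral>\<^sup>+u. rate n \<omega> u * y (extend_epochs n (\<omega>, u)) \<partial>lborel \<partial>M)"
proof -
  let ?S = "{\<omega>\<in>space M. A (Suc n) \<omega> < \<infinity>}"
  let ?V = "\<Pi>\<^sub>M i\<in>{..Suc n}. (borel :: real measure)"
  have "(\<integral>\<^sup>+\<omega>. indicator {\<omega>. A (Suc n) \<omega> < \<infinity>} \<omega> * y (epochs (Suc n) \<omega>) \<partial>M) =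
      (\<integral>\<^sup>+\<omega>. indicator ?S \<omega> * y (epochs (Suc n) \<omega>) \<partial>M)"
    by (intro nn_integral_cong) (auto simp: indicator_def)
  also have "\<dots> = (\<integral>\<^sup>+\<omega>. y (epochs (Suc n) \<omega>) \<partial>density M (indicator ?S))"
    by (intro nn_integral_density[symmetric]) measurable
  also have "\<dots> = (\<integral>\<^sup>+v. y v \<partial>distr (density M (indicator ?S)) ?V (epochs (Suc n)))"
    by (intro nn_integral_distr[symmetric]; measurable)
  also have "\<dots> = (\<integral>\<^sup>+v. y v \<partial>distr (density (M \<Otimes>\<^sub>M lborel) (\<lambda>(\<omega>, u). rate n \<omega> u)) ?V (extend_epochs n))"
    by (simp only: distr_epochs_Suc)
  also have "\<dots> = (\<integral>\<^sup>+x. y (extend_epochs n x) \<partial>density (M \<Otimes>\<^sub>M lborel) (\<lambda>(\<omega>, u). rate n \<omega> u))"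
    by (intro nn_integral_distr; measurable)
  also have "\<dots> = (\<integral>\<^sup>+x. (case x of (\<omega>, u) \<Rightarrow> rate n \<omega> u) * y (extend_epochs n x) \<partial>(M \<Otimes>\<^sub>M lborel))"
    by (intro nn_integral_density; measurable)
  also have "\<dots> = (\<integral>\<^sup>+\<omega>. \<integral>\<^sup>+u. rate n \<omega> u * y (extend_epochs n (\<omega>, u)) \<partial>lborel \<partial>M)"
    by (subst lborel.nn_integral_fst[symmetric]) simp_all
  finally show ?thesis .
qed

section \<open>Transformed epochs and the change of time\<close>

abbreviation te :: "nat \<Rightarrow> 'a \<Rightarrow> real" where
  "te \<equiv> transformed_epoch g A"

abbreviation tvec :: "nat \<Rightarrow> 'a \<Rightarrow> nat \<Rightarrow> real" where
  "tvec n \<omega> \<equiv> \<lambda>i\<in>{1..n}. te i \<omega>"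

lemma te_ep: "te i \<omega> = (\<Sum>j<i. G (ep i \<omega> - ep j \<omega>))"
  by (simp add: transformed_epoch_def ep_def)

lemma te_Suc: "te (Suc n) \<omega> = comp_after n \<omega> (ep (Suc n) \<omega>)"
  by (simp add: te_ep comp_after_def)

lemma te_comp_after: "te n \<omega> = comp_after n \<omega> (ep n \<omega>)"
  by (simp add: te_ep comp_after_def G_nonpos)

lemma te_measurable[measurable]: "te i \<in> borel_measurable M"
  unfolding te_ep[abs_def] by measurable

lemma tvec_measurable[measurable]: "tvec n \<in> measurable M (\<Pi>\<^sub>M i\<in>{1..n}. borel)"
  by (rule measurable_restrict) simp

lemma te_Suc_ge:
  assumes "\<omega> \<in> space M" "A (Suc n) \<omega> < \<infinity>"
  shows "te n \<omega> \<le> te (Suc n) \<omega>"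
  unfolding te_Suc te_comp_after[of n] using ep_less[OF assms, of n] by (intro comp_after_mono) simp

lemma te_le: "te (Suc n) \<omega> \<le> Suc n * kernel_mass g"
  unfolding te_Suc by (rule comp_after_le)

lemma te_le': "te n \<omega> \<le> Suc n * kernel_mass g"
  unfolding te_comp_after[of n] by (rule comp_after_le)

text \<open>The compensator value at which growth under the events up to \<open>A n\<close> ends, by the next event or by exhaustion.\<close>

definition te_limit :: "nat \<Rightarrow> 'a \<Rightarrow> real" where
  "te_limit n \<omega> = (if A (Suc n) \<omega> < \<infinity> then te (Suc n) \<omega> else Suc n * kernel_mass g)"

lemma te_limit_measurable[measurable]: "te_limit n \<in> borel_measurable M"
  unfolding te_limit_def by measurable

lemma te_limit_ge: "\<omega> \<in> space M \<Longrightarrow> te n \<omega> \<le> te_limit n \<omega>"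
  unfolding te_limit_def using te_Suc_ge te_le' by simp

lemma te_limit_le: "te_limit n \<omega> \<le> Suc n * kernel_mass g"
  unfolding te_limit_def using te_le by simp

text \<open>Formally the substitution \<open>x = comp_after n \<omega> u\<close> with derivative
  \<open>intens_after n \<omega> u\<close>. Since \<open>comp_after\<close> can be flat, it is
  carried out for the measure \<open>N\<close> with density \<open>rate n \<omega>\<close>: up to
  the shift by \<open>te n \<omega>\<close> its cdf is \<open>comp_after\<close> wherever the rate
  is positive, and \<open>distr_cdf_no_atoms\<close> turns \<open>N\<close> into Lebesgue measure on
  an interval.\<close>

lemma nn_integral_rate_comp_after:
  assumes \<omega>[measurable]: "\<omega> \<in> space M" and fin: "A n \<omega> < \<infinity>" and f[measurable]: "f \<in> borel_measurable borel"
  shows "(\<integral>\<^sup>+u. rate n \<omega> u * f (comp_after n \<omega> u) \<partial>lborel) =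
    (\<integral>\<^sup>+x. indicator {te n \<omega><..te_limit n \<omega>} x * f x \<partial>lborel)"
proof -
  let ?T = "A (Suc n) \<omega>" and ?e = "ep n \<omega>"
  define N where "N = density lborel (rate n \<omega>)"
  have e: "ereal ?e = A n \<omega>" using \<omega> fin by (rule ereal_ep)
  have eT: "ereal ?e < ?T" unfolding e using A_Suc_less[OF \<omega> fin] .
  have rm[measurable]: "rate n \<omega> \<in> borel_measurable borel"
    using measurable_Pair2[OF rate_measurable \<omega>] by simp
  have rate: "rate n \<omega> u = indicator {?e<..} u * indicator {u. ereal u \<le> ?T} u * ennreal (intens_after n \<omega> u)" for u
    by (auto simp: rate_def indicator_def simp flip: e)
  have N_le: "emeasure N {..t} = ennreal (comp_after n \<omega> (real_of_ereal (min (ereal t) ?T)) - te n \<omega>)"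
    if "?e \<le> t" for t
  proof -
    have "emeasure N {..t} = (\<integral>\<^sup>+u. indicator {?e<..t} u * indicator {u. ereal u \<le> ?T} u * ennreal (intens_after n \<omega> u) \<partial>lborel)"
      unfolding N_def by (subst emeasure_density) (auto intro!: nn_integral_cong simp: rate indicator_def)
    then show ?thesis
      using nn_integral_stopped_intens_after[OF \<omega> that] eT by (simp add: te_comp_after[of n])
  qed
  have N_UNIV: "emeasure N UNIV = ennreal (te_limit n \<omega> - te n \<omega>)"
  proof (cases "?T < \<infinity>")
    case True
    then have T: "ereal (ep (Suc n) \<omega>) = ?T" using \<omega> by (intro ereal_ep)
    have "emeasure N UNIV = (\<integral>\<^sup>+u. rate n \<omega> u * indicator {..ep (Suc n) \<omega>} u \<partial>lborel)"
      unfolding N_def by (subst emeasure_density) (auto intro!: nn_integral_cong simp: rate_def indicator_def simp flip: T)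
    also have "\<dots> = emeasure N {..ep (Suc n) \<omega>}"
      unfolding N_def by (subst emeasure_density) simp_all
    also have "\<dots> = ennreal (te_limit n \<omega> - te n \<omega>)"
      using True ep_less[OF \<omega> True, of n] by (subst N_le) (simp_all add: T te_limit_def te_Suc flip: ep_def)
    finally show ?thesis .
  next
    case False
    \<comment> \<open>Without a further event the intensity is never switched off, and the active
      events spend their whole mass.\<close>
    then have "rate n \<omega> u = indicator {?e<..} u * ennreal (intens_after n \<omega> u)" for u
      by (simp add: rate indicator_def)
    then have "emeasure N UNIV = (\<integral>\<^sup>+u. indicator {?e<..} u * ennreal (intens_after n \<omega> u) \<partial>lborel)"
      unfolding N_def by (subst emeasure_density) simp_all
    then show ?thesis
      using False by (simp add: nn_integral_intens_after_Ioi te_limit_def te_comp_after[of n])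
  qed
  interpret N: finite_borel_measure N
    by (intro finite_borel_measure.intro finite_borel_measure_axioms.intro finite_measureI)
      (use N_UNIV in \<open>simp_all add: N_def\<close>)
  have atoms: "measure N {x} = 0" for x
  proof -
    have "emeasure N {x} = (\<integral>\<^sup>+u. rate n \<omega> x * indicator {x} u \<partial>lborel)"
      unfolding N_def by (subst emeasure_density) (auto intro!: nn_integral_cong simp: indicator_def)
    also have "\<dots> = 0" by (simp add: nn_integral_cmult)
    finally show ?thesis by (simp add: measure_def)
  qed
  \<comment> \<open>After the next event the cdf of \<open>N\<close> stops growing while
    \<open>comp_after\<close> may continue; there the rate is 0 and the integrand vanishes.\<close>
  have cdf: "comp_after n \<omega> u = te n \<omega> + cdf N u" if "rate n \<omega> u \<noteq> 0" for u
  proof -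
    have u: "?e < u" "ereal u \<le> ?T" using that by (auto simp: rate_def split: if_splits simp flip: e)
    then have "emeasure N {..u} = ennreal (comp_after n \<omega> u - te n \<omega>)"
      by (subst N_le) (simp_all add: min_absorb1)
    moreover have "te n \<omega> \<le> comp_after n \<omega> u"
      unfolding te_comp_after[of n] using u by (intro comp_after_mono) simp
    ultimately show ?thesis by (simp add: cdf_def measure_def)
  qed
  have cdf_m[measurable]: "cdf N \<in> borel_measurable borel"
    by (rule borel_measurable_mono) (simp add: mono_def N.cdf_nondecreasing)
  have "(\<integral>\<^sup>+u. rate n \<omega> u * f (comp_after n \<omega> u) \<partial>lborel) = (\<integral>\<^sup>+u. rate n \<omega> u * f (te n \<omega> + cdf N u) \<partial>lborel)"
    using cdf by (intro nn_integral_cong) (metis mult_zero_left)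
  also have "\<dots> = (\<integral>\<^sup>+u. f (te n \<omega> + cdf N u) \<partial>N)"
    unfolding N_def[symmetric] by (subst (2) N_def, subst nn_integral_density) simp_all
  also have "\<dots> = (\<integral>\<^sup>+x. f (te n \<omega> + x) \<partial>distr N borel (cdf N))"
    by (rule nn_integral_distr[symmetric]) (simp_all add: N_def[symmetric] measurable_cong_sets[OF N.M_is_borel refl])
  also have "\<dots> = (\<integral>\<^sup>+x. indicator {0<..<measure N UNIV} x * f (te n \<omega> + x) \<partial>lborel)"
    unfolding distr_cdf_no_atoms[OF N.finite_borel_measure_axioms atoms]
    by (subst nn_integral_density) simp_all
  \<comment> \<open>The open interval from the transform and the half-open one in the statement
    differ by a single point.\<close>
  also have "\<dots> = (\<integral>\<^sup>+x. indicator {te n \<omega><..te_limit n \<omega>} (te n \<omega> + x) * f (te n \<omega> + x) \<partial>lborel)"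
  proof (rule nn_integral_cong_AE)
    have m: "measure N UNIV = te_limit n \<omega> - te n \<omega>"
      using N_UNIV te_limit_ge[OF \<omega>] by (simp add: measure_def)
    show "AE x in lborel. indicator {0<..<measure N UNIV} x * f (te n \<omega> + x) =
      indicator {te n \<omega><..te_limit n \<omega>} (te n \<omega> + x) * f (te n \<omega> + x)"
      using AE_lborel_singleton[of "te_limit n \<omega> - te n \<omega>"]
      by eventually_elim (auto simp: indicator_def m)
  qed
  also have "\<dots> = (\<integral>\<^sup>+x. indicator {te n \<omega><..te_limit n \<omega>} x * f x \<partial>lborel)"
    by (subst (2) nn_integral_real_affine[where c=1 and t="te n \<omega>"]) simp_all
  finally show ?thesis .
qed

text \<open>The hazard identity in compensator time: given the past, the next transformed epoch has
  hazard 1 from \<open>te n\<close> until growth ends at \<open>te_limit n\<close>.\<close>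

lemma nn_integral_tvec_Suc:
  assumes f[measurable]: "f \<in> borel_measurable (\<Pi>\<^sub>M i\<in>{1..Suc n}. borel)"
  shows "(\<integral>\<^sup>+\<omega>. indicator {\<omega>. A (Suc n) \<omega> < \<infinity>} \<omega> * f (tvec (Suc n) \<omega>) \<partial>M) =
    (\<integral>\<^sup>+\<omega>. indicator {\<omega>. A n \<omega> < \<infinity>} \<omega> *
      (\<integral>\<^sup>+x. indicator {te n \<omega><..te_limit n \<omega>} x * f ((tvec n \<omega>)(Suc n := x)) \<partial>lborel) \<partial>M)"
proof -
  \<comment> \<open>The transformed epochs depend on the path only through the epochs, so
    \<open>nn_integral_next_event\<close> applies to any function of them.\<close>
  define tr where "tr v = (\<lambda>i\<in>{1..Suc n}. \<Sum>j<i. G (v i - v j))" for v :: "nat \<Rightarrow> real"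
  have tr[measurable]: "tr \<in> measurable (\<Pi>\<^sub>M i\<in>{..Suc n}. borel) (\<Pi>\<^sub>M i\<in>{1..Suc n}. borel)"
    unfolding tr_def
  proof (rule measurable_restrict)
    fix i assume i: "i \<in> {1..Suc n}"
    have [measurable]: "(\<lambda>v. v j) \<in> borel_measurable (\<Pi>\<^sub>M i\<in>{..Suc n}. (borel :: real measure))" if "j \<le> i" for j
      using that i by (intro measurable_component_singleton) simp
    show "(\<lambda>v. \<Sum>j<i. G (v i - v j)) \<in> borel_measurable (\<Pi>\<^sub>M i\<in>{..Suc n}. borel)"
      by (intro borel_measurable_sum) simp
  qed
  have tr1: "tr (epochs (Suc n) \<omega>) = tvec (Suc n) \<omega>" for \<omega>
    unfolding tr_def te_ep by (rule restrict_ext) (auto intro!: sum.cong)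
  have tr2: "tr (extend_epochs n (\<omega>, u)) = (tvec n \<omega>)(Suc n := comp_after n \<omega> u)" for \<omega> u
  proof
    fix i
    consider "i \<in> {1..n}" | "i = Suc n" | "i \<notin> {1..Suc n}" by force
    then show "tr (extend_epochs n (\<omega>, u)) i = ((tvec n \<omega>)(Suc n := comp_after n \<omega> u)) i"
      by cases (auto simp: tr_def te_ep comp_after_def intro!: sum.cong)
  qed
  have "(\<integral>\<^sup>+\<omega>. indicator {\<omega>. A (Suc n) \<omega> < \<infinity>} \<omega> * f (tr (epochs (Suc n) \<omega>)) \<partial>M) =
      (\<integral>\<^sup>+\<omega>. \<integral>\<^sup>+u. rate n \<omega> u * f (tr (extend_epochs n (\<omega>, u))) \<partial>lborel \<partial>M)"
    by (rule nn_integral_next_event[of "\<lambda>v. f (tr v)"]) measurable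
  also have "\<dots> = (\<integral>\<^sup>+\<omega>. indicator {\<omega>. A n \<omega> < \<infinity>} \<omega> *
      (\<integral>\<^sup>+x. indicator {te n \<omega><..te_limit n \<omega>} x * f ((tvec n \<omega>)(Suc n := x)) \<partial>lborel) \<partial>M)"
  proof (rule nn_integral_cong)
    fix \<omega> assume \<omega>: "\<omega> \<in> space M"
    have "(\<lambda>x. f ((tvec n \<omega>)(Suc n := x))) \<in> borel_measurable borel"
    proof -
      have "(\<lambda>x. (tvec n \<omega>)(Suc n := x)) = (\<lambda>x. \<lambda>i\<in>{1..Suc n}. if i = Suc n then x else te i \<omega>)"
        by (auto simp: fun_eq_iff)
      also have "\<dots> \<in> measurable borel (\<Pi>\<^sub>M i\<in>{1..Suc n}. borel)"
        by (rule measurable_restrict) simp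
      finally show ?thesis using f by (rule measurable_compose)
    qed
    note * = nn_integral_rate_comp_after[OF \<omega> _ this]
    show "(\<integral>\<^sup>+u. rate n \<omega> u * f (tr (extend_epochs n (\<omega>, u))) \<partial>lborel) = indicator {\<omega>. A n \<omega> < \<infinity>} \<omega> *
      (\<integral>\<^sup>+x. indicator {te n \<omega><..te_limit n \<omega>} x * f ((tvec n \<omega>)(Suc n := x)) \<partial>lborel)"
    proof (cases "A n \<omega> < \<infinity>")
      case True
      then show ?thesis unfolding tr2 *[OF True] by simp
    next
      case False
      then have "rate n \<omega> u = 0" for u by (auto simp: rate_def)
      then show ?thesis using False by simp
    qed
  qed
  finally show ?thesis unfolding tr1 .
qed

text \<open>
  The next transformed epoch exceeds its predecessor by an exponential variable of rate 1, truncated at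
  \<open>Suc n * kernel_mass g\<close>. The proof tests the hazard rate identity against \<open>exp\<close>; the bound on \<open>\<phi>\<close> keeps
  the term that is cancelled finite.
\<close>

lemma nn_integral_survival:
  fixes x :: real
  assumes \<phi>[measurable]: "\<phi> \<in> borel_measurable (\<Pi>\<^sub>M i\<in>{1..n}. borel)" and phi_le_1: "\<And>v. \<phi> v \<le> (1 :: ennreal)"
  shows "ennreal (exp (min x (Suc n * kernel_mass g))) * (\<integral>\<^sup>+\<omega>. (if A n \<omega> < \<infinity> \<and> te n \<omega> < x \<and>
      \<not> (A (Suc n) \<omega> < \<infinity> \<and> te (Suc n) \<omega> < x) then \<phi> (tvec n \<omega>) else 0) \<partial>M) =
    (\<integral>\<^sup>+\<omega>. (if A n \<omega> < \<infinity> \<and> te n \<omega> < x then \<phi> (tvec n \<omega>) * ennreal (exp (te n \<omega>)) else 0) \<partial>M)"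
    (is "?d * ?r = ?c")
proof -
  \<comment> \<open>The contribution of the paths whose next transformed epoch lies below
    \<open>x\<close>. The hazard identity rewrites it as an integral of \<open>exp\<close> from
    \<open>te n\<close> to \<open>min x (te_limit n)\<close>, and adding \<open>?c\<close> restores
    the lower end point of that integral.\<close>
  define a where "a = (\<integral>\<^sup>+\<omega>. (if A (Suc n) \<omega> < \<infinity> \<and> te (Suc n) \<omega> < x
    then \<phi> (tvec n \<omega>) * ennreal (exp (te (Suc n) \<omega>)) else 0) \<partial>M)"
  let ?f = "\<lambda>v. \<phi> (restrict v {1..n}) * (indicator {..<x} (v (Suc n)) * ennreal (exp (v (Suc n))))"
  have m: "?f \<in> borel_measurable (\<Pi>\<^sub>M i\<in>{1..Suc n}. borel)"
  proof -
    have [measurable]: "(\<lambda>v. restrict v {1..n}) \<in> measurable (\<Pi>\<^sub>M i\<in>{1..Suc n}. borel) (\<Pi>\<^sub>M i\<in>{1..n}. (borel :: real measure))"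
      by (rule measurable_restrict_subset) auto
    have [measurable]: "(\<lambda>v. v (Suc n)) \<in> borel_measurable (\<Pi>\<^sub>M i\<in>{1..Suc n}. (borel :: real measure))"
      by (rule measurable_component_singleton) simp
    show ?thesis by measurable
  qed
  have F_m[measurable]: "(\<lambda>\<omega>. \<phi> (tvec n \<omega>)) \<in> borel_measurable M" by measurable
  have r1: "restrict (tvec (Suc n) \<omega>) {1..n} = tvec n \<omega>" for \<omega> by auto
  have r2: "restrict ((tvec n \<omega>)(Suc n := y)) {1..n} = tvec n \<omega>" for \<omega> y by auto
  have "a = (\<integral>\<^sup>+\<omega>. indicator {\<omega>. A (Suc n) \<omega> < \<infinity>} \<omega> * ?f (tvec (Suc n) \<omega>) \<partial>M)"
    unfolding a_def r1 by (intro nn_integral_cong) (auto simp: indicator_def)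
  also have "\<dots> = (\<integral>\<^sup>+\<omega>. indicator {\<omega>. A n \<omega> < \<infinity>} \<omega> *
      (\<integral>\<^sup>+y. indicator {te n \<omega><..te_limit n \<omega>} y * ?f ((tvec n \<omega>)(Suc n := y)) \<partial>lborel) \<partial>M)"
    by (rule nn_integral_tvec_Suc[OF m])
  also have "\<dots> = (\<integral>\<^sup>+\<omega>. (if A n \<omega> < \<infinity> \<and> te n \<omega> < x
      then \<phi> (tvec n \<omega>) * ennreal (exp (min x (te_limit n \<omega>)) - exp (te n \<omega>)) else 0) \<partial>M)"
  proof (rule nn_integral_cong)
    fix \<omega> assume \<omega>: "\<omega> \<in> space M"
    have "(\<integral>\<^sup>+y. indicator {te n \<omega><..te_limit n \<omega>} y * ?f ((tvec n \<omega>)(Suc n := y)) \<partial>lborel) =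
        (\<integral>\<^sup>+y. \<phi> (tvec n \<omega>) * (indicator {te n \<omega><..te_limit n \<omega>} y * (indicator {..<x} y * ennreal (exp y))) \<partial>lborel)"
      unfolding r2 by (intro nn_integral_cong) (simp add: mult.left_commute)
    also have "\<dots> = \<phi> (tvec n \<omega>) * (\<integral>\<^sup>+y. indicator {te n \<omega><..te_limit n \<omega>} y * (indicator {..<x} y * ennreal (exp y)) \<partial>lborel)"
      by (intro nn_integral_cmult) measurable
    finally show "indicator {\<omega>. A n \<omega> < \<infinity>} \<omega> *
      (\<integral>\<^sup>+y. indicator {te n \<omega><..te_limit n \<omega>} y * ?f ((tvec n \<omega>)(Suc n := y)) \<partial>lborel) =
      (if A n \<omega> < \<infinity> \<and> te n \<omega> < x
      then \<phi> (tvec n \<omega>) * ennreal (exp (min x (te_limit n \<omega>)) - exp (te n \<omega>)) else 0)"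
      using te_limit_ge[OF \<omega>, of n] unfolding nn_integral_exp_cut by (auto simp: indicator_def)
  qed
  finally have "a + ?c = (\<integral>\<^sup>+\<omega>. (if A n \<omega> < \<infinity> \<and> te n \<omega> < x
      then \<phi> (tvec n \<omega>) * ennreal (exp (min x (te_limit n \<omega>)) - exp (te n \<omega>)) else 0) \<partial>M) + ?c"
    by simp
  also have "\<dots> = (\<integral>\<^sup>+\<omega>. (if A n \<omega> < \<infinity> \<and> te n \<omega> < x
      then \<phi> (tvec n \<omega>) * ennreal (exp (min x (te_limit n \<omega>)) - exp (te n \<omega>)) else 0) +
      (if A n \<omega> < \<infinity> \<and> te n \<omega> < x then \<phi> (tvec n \<omega>) * ennreal (exp (te n \<omega>)) else 0) \<partial>M)"
    by (intro nn_integral_add[symmetric]) measurable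
  \<comment> \<open>Pointwise the sum is \<open>exp\<close> at the end point
    \<open>min x (te_limit n)\<close>. If the next epoch comes before \<open>x\<close>, this is the
    integrand of \<open>a\<close>; otherwise it is the factor \<open>?d\<close>, which does not
    depend on the path.\<close>
  also have "\<dots> = (\<integral>\<^sup>+\<omega>. (if A (Suc n) \<omega> < \<infinity> \<and> te (Suc n) \<omega> < x then \<phi> (tvec n \<omega>) * ennreal (exp (te (Suc n) \<omega>)) else 0) +
      ?d * (if A n \<omega> < \<infinity> \<and> te n \<omega> < x \<and> \<not> (A (Suc n) \<omega> < \<infinity> \<and> te (Suc n) \<omega> < x) then \<phi> (tvec n \<omega>) else 0) \<partial>M)"
  proof (rule nn_integral_cong)
    fix \<omega> assume \<omega>: "\<omega> \<in> space M"
    let ?m = "min x (te_limit n \<omega>)"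
    have "\<phi> (tvec n \<omega>) * ennreal (exp ?m - exp (te n \<omega>)) + \<phi> (tvec n \<omega>) * ennreal (exp (te n \<omega>)) = \<phi> (tvec n \<omega>) * ennreal (exp ?m)"
      if "te n \<omega> < x"
      using te_limit_ge[OF \<omega>, of n] that
      by (simp add: distrib_left[symmetric] ennreal_plus[symmetric] del: ennreal_plus)
    then have "(if A n \<omega> < \<infinity> \<and> te n \<omega> < x then \<phi> (tvec n \<omega>) * ennreal (exp ?m - exp (te n \<omega>)) else 0) +
      (if A n \<omega> < \<infinity> \<and> te n \<omega> < x then \<phi> (tvec n \<omega>) * ennreal (exp (te n \<omega>)) else 0) =
      (if A n \<omega> < \<infinity> \<and> te n \<omega> < x then \<phi> (tvec n \<omega>) * ennreal (exp ?m) else 0)" (is "?l = ?l'")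
      by simp
    also have "?l' = (if A (Suc n) \<omega> < \<infinity> \<and> te (Suc n) \<omega> < x then \<phi> (tvec n \<omega>) * ennreal (exp (te (Suc n) \<omega>)) else 0) +
      ?d * (if A n \<omega> < \<infinity> \<and> te n \<omega> < x \<and> \<not> (A (Suc n) \<omega> < \<infinity> \<and> te (Suc n) \<omega> < x) then \<phi> (tvec n \<omega>) else 0)"
    proof (cases "A (Suc n) \<omega> < \<infinity> \<and> te (Suc n) \<omega> < x")
      case True
      then have "A n \<omega> < \<infinity>" using A_mono[OF \<omega>, of n "Suc n"] by auto
      moreover have "te n \<omega> < x" using True te_Suc_ge[OF \<omega>, of n] by auto
      ultimately show ?thesis using True by (simp add: te_limit_def)
    next
      case False
      \<comment> \<open>A next epoch at or beyond \<open>x\<close> and no next epoch at all lead to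
        the same end point, because \<open>te (Suc n)\<close> never exceeds
        \<open>Suc n * kernel_mass g\<close>.\<close>
      then have m: "?m = min x (Suc n * kernel_mass g)"
        using te_le[of n \<omega>] by (auto simp: te_limit_def min_def)
      show ?thesis
        by (simp only: False m if_False simp_thms add_0) (simp only: if_distrib[where f="(*) _"] mult.commute mult_zero_right mult_zero_left)
    qed
    finally show "?l = \<dots>" .
  qed
  also have "\<dots> = a + ?d * ?r"
    unfolding a_def
    by (subst nn_integral_cmult[symmetric], measurable) (intro nn_integral_add; measurable)
  finally have eq: "a + ?c = a + ?d * ?r" .
  have "a \<le> (\<integral>\<^sup>+\<omega>. ennreal (exp x) \<partial>M)"
    unfolding a_def
  proof (rule nn_integral_mono)
    fix \<omega>
    show "(if A (Suc n) \<omega> < \<infinity> \<and> te (Suc n) \<omega> < x then \<phi> (tvec n \<omega>) * ennreal (exp (te (Suc n) \<omega>)) else 0) \<le> ennreal (exp x)"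
      using mult_mono[OF phi_le_1[of "tvec n \<omega>"] ennreal_leI[of "exp (te (Suc n) \<omega>)" "exp x"]] by auto
  qed
  also have "\<dots> < \<infinity>" by (simp add: emeasure_space_1)
  finally have "a \<noteq> \<infinity>" by simp
  with eq show ?thesis by (simp only: ennreal_add_left_cancel) auto
qed

section \<open>The weighted law as Lebesgue measure on the chamber\<close>

text \<open>The weight \<open>exp (te n)\<close> is the reciprocal of the probability that a rate 1
  exponential clock has not rung by \<open>te n\<close>, so it undoes the density of the transformed
  epochs. In the induction the last coordinate \<open>x\<close> is fixed first: survival up to
  \<open>x\<close> turns \<open>exp x\<close> into \<open>exp (te n)\<close>, which is the weight of
  the induction hypothesis.\<close>

lemma nn_integral_exp_te:
  assumes "B \<in> sets (\<Pi>\<^sub>M i\<in>{1..n}. borel)"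
  shows "(\<integral>\<^sup>+\<omega>. (if A n \<omega> < \<infinity> then indicator B (tvec n \<omega>) * ennreal (exp (te n \<omega>)) else 0) \<partial>M) =
    (\<integral>\<^sup>+v. indicator (parking_chamber (kernel_mass g) n) v * indicator B v \<partial>(\<Pi>\<^sub>M i\<in>{1..n}. lborel))"
  using assms
proof (induction n arbitrary: B)
  case 0
  have "(\<integral>\<^sup>+\<omega>. (if A 0 \<omega> < \<infinity> then indicator B (tvec 0 \<omega>) * ennreal (exp (te 0 \<omega>)) else 0) \<partial>M) =
      (\<integral>\<^sup>+\<omega>. indicator B (\<lambda>_. undefined) \<partial>M)"
    by (intro nn_integral_cong) (simp add: A_0 te_ep restrict_def)
  also have "\<dots> = indicator B (\<lambda>_. undefined)" by (simp add: emeasure_space_1)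
  finally show ?case
    by (simp add: PiM_empty nn_integral_count_space_finite parking_chamber_def)
next
  case (Suc n)
  let ?r = "kernel_mass g"
  let ?P = "\<lambda>n. parking_chamber (kernel_mass g) n"
  let ?V = "\<lambda>n. \<Pi>\<^sub>M i\<in>{1..n}. (borel :: real measure)"
  let ?L = "\<lambda>n. \<Pi>\<^sub>M i\<in>{1..n}. (lborel :: real measure)"
  interpret P: product_sigma_finite "\<lambda>_. lborel :: real measure"
    by (rule product_sigma_finite.intro) (rule lborel.sigma_finite_measure_axioms)
  interpret MB: pair_sigma_finite M "lborel :: real measure"
    by (rule pair_sigma_finite.intro) (rule sigma_finite_measure_axioms, rule lborel.sigma_finite_measure_axioms)
  have sets: "sets (?L n) = sets (?V n)" for n by (intro sets_PiM_cong) simp_all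
  have I: "{1..Suc n} = insert (Suc n) {1..n}" and I': "{1..Suc n} = {1..n} \<union> {Suc n}" by auto
  have B[measurable]: "B \<in> sets (?V (Suc n))" by fact
  have upd: "(\<lambda>p. (tvec n (fst p))(Suc n := snd p)) \<in> measurable (M \<Otimes>\<^sub>M borel) (?V (Suc n))"
    by (rule measurable_fun_upd[OF I']) measurable
  have upd': "(\<lambda>v. v(Suc n := x)) \<in> measurable (?V n) (?V (Suc n))" for x
    by (rule measurable_fun_upd[OF I']) measurable
  \<comment> \<open>For \<open>n = 0\<close> there is no coordinate to compare with;
    \<open>te 0 = 0\<close> supplies the lower bound.\<close>
  define cut where "cut x = {v\<in>space (?V n). (if n = 0 then 0 else v n) < x}" for x :: real
  define slice where "slice x = (\<lambda>v. v(Suc n := x)) -` B \<inter> space (?V n)" for x :: real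
  have cut_m: "cut x \<in> sets (?V n)" for x
  proof (cases "n = 0")
    case False
    then have [measurable]: "(\<lambda>v. v n) \<in> borel_measurable (?V n)"
      by (intro measurable_component_singleton) simp
    show ?thesis unfolding cut_def by measurable
  qed (simp add: cut_def)
  have slice_m: "slice x \<in> sets (?V n)" for x
    unfolding slice_def using upd' B by (rule measurable_sets)
  have sp: "tvec n \<omega> \<in> space (?V n)" for \<omega> by (auto simp: space_PiM)
  have cut_iff: "tvec n \<omega> \<in> cut x \<longleftrightarrow> te n \<omega> < x" for \<omega> x
    using sp[of \<omega>] by (auto simp: cut_def te_ep)
  have slice_iff: "tvec n \<omega> \<in> slice x \<longleftrightarrow> (tvec n \<omega>)(Suc n := x) \<in> B" for \<omega> x
    using sp[of \<omega>] by (auto simp: slice_def)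
  have slice_ind: "indicator (slice x) (tvec n \<omega>) = (indicator B ((tvec n \<omega>)(Suc n := x)) :: ennreal)" for \<omega> x
    by (simp only: indicator_def slice_iff)
  have cut_ind: "indicator (slice x \<inter> cut x) (tvec n \<omega>) =
      (if te n \<omega> < x then indicator (slice x) (tvec n \<omega>) else 0 :: ennreal)" for \<omega> x
    by (cases "te n \<omega> < x") (simp_all only: indicator_def Int_iff cut_iff simp_thms if_True if_False of_bool_eq)
  \<comment> \<open>For \<open>x\<close> up to the exhaustion level,
    \<open>x \<le> te_limit n \<omega>\<close> says that no next transformed epoch lies below
    \<open>x\<close>. This is the event in \<open>nn_integral_survival\<close>, and the minimum in
    its exponent is \<open>x\<close>. Above that level both sides vanish.\<close>
  have fibre: "(\<integral>\<^sup>+\<omega>. (if A n \<omega> < \<infinity> \<and> te n \<omega> < x \<and> x \<le> te_limit n \<omega>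
        then indicator B ((tvec n \<omega>)(Suc n := x)) * ennreal (exp x) else 0) \<partial>M) =
      (\<integral>\<^sup>+v. indicator (?P (Suc n)) (v(Suc n := x)) * indicator B (v(Suc n := x)) \<partial>?L n)" for x
  proof (cases "x \<le> Suc n * ?r")
    case True
    have lim: "x \<le> te_limit n \<omega> \<longleftrightarrow> \<not> (A (Suc n) \<omega> < \<infinity> \<and> te (Suc n) \<omega> < x)" for \<omega>
      using True by (auto simp: te_limit_def)
    have m: "(\<lambda>\<omega>. if A n \<omega> < \<infinity> \<and> te n \<omega> < x \<and> \<not> (A (Suc n) \<omega> < \<infinity> \<and> te (Suc n) \<omega> < x)
        then indicator (slice x) (tvec n \<omega>) else 0 :: ennreal) \<in> borel_measurable M"
      using slice_m by measurable
    have "(\<integral>\<^sup>+\<omega>. (if A n \<omega> < \<infinity> \<and> te n \<omega> < x \<and> x \<le> te_limit n \<omega>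
        then indicator B ((tvec n \<omega>)(Suc n := x)) * ennreal (exp x) else 0) \<partial>M) =
      (\<integral>\<^sup>+\<omega>. ennreal (exp x) * (if A n \<omega> < \<infinity> \<and> te n \<omega> < x \<and> \<not> (A (Suc n) \<omega> < \<infinity> \<and> te (Suc n) \<omega> < x)
        then indicator (slice x) (tvec n \<omega>) else 0) \<partial>M)"
      unfolding lim slice_ind by (intro nn_integral_cong) (auto simp: mult.commute)
    also have "\<dots> = ennreal (exp x) * (\<integral>\<^sup>+\<omega>. (if A n \<omega> < \<infinity> \<and> te n \<omega> < x \<and> \<not> (A (Suc n) \<omega> < \<infinity> \<and> te (Suc n) \<omega> < x)
        then indicator (slice x) (tvec n \<omega>) else 0) \<partial>M)"
      using m by (rule nn_integral_cmult)
    also have "\<dots> = (\<integral>\<^sup>+\<omega>. (if A n \<omega> < \<infinity> \<and> te n \<omega> < x then indicator (slice x) (tvec n \<omega>) * ennreal (exp (te n \<omega>)) else 0) \<partial>M)"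
      using nn_integral_survival[OF borel_measurable_indicator[OF slice_m] indicator_le_1_ennreal, of x x] True
      by (simp only: min_absorb1)
    also have "\<dots> = (\<integral>\<^sup>+\<omega>. (if A n \<omega> < \<infinity> then indicator (slice x \<inter> cut x) (tvec n \<omega>) * ennreal (exp (te n \<omega>)) else 0) \<partial>M)"
      unfolding cut_ind by (intro nn_integral_cong) auto
    \<comment> \<open>The induction hypothesis for all points that \<open>x\<close> extends to a
      point of \<open>B\<close> with an admissible last step.\<close>
    also have "\<dots> = (\<integral>\<^sup>+v. indicator (?P n) v * indicator (slice x \<inter> cut x) v \<partial>?L n)"
      by (intro Suc.IH sets.Int slice_m cut_m)
    also have "\<dots> = (\<integral>\<^sup>+v. indicator (?P (Suc n)) (v(Suc n := x)) * indicator B (v(Suc n := x)) \<partial>?L n)"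
    proof (rule nn_integral_cong)
      fix v assume "v \<in> space (?L n)"
      then have v: "v \<in> space (?V n)" "v \<in> extensional {1..n}" by (auto simp: space_PiM PiE_iff)
      have "v(Suc n := x) \<in> ?P (Suc n) \<longleftrightarrow> v \<in> ?P n \<and> v \<in> cut x"
        unfolding parking_chamber_Suc[OF v(2)] using True v(1) by (auto simp: cut_def mult.commute)
      moreover have "v(Suc n := x) \<in> B \<longleftrightarrow> v \<in> slice x" using v(1) by (simp add: slice_def)
      ultimately show "indicator (?P n) v * indicator (slice x \<inter> cut x) v =
        (indicator (?P (Suc n)) (v(Suc n := x)) * indicator B (v(Suc n := x)) :: ennreal)"
        by (simp add: indicator_def)
    qed
    finally show ?thesis .
  next
    case False
    have "\<not> x \<le> te_limit n \<omega>" for \<omega> using te_limit_le[of n \<omega>] False by simp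
    moreover have "v(Suc n := x) \<notin> ?P (Suc n)" if "v \<in> space (?L n)" for v
      using that False by (subst parking_chamber_Suc) (auto simp: space_PiM PiE_iff mult.commute)
    then have "(\<integral>\<^sup>+v. indicator (?P (Suc n)) (v(Suc n := x)) * indicator B (v(Suc n := x)) \<partial>?L n) = (\<integral>\<^sup>+v. 0 \<partial>?L n)"
      by (intro nn_integral_cong) simp
    ultimately show ?thesis by simp
  qed
  have "(\<integral>\<^sup>+\<omega>. (if A (Suc n) \<omega> < \<infinity> then indicator B (tvec (Suc n) \<omega>) * ennreal (exp (te (Suc n) \<omega>)) else 0) \<partial>M) =
      (\<integral>\<^sup>+\<omega>. indicator {\<omega>. A (Suc n) \<omega> < \<infinity>} \<omega> *
        (\<lambda>v. indicator B v * ennreal (exp (v (Suc n)))) (tvec (Suc n) \<omega>) \<partial>M)"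
    by (intro nn_integral_cong) (simp add: indicator_def)
  also have "\<dots> = (\<integral>\<^sup>+\<omega>. indicator {\<omega>. A n \<omega> < \<infinity>} \<omega> * (\<integral>\<^sup>+x. indicator {te n \<omega><..te_limit n \<omega>} x *
      (\<lambda>v. indicator B v * ennreal (exp (v (Suc n)))) ((tvec n \<omega>)(Suc n := x)) \<partial>lborel) \<partial>M)"
  proof (rule nn_integral_tvec_Suc)
    have [measurable]: "(\<lambda>v. v (Suc n)) \<in> borel_measurable (?V (Suc n))"
      by (rule measurable_component_singleton) simp
    show "(\<lambda>v. indicator B v * ennreal (exp (v (Suc n)))) \<in> borel_measurable (?V (Suc n))"
      by measurable
  qed
  also have "\<dots> = (\<integral>\<^sup>+\<omega>. (\<integral>\<^sup>+x. (if A n \<omega> < \<infinity> \<and> te n \<omega> < x \<and> x \<le> te_limit n \<omega>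
        then indicator B ((tvec n \<omega>)(Suc n := x)) * ennreal (exp x) else 0) \<partial>lborel) \<partial>M)"
  proof (rule nn_integral_cong)
    fix \<omega>
    show "indicator {\<omega>. A n \<omega> < \<infinity>} \<omega> * (\<integral>\<^sup>+x. indicator {te n \<omega><..te_limit n \<omega>} x *
      (\<lambda>v. indicator B v * ennreal (exp (v (Suc n)))) ((tvec n \<omega>)(Suc n := x)) \<partial>lborel) =
      (\<integral>\<^sup>+x. (if A n \<omega> < \<infinity> \<and> te n \<omega> < x \<and> x \<le> te_limit n \<omega>
        then indicator B ((tvec n \<omega>)(Suc n := x)) * ennreal (exp x) else 0) \<partial>lborel)"
      by (cases "A n \<omega> < \<infinity>") (auto intro!: nn_integral_cong simp: indicator_def)
  qed
  \<comment> \<open>The integral over paths has to come first, because survival up to a fixed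
    \<open>x\<close> is a statement about the law and not about a single path.\<close>
  also have "\<dots> = (\<integral>\<^sup>+x. (\<integral>\<^sup>+\<omega>. (if A n \<omega> < \<infinity> \<and> te n \<omega> < x \<and> x \<le> te_limit n \<omega>
        then indicator B ((tvec n \<omega>)(Suc n := x)) * ennreal (exp x) else 0) \<partial>M) \<partial>lborel)"
  proof (rule MB.Fubini'[symmetric])
    have [measurable]: "(\<lambda>p. indicator B ((tvec n (fst p))(Suc n := snd p)) :: ennreal) \<in> borel_measurable (M \<Otimes>\<^sub>M borel)"
      by (rule measurable_compose[OF upd]) (rule borel_measurable_indicator[OF B])
    have "(\<lambda>p. if A n (fst p) < \<infinity> \<and> te n (fst p) < snd p \<and> snd p \<le> te_limit n (fst p)
        then indicator B ((tvec n (fst p))(Suc n := snd p)) * ennreal (exp (snd p)) else 0) \<in> borel_measurable (M \<Otimes>\<^sub>M borel)"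
      by measurable
    then show "(\<lambda>(\<omega>, x). if A n \<omega> < \<infinity> \<and> te n \<omega> < x \<and> x \<le> te_limit n \<omega>
        then indicator B ((tvec n \<omega>)(Suc n := x)) * ennreal (exp x) else 0) \<in> borel_measurable (M \<Otimes>\<^sub>M lborel)"
      by (simp add: case_prod_unfold cong: measurable_cong_sets)
  qed
  also have "\<dots> = (\<integral>\<^sup>+x. (\<integral>\<^sup>+v. indicator (?P (Suc n)) (v(Suc n := x)) * indicator B (v(Suc n := x)) \<partial>?L n) \<partial>lborel)"
    by (simp only: fibre)
  also have "\<dots> = (\<integral>\<^sup>+v. indicator (?P (Suc n)) v * indicator B v \<partial>?L (Suc n))"
  proof -
    have "(\<lambda>v. indicator (?P (Suc n)) v * indicator B v :: ennreal) \<in> borel_measurable (?V (Suc n))"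
      by measurable
    then have "(\<lambda>v. indicator (?P (Suc n)) v * indicator B v :: ennreal) \<in> borel_measurable (?L (Suc n))"
      using measurable_cong_sets[OF sets refl] by blast
    then show ?thesis
      unfolding I by (intro P.product_nn_integral_insert_rev[symmetric]) simp_all
  qed
  finally show ?case .
qed

text \<open>Survival beyond the exhaustion level means that no further event ever comes. There the
  exponential factor has settled at the constant \<open>exp (Suc n * kernel_mass g)\<close>.\<close>

lemma emeasure_cluster_tvec:
  assumes B[measurable]: "B \<in> sets (\<Pi>\<^sub>M i\<in>{1..n}. borel)"
  shows "ennreal (exp (Suc n * kernel_mass g)) * emeasure M {\<omega>\<in>space M. cluster_size A \<omega> = enat (Suc n) \<and> tvec n \<omega> \<in> B} =
    (\<integral>\<^sup>+v. indicator (parking_chamber (kernel_mass g) n) v * indicator B v \<partial>(\<Pi>\<^sub>M i\<in>{1..n}. lborel))"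
proof -
  \<comment> \<open>Any level above \<open>Suc n * kernel_mass g\<close> would do: no transformed
    epoch \<open>te n\<close> or \<open>te (Suc n)\<close> reaches it, so the conditions involving
    \<open>?x\<close> hold automatically.\<close>
  let ?x = "Suc n * kernel_mass g + 1"
  have [measurable]: "Measurable.pred M (\<lambda>\<omega>. tvec n \<omega> \<in> B)"
    by (rule pred_sets2[OF B tvec_measurable])
  have min_x: "min ?x (Suc n * kernel_mass g) = Suc n * kernel_mass g" by simp
  have lt: "te n \<omega> < ?x" "te (Suc n) \<omega> < ?x" for \<omega>
    using te_le'[of n \<omega>] te_le[of n \<omega>] by simp_all
  let ?S = "{\<omega>\<in>space M. A n \<omega> < \<infinity> \<and> \<not> A (Suc n) \<omega> < \<infinity> \<and> tvec n \<omega> \<in> B}"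
  have "emeasure M ?S = (\<integral>\<^sup>+\<omega>. indicator ?S \<omega> \<partial>M)"
    by (rule nn_integral_indicator[symmetric]) measurable
  also have "\<dots> = (\<integral>\<^sup>+\<omega>. (if A n \<omega> < \<infinity> \<and> te n \<omega> < ?x \<and> \<not> (A (Suc n) \<omega> < \<infinity> \<and> te (Suc n) \<omega> < ?x)
      then indicator B (tvec n \<omega>) else 0) \<partial>M)"
    using lt by (intro nn_integral_cong) (auto simp: indicator_def)
  finally have S: "emeasure M ?S = \<dots>" .
  have "{\<omega>\<in>space M. cluster_size A \<omega> = enat (Suc n) \<and> tvec n \<omega> \<in> B} = ?S"
    by (auto simp: cluster_size_eq_iff)
  then have "ennreal (exp (Suc n * kernel_mass g)) * emeasure M {\<omega>\<in>space M. cluster_size A \<omega> = enat (Suc n) \<and> tvec n \<omega> \<in> B} =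
      (\<integral>\<^sup>+\<omega>. (if A n \<omega> < \<infinity> \<and> te n \<omega> < ?x then indicator B (tvec n \<omega>) * ennreal (exp (te n \<omega>)) else 0) \<partial>M)"
    using nn_integral_survival[OF borel_measurable_indicator[OF B] indicator_le_1_ennreal, of ?x]
    unfolding min_x by (simp only: S)
  also have "\<dots> = (\<integral>\<^sup>+\<omega>. (if A n \<omega> < \<infinity> then indicator B (tvec n \<omega>) * ennreal (exp (te n \<omega>)) else 0) \<partial>M)"
    using lt by (intro nn_integral_cong) simp
  also have "\<dots> = (\<integral>\<^sup>+v. indicator (parking_chamber (kernel_mass g) n) v * indicator B v \<partial>(\<Pi>\<^sub>M i\<in>{1..n}. lborel))"
    by (rule nn_integral_exp_te[OF B])
  finally show ?thesis .
qed

end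

section \<open>Normalisation and the conditional law\<close>

theorem theorem1:
  fixes M :: "'a measure" and g :: "real \<Rightarrow> real" and A :: "nat \<Rightarrow> 'a \<Rightarrow> ereal" and k :: nat
  assumes g_nonneg: "\<And>t. 0 \<le> t \<Longrightarrow> 0 \<le> g t"
    and g_integrable: "set_integrable lborel {0..} g"
    and mass: "0 < kernel_mass g" "kernel_mass g < 1"
    and cluster: "hawkes_cluster M g A"
  shows "(\<forall>i\<in>{1..k}.
            distr (given_cluster_size M A (k + 1)) borel (transformed_epoch g A i)
            = distr (parking_uniform k) borel (\<lambda>x. kernel_mass g * diff_order_stat i x))
       \<and> distr (given_cluster_size M A (k + 1)) (\<Pi>\<^sub>M i\<in>{1..k}. borel)
              (\<lambda>\<omega>. \<lambda>i\<in>{1..k}. transformed_epoch g A i \<omega>)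
            = distr (parking_uniform k) (\<Pi>\<^sub>M i\<in>{1..k}. borel)
              (\<lambda>x. \<lambda>i\<in>{1..k}. kernel_mass g * diff_order_stat i x)"
proof -
  interpret prob_space M
    using cluster by (simp add: hawkes_cluster_def)
  interpret hawkes_process g M A
    by unfold_locales (use assms in auto)
  let ?r = "kernel_mass g"
  let ?S = "{\<omega> \<in> space M. cluster_size A \<omega> = enat (k + 1)}"
  let ?V = "\<Pi>\<^sub>M i\<in>{1..k}. (borel :: real measure)"
  let ?L = "\<Pi>\<^sub>M i\<in>{1..k}. (lborel :: real measure)"
  let ?d = "\<lambda>x. \<lambda>i\<in>{1..k}. ?r * diff_order_stat i x"
  let ?C = "given_cluster_size M A (k + 1)"
  let ?e = "ennreal (exp (Suc k * ?r))"
  let ?vol = "\<lambda>B. \<integral>\<^sup>+v. indicator (parking_chamber ?r k) v * indicator B v \<partial>?L"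
  \<comment> \<open>Only the shape of the density is kept; the constant enters solely through the
    total mass 1.\<close>
  obtain c where c: "distr (parking_uniform k) ?V ?d =
      density ?L (\<lambda>y. c * indicator (parking_chamber ?r k) y)"
    using distr_parking_uniform[OF mass(1), of k] by blast
  have sets: "sets ?L = sets ?V" by (intro sets_PiM_cong) simp_all
  have d: "?d \<in> measurable (parking_uniform k) ?V"
    by (rule measurable_restrict) measurable
  have parking: "emeasure (distr (parking_uniform k) ?V ?d) B = c * ?vol B" if "B \<in> sets ?V" for B
  proof -
    have B: "B \<in> sets ?L" "parking_chamber ?r k \<in> sets ?L"
      using that parking_chamber_sets unfolding sets by blast+
    have "emeasure (distr (parking_uniform k) ?V ?d) B =
        (\<integral>\<^sup>+v. c * (indicator (parking_chamber ?r k) v * indicator B v) \<partial>?L)"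
      unfolding c using B by (subst emeasure_density) (auto simp: mult.assoc)
    also have "\<dots> = c * ?vol B"
      using B by (intro nn_integral_cmult) auto
    finally show ?thesis .
  qed
  have V: "space ?V \<in> sets ?V" by simp
  have unit: "c * ?vol (space ?V) = 1"
    unfolding parking[OF V, symmetric]
    using prob_space.emeasure_space_1[OF prob_space.prob_space_distr[OF prob_space_parking_uniform d]] by simp
  have tv: "tvec k \<in> measurable M ?V" by measurable
  have hawkes_vol: "?e * emeasure M (?S \<inter> (tvec k -` B \<inter> space M)) = ?vol B" if "B \<in> sets ?V" for B
  proof -
    have "?S \<inter> (tvec k -` B \<inter> space M) =
        {\<omega>\<in>space M. cluster_size A \<omega> = enat (Suc k) \<and> tvec k \<omega> \<in> B}" by auto
    then show ?thesis using emeasure_cluster_tvec[OF that] by (simp only:)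
  qed
  have S: "?S \<in> sets M"
  proof -
    have "?S = {\<omega> \<in> space M. A k \<omega> < \<infinity> \<and> \<not> A (Suc k) \<omega> < \<infinity>}"
      using cluster_size_eq_iff[of _ k] by auto
    also have "\<dots> \<in> sets M" by measurable
    finally show ?thesis .
  qed
  have "tvec k -` space ?V \<inter> space M = space M"
    using measurable_space[OF tv] by auto
  then have "?e * emeasure M ?S = ?vol (space ?V)"
    using hawkes_vol[OF V] sets.Int_space_eq2[OF S] by simp
  \<comment> \<open>Both total masses refer to the same volume. This equation shows that the event
    of exactly \<open>k + 1\<close> events is not null, and it supplies the normalising constant of
    the conditional law.\<close>
  then have unit': "c * ?e * emeasure M ?S = 1"
    using unit by (simp only: mult.assoc)
  then have S0: "emeasure M ?S \<noteq> 0" by (metis mult_zero_right zero_neq_one)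
  have joint: "distr ?C ?V (tvec k) = distr (parking_uniform k) ?V ?d"
  proof (rule measure_eqI)
    fix B assume "B \<in> sets (distr ?C ?V (tvec k))"
    then have B: "B \<in> sets ?V" by simp
    let ?E = "tvec k -` B \<inter> space M"
    have E: "?E \<in> sets M" using tv B by (rule measurable_sets)
    have tC: "tvec k \<in> measurable ?C ?V"
      using tv unfolding given_cluster_size_def by simp
    have "emeasure (distr ?C ?V (tvec k)) B = emeasure M (?S \<inter> ?E) / emeasure M ?S"
      using B S E unfolding emeasure_distr[OF tC B] by (simp add: given_cluster_size_def)
    \<comment> \<open>A factor 1 is inserted through \<open>unit'\<close>; afterwards
      \<open>emeasure M ?S\<close>, which is nonzero and finite, cancels.\<close>
    also have "\<dots> = (c * ?e * emeasure M ?S) * emeasure M (?S \<inter> ?E) / emeasure M ?S"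
      unfolding unit' by simp
    also have "\<dots> = (c * (?e * emeasure M (?S \<inter> ?E))) * emeasure M ?S / emeasure M ?S"
      by (simp only: mult_ac)
    also have "\<dots> = c * (?e * emeasure M (?S \<inter> ?E))"
      using S0 by (intro ennreal_mult_divide_eq) (simp_all add: emeasure_eq_measure)
    also have "\<dots> = emeasure (distr (parking_uniform k) ?V ?d) B"
      unfolding hawkes_vol[OF B] parking[OF B] ..
    finally show "emeasure (distr ?C ?V (tvec k)) B = emeasure (distr (parking_uniform k) ?V ?d) B" .
  qed simp
  \<comment> \<open>The marginals are images of the joint law under coordinate projections.\<close>
  moreover have "distr ?C borel (te i) = distr (parking_uniform k) borel (\<lambda>x. ?r * diff_order_stat i x)"
    if i: "i \<in> {1..k}" for i
  proof -
    have tC: "tvec k \<in> measurable ?C ?V"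
      using tv unfolding given_cluster_size_def by simp
    have p: "(\<lambda>v. v i) \<in> borel_measurable ?V" using i by (rule measurable_component_singleton)
    have "distr ?C borel (te i) = distr (distr ?C ?V (tvec k)) borel (\<lambda>v. v i)"
      using i by (subst distr_distr[OF p tC]) (simp add: comp_def)
    also have "\<dots> = distr (distr (parking_uniform k) ?V ?d) borel (\<lambda>v. v i)"
      by (simp only: joint)
    also have "\<dots> = distr (parking_uniform k) borel (\<lambda>x. ?r * diff_order_stat i x)"
      using i by (subst distr_distr[OF p d]) (simp add: comp_def)
    finally show ?thesis .
  qed
  ultimately show ?thesis by blast
qed

end
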